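(* Let $p$ be a prime, $n\ge1$ an integer and $s>-1$ a real number. Let $\Pi:\mathrm{Mat}(n+1,\mathbb{Q}_p)\to\mathrm{Mat}(n,\mathbb{Q}_p)$ be the map $$\Pi:\begin{pmatrix} z_{11} & z_{12} \\ z_{21} & z_{22} \end{pmatrix}\mapsto z_{11}$$ sending an $(n+1)\times(n+1)$ matrix, in block form of size $n+1$, to its upper left $n\times n$ block. Then the pushforward of the measure $\mu_s^{n+1}$ under $\Pi$ is $\mu_s^n$.
   Context: $\mathbb{Q}_p$ is the field of $p$-adic numbers, $\mathbb{O}_p$ the ring of $p$-adic integers. $\mathrm{Mat}(n,\mathbb{Q}_p)$ is the space of $n\times n$ matrices over $\mathbb{Q}_p$, and $\mathrm{vol}$ is the translation-invariant (Haar) measure on it normalized by $\mathrm{vol}(\mathrm{Mat}(n,\mathbb{O}_p))=1$. $\mathrm{GL}(n,\mathbb{O}_p)$ is the group of $n\times n$ matrices over $\mathbb{O}_p$ invertible over $\mathbb{O}_p$. Any $z\in\mathrm{Mat}(n,\mathbb{Q}_p)$ can be written as $z=A\,\mathrm{diag}(p^{-k_1},\dots,p^{-k_n})\,B$ with $A,B\in\mathrm{GL}(n,\mathbb{O}_p)$ and $k_1\ge\dots\ge k_n\ge-\infty$ ($k_j$ integers or $-\infty$, with the entry $p^{-k_j}$ equal to $0$ if $k_j=-\infty$); the $k_j$ are determined by $z$. Define $\gamma(z)=\prod_{j:\,k_j>0}p^{k_j}$ (empty product equal to $1$). For $s>-1$, $\mu_s^n$ is the probability measure on $\mathrm{Mat}(n,\mathbb{Q}_p)$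 given by $d\mu_s^n(z)=c(n,s+2n)^{-1}\gamma(z)^{-s-2n}\,d\mathrm{vol}(z)$, where $c(n,\alpha)=\int_{\mathrm{Mat}(n,\mathbb{Q}_p)}\gamma(z)^{-\alpha}\,d\mathrm{vol}(z)=\prod_{j=1}^n\frac{1-p^{-\alpha+n-j}}{1-p^{-\alpha+n+j-1}}$. *)

theory Defs
  imports
    "HOL-Analysis.Analysis"
    "HOL-Library.Option_ord"
    "Berlekamp_Zassenhaus.Finite_Field"
    "Jordan_Normal_Form.Matrix"
begin

section \<open>The p-adic absolute value on the rationals\<close>

definition rat_pabs :: "nat \<Rightarrow> rat \<Rightarrow> real" where
  "rat_pabs p x = (if x = 0 then 0 else
     real p powi (int (multiplicity (int p) (snd (quotient_of x)))
                  - int (multiplicity (int p) (fst (quotient_of x)))))"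

lemma rat_pabs_0 [simp]: "rat_pabs p 0 = 0"
  by (simp add: rat_pabs_def)

lemma rat_pabs_nonneg [simp]: "0 \<le> rat_pabs p x"
  by (simp add: rat_pabs_def)

context
  fixes p :: nat
  assumes p: "prime p"
begin

lemma rat_pabs_frac:
  fixes a b :: int
  assumes "a \<noteq> 0" "b \<noteq> 0"
  shows "rat_pabs p (of_int a / of_int b) =
    real p powi (int (multiplicity (int p) b) - int (multiplicity (int p) a))"
proof -
  obtain c d where q: "quotient_of (of_int a / of_int b) = (c, d)" by fastforce
  have d: "d > 0" using quotient_of_denom_pos[OF q] .
  have eq: "(of_int a / of_int b :: rat) = of_int c / of_int d" using quotient_of_div[OF q] .
  have "of_int (a * d) = (of_int (c * b) :: rat)" using eq d assms by (simp add: field_simps)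
  then have ad: "a * d = c * b" by (simp only: of_int_eq_iff)
  have c: "c \<noteq> 0" using ad assms d by auto
  have pe: "prime_elem (int p)" using p by simp
  have "multiplicity (int p) (a * d) = multiplicity (int p) (c * b)" using ad by simp
  then have "multiplicity (int p) a + multiplicity (int p) d
      = multiplicity (int p) c + multiplicity (int p) b"
    using assms c d by (simp add: prime_elem_multiplicity_mult_distrib[OF pe])
  moreover have "(of_int a / of_int b :: rat) \<noteq> 0" using assms by simp
  ultimately show ?thesis unfolding rat_pabs_def q by (auto intro!: arg_cong2[where f="(powi)"])
qed

lemma rat_frac_cases:
  obtains a b :: int where "b \<noteq> 0" "(x :: rat) = of_int a / of_int b"
  by (metis Fract_of_int_quotient Rat_cases less_irrefl)

lemma rat_pabs_eq_0 [simp]: "rat_pabs p x = 0 \<longleftrightarrow> x = 0"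
  using p by (auto simp: rat_pabs_def prime_gt_0_nat)

lemma rat_pabs_1 [simp]: "rat_pabs p 1 = 1"
  using rat_pabs_frac[of 1 1] by simp

lemma rat_pabs_mult: "rat_pabs p (x * y) = rat_pabs p x * rat_pabs p y"
proof (cases "x = 0 \<or> y = 0")
  case False
  obtain a b :: int where x: "b \<noteq> 0" "x = of_int a / of_int b" by (rule rat_frac_cases)
  obtain c d :: int where y: "d \<noteq> 0" "y = of_int c / of_int d" by (rule rat_frac_cases)
  have nz: "a \<noteq> 0" "c \<noteq> 0" using False x y by auto
  have xy: "x * y = of_int (a * c) / of_int (b * d)" by (simp add: x y)
  have pe: "prime_elem (int p)" using p by simp
  have pp: "real p \<noteq> 0" using p prime_gt_0_nat by auto
  have "rat_pabs p (x * y) =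
      real p powi (int (multiplicity (int p) (b * d)) - int (multiplicity (int p) (a * c)))"
    unfolding xy using nz x y by (intro rat_pabs_frac) auto
  also have "\<dots> = real p powi ((int (multiplicity (int p) b) - int (multiplicity (int p) a))
      + (int (multiplicity (int p) d) - int (multiplicity (int p) c)))"
    using nz x y by (simp add: prime_elem_multiplicity_mult_distrib[OF pe] algebra_simps)
  also have "\<dots> = rat_pabs p x * rat_pabs p y"
    using nz x y pp by (simp add: rat_pabs_frac power_int_add)
  finally show ?thesis .
qed auto

lemma rat_pabs_minus [simp]: "rat_pabs p (- x) = rat_pabs p x"
proof -
  have "rat_pabs p (- 1) * rat_pabs p (- 1) = 1" using rat_pabs_mult[of "-1" "-1"] by simp
  then have "rat_pabs p (- 1) = 1"
    by (metis abs_of_nonneg rat_pabs_nonneg real_sqrt_abs2 real_sqrt_one)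
  then show ?thesis using rat_pabs_mult[of "-1" x] by simp
qed

lemma rat_pabs_diff_commute: "rat_pabs p (x - y) = rat_pabs p (y - x)"
  using rat_pabs_minus[of "x - y"] by simp

lemma rat_pabs_inverse: "rat_pabs p (inverse x) = inverse (rat_pabs p x)"
proof (cases "x = 0")
  case False
  then have "rat_pabs p x * rat_pabs p (inverse x) = 1"
    using rat_pabs_mult[of x "inverse x"] by simp
  then show ?thesis by (metis inverse_unique)
qed auto

lemma rat_pabs_add_le_max: "rat_pabs p (x + y) \<le> max (rat_pabs p x) (rat_pabs p y)"
proof (cases "x = 0 \<or> y = 0 \<or> x + y = 0")
  case False
  obtain a b :: int where x: "b \<noteq> 0" "x = of_int a / of_int b" by (rule rat_frac_cases)
  obtain c d :: int where y: "d \<noteq> 0" "y = of_int c / of_int d" by (rule rat_frac_cases)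
  define u v w where "u = a * d" and "v = c * b" and "w = b * d"
  have w: "w \<noteq> 0" using x y by (simp add: w_def)
  have xu: "x = of_int u / of_int w" and yv: "y = of_int v / of_int w"
    using x y by (simp_all add: u_def v_def w_def field_simps)
  then have xy: "x + y = of_int (u + v) / of_int w" by (simp add: add_divide_distrib)
  have nz: "u \<noteq> 0" "v \<noteq> 0" "u + v \<noteq> 0" using False xu yv xy by auto
  let ?m = "multiplicity (int p)"
  have pe: "prime_elem (int p)" using p by simp
  have "int p ^ min (?m u) (?m v) dvd u + v"
    by (intro dvd_add multiplicity_dvd') auto
  then have m: "min (?m u) (?m v) \<le> ?m (u + v)"
    using nz pe by (intro multiplicity_geI) (auto simp: prime_elem_not_unit)
  have p1: "real p \<ge> 1" using p prime_ge_1_nat by auto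
  have "real p powi (int (?m w) - int (?m (u + v)))
      \<le> real p powi (int (?m w) - int (min (?m u) (?m v)))"
    using m p1 by (intro power_int_increasing) auto
  also have "\<dots> \<le> max (real p powi (int (?m w) - int (?m u))) (real p powi (int (?m w) - int (?m v)))"
    by (auto simp: min_def)
  finally show ?thesis
    unfolding xy rat_pabs_frac[OF nz(3) w] unfolding xu yv using nz w by (simp add: rat_pabs_frac)
qed (auto simp: max_def)

lemma rat_pabs_triangle: "rat_pabs p (x + y) \<le> rat_pabs p x + rat_pabs p y"
  using rat_pabs_add_le_max[of x y] rat_pabs_nonneg[of p x] rat_pabs_nonneg[of p y] by linarith

lemma rat_pabs_abs_diff: "\<bar>rat_pabs p x - rat_pabs p y\<bar> \<le> rat_pabs p (x - y)"
  using rat_pabs_triangle[of "x - y" y] rat_pabs_triangle[of "y - x" x]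
    rat_pabs_diff_commute[of x y] by simp

end

section \<open>Cauchy sequences of rationals\<close>

definition pvanishes :: "nat \<Rightarrow> (nat \<Rightarrow> rat) \<Rightarrow> bool" where
  "pvanishes p X \<longleftrightarrow> (\<lambda>n. rat_pabs p (X n)) \<longlonglongrightarrow> 0"

definition pcauchy :: "nat \<Rightarrow> (nat \<Rightarrow> rat) \<Rightarrow> bool" where
  "pcauchy p X \<longleftrightarrow> (\<forall>e>0. \<exists>N. \<forall>m\<ge>N. \<forall>n\<ge>N. rat_pabs p (X m - X n) < e)"

lemma pcauchyD:
  "pcauchy p X \<Longrightarrow> 0 < e \<Longrightarrow> \<exists>N. \<forall>m\<ge>N. \<forall>n\<ge>N. rat_pabs p (X m - X n) < e"
  by (simp add: pcauchy_def)

lemma pvanishes_0 [simp]: "pvanishes p (\<lambda>n. 0)"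
  by (simp add: pvanishes_def)

lemma pcauchy_const [simp]: "pcauchy p (\<lambda>n. c)"
  by (auto simp: pcauchy_def)

context
  fixes p :: nat
  assumes p: "prime p"
begin

lemma pvanishes_bound:
  assumes "\<And>n. rat_pabs p (X n) \<le> f n" "f \<longlonglongrightarrow> 0"
  shows "pvanishes p X"
  unfolding pvanishes_def
  by (rule tendsto_sandwich[OF _ _ tendsto_const assms(2)]) (auto simp: assms(1))

lemma pvanishes_const [simp]: "pvanishes p (\<lambda>n. c) \<longleftrightarrow> c = 0"
  using rat_pabs_eq_0[OF p, of c] by (auto simp: pvanishes_def LIMSEQ_const_iff)

lemma pvanishes_minus: "pvanishes p X \<Longrightarrow> pvanishes p (\<lambda>n. - X n)"
  by (simp add: pvanishes_def rat_pabs_minus[OF p])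

lemma pvanishes_add:
  assumes "pvanishes p X" "pvanishes p Y"
  shows "pvanishes p (\<lambda>n. X n + Y n)"
  using tendsto_add[OF assms[unfolded pvanishes_def]]
  by (intro pvanishes_bound[OF rat_pabs_triangle[OF p]]) simp

lemma pvanishes_diff:
  assumes "pvanishes p X" "pvanishes p Y"
  shows "pvanishes p (\<lambda>n. X n - Y n)"
  using pvanishes_add[OF assms(1) pvanishes_minus[OF assms(2)]] by simp

lemma pcauchy_abs_convergent:
  assumes "pcauchy p X"
  shows "convergent (\<lambda>n. rat_pabs p (X n))"
proof -
  have "Cauchy (\<lambda>n. rat_pabs p (X n))"
    unfolding Cauchy_def
  proof (intro allI impI)
    fix e :: real assume "e > 0"
    from pcauchyD[OF assms this] obtain N
      where N: "\<forall>m\<ge>N. \<forall>n\<ge>N. rat_pabs p (X m - X n) < e" by blast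
    show "\<exists>M. \<forall>m\<ge>M. \<forall>n\<ge>M. dist (rat_pabs p (X m)) (rat_pabs p (X n)) < e"
      using N rat_pabs_abs_diff[OF p] unfolding dist_real_def by (meson le_less_trans)
  qed
  then show ?thesis by (rule Cauchy_convergent)
qed

lemma pcauchy_bounded:
  assumes "pcauchy p X"
  obtains B where "B > 0" "\<And>n. rat_pabs p (X n) \<le> B"
proof -
  have "Bseq (\<lambda>n. rat_pabs p (X n))"
    using pcauchy_abs_convergent[OF assms] by (rule convergent_imp_Bseq)
  then obtain K where "K > 0" "\<forall>n. norm (rat_pabs p (X n)) \<le> K" by (auto simp: Bseq_def)
  then show thesis using that[of K] by simp
qed

lemma pvanishes_mult_bounded:
  assumes "pcauchy p X" "pvanishes p Y"
  shows "pvanishes p (\<lambda>n. X n * Y n)"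
proof -
  obtain B where B: "B > 0" "\<And>n. rat_pabs p (X n) \<le> B" using pcauchy_bounded[OF assms(1)] by blast
  have "(\<lambda>n. B * rat_pabs p (Y n)) \<longlonglongrightarrow> B * 0"
    using assms(2) unfolding pvanishes_def by (intro tendsto_intros)
  then show ?thesis
    by (intro pvanishes_bound[where f = "\<lambda>n. B * rat_pabs p (Y n)"])
      (auto simp: rat_pabs_mult[OF p] intro!: mult_right_mono B)
qed

lemma pcauchy_minus [simp]: "pcauchy p X \<Longrightarrow> pcauchy p (\<lambda>n. - X n)"
proof -
  have "rat_pabs p (- X m - - X n) = rat_pabs p (X m - X n)" for m n
    using rat_pabs_diff_commute[OF p, of "X n" "X m"] by simp
  then show "pcauchy p X \<Longrightarrow> pcauchy p (\<lambda>n. - X n)" unfolding pcauchy_def by simp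
qed

lemma pcauchy_add [simp]:
  assumes "pcauchy p X" "pcauchy p Y"
  shows "pcauchy p (\<lambda>n. X n + Y n)"
  unfolding pcauchy_def
proof (intro allI impI)
  fix e :: real assume e: "e > 0"
  obtain M where M: "\<forall>m\<ge>M. \<forall>n\<ge>M. rat_pabs p (X m - X n) < e"
    using pcauchyD[OF assms(1) e] by blast
  obtain N where N: "\<forall>m\<ge>N. \<forall>n\<ge>N. rat_pabs p (Y m - Y n) < e"
    using pcauchyD[OF assms(2) e] by blast
  have "rat_pabs p (X m + Y m - (X n + Y n)) < e" if "m \<ge> max M N" "n \<ge> max M N" for m n
  proof -
    have "rat_pabs p ((X m - X n) + (Y m - Y n)) \<le>
        max (rat_pabs p (X m - X n)) (rat_pabs p (Y m - Y n))"
      by (rule rat_pabs_add_le_max[OF p])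
    also have "\<dots> < e" using M N that by auto
    finally show ?thesis by (simp add: algebra_simps)
  qed
  then show "\<exists>N. \<forall>m\<ge>N. \<forall>n\<ge>N. rat_pabs p (X m + Y m - (X n + Y n)) < e" by blast
qed

lemma pcauchy_mult [simp]:
  assumes "pcauchy p X" "pcauchy p Y"
  shows "pcauchy p (\<lambda>n. X n * Y n)"
  unfolding pcauchy_def
proof (intro allI impI)
  fix e :: real assume e: "e > 0"
  obtain A where A: "A > 0" "\<And>n. rat_pabs p (X n) \<le> A" using pcauchy_bounded[OF assms(1)] by blast
  obtain B where B: "B > 0" "\<And>n. rat_pabs p (Y n) \<le> B" using pcauchy_bounded[OF assms(2)] by blast
  obtain M where M: "\<forall>m\<ge>M. \<forall>n\<ge>M. rat_pabs p (X m - X n) < e / B"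
    using pcauchyD[OF assms(1), of "e / B"] e B by auto
  obtain N where N: "\<forall>m\<ge>N. \<forall>n\<ge>N. rat_pabs p (Y m - Y n) < e / A"
    using pcauchyD[OF assms(2), of "e / A"] e A by auto
  have "rat_pabs p (X m * Y m - X n * Y n) < e" if mn: "m \<ge> max M N" "n \<ge> max M N" for m n
  proof -
    have "X m * Y m - X n * Y n = X m * (Y m - Y n) + (X m - X n) * Y n"
      by (simp add: algebra_simps)
    then have "rat_pabs p (X m * Y m - X n * Y n) \<le>
        max (rat_pabs p (X m * (Y m - Y n))) (rat_pabs p ((X m - X n) * Y n))"
      using rat_pabs_add_le_max[OF p] by metis
    moreover have "rat_pabs p (X m * (Y m - Y n)) < e"
    proof -
      have "rat_pabs p (X m * (Y m - Y n)) \<le> A * rat_pabs p (Y m - Y n)"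
        by (simp add: rat_pabs_mult[OF p] A mult_right_mono)
      also have "\<dots> < A * (e / A)"
        using N mn A by (intro mult_strict_left_mono) auto
      finally show ?thesis using A by simp
    qed
    moreover have "rat_pabs p ((X m - X n) * Y n) < e"
    proof -
      have "rat_pabs p ((X m - X n) * Y n) \<le> rat_pabs p (X m - X n) * B"
        by (simp add: rat_pabs_mult[OF p] B mult_left_mono)
      also have "\<dots> < e / B * B"
        using M mn B by (intro mult_strict_right_mono) auto
      finally show ?thesis using B by simp
    qed
    ultimately show ?thesis by linarith
  qed
  then show "\<exists>N. \<forall>m\<ge>N. \<forall>n\<ge>N. rat_pabs p (X m * Y m - X n * Y n) < e" by blast
qed

lemma pcauchy_not_pvanishes:
  assumes "pcauchy p X" "\<not> pvanishes p X"
  obtains b N where "b > 0" "\<And>n. n \<ge> N \<Longrightarrow> rat_pabs p (X n) > b"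
proof -
  obtain L where L: "(\<lambda>n. rat_pabs p (X n)) \<longlonglongrightarrow> L"
    using pcauchy_abs_convergent[OF assms(1)] by (auto simp: convergent_def)
  have "L \<ge> 0" by (rule LIMSEQ_le_const[OF L]) auto
  moreover have "L \<noteq> 0" using L assms(2) by (auto simp: pvanishes_def)
  ultimately have "L > 0" by simp
  then have "eventually (\<lambda>n. rat_pabs p (X n) > L / 2) sequentially"
    by (intro order_tendstoD(1)[OF L]) auto
  then show thesis using that[of "L / 2"] \<open>L > 0\<close> by (auto simp: eventually_sequentially)
qed

lemma rat_pabs_inverse_diff:
  assumes "rat_pabs p x > a" "rat_pabs p y > b" "a > 0" "b > 0"
  shows "rat_pabs p (inverse x - inverse y) \<le> rat_pabs p (x - y) / (a * b)"
proof -
  have nz: "x \<noteq> 0" "y \<noteq> 0" using assms by auto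
  then have "inverse x - inverse y = - (inverse x * (x - y) * inverse y)"
    by (simp add: field_simps)
  then have "rat_pabs p (inverse x - inverse y) = rat_pabs p (- (inverse x * (x - y) * inverse y))"
    by (rule arg_cong)
  also have "\<dots> = rat_pabs p (x - y) / (rat_pabs p x * rat_pabs p y)"
    by (simp only: rat_pabs_minus[OF p] rat_pabs_mult[OF p] rat_pabs_inverse[OF p])
      (simp add: divide_inverse)
  also have "\<dots> \<le> rat_pabs p (x - y) / (a * b)"
    using assms by (intro divide_left_mono mult_mono mult_pos_pos) auto
  finally show ?thesis .
qed

lemma pcauchy_inverse [simp]:
  assumes "pcauchy p X" "\<not> pvanishes p X"
  shows "pcauchy p (\<lambda>n. inverse (X n))"
  unfolding pcauchy_def
proof (intro allI impI)
  fix e :: real assume e: "e > 0"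
  obtain b M where b: "b > 0" "\<And>n. n \<ge> M \<Longrightarrow> rat_pabs p (X n) > b"
    by (rule pcauchy_not_pvanishes[OF assms]) blast
  obtain N where N: "\<forall>m\<ge>N. \<forall>n\<ge>N. rat_pabs p (X m - X n) < e * (b * b)"
    using pcauchyD[OF assms(1), of "e * (b * b)"] e b by auto
  have "rat_pabs p (inverse (X m) - inverse (X n)) < e" if "m \<ge> max M N" "n \<ge> max M N" for m n
  proof -
    have "rat_pabs p (inverse (X m) - inverse (X n)) \<le> rat_pabs p (X m - X n) / (b * b)"
      using that b by (intro rat_pabs_inverse_diff) auto
    also have "\<dots> < e" using N that b by (auto simp: pos_divide_less_eq)
    finally show ?thesis .
  qed
  then show "\<exists>N. \<forall>m\<ge>N. \<forall>n\<ge>N. rat_pabs p (inverse (X m) - inverse (X n)) < e" by blast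
qed

lemma pvanishes_diff_inverse:
  assumes X: "pcauchy p X" "\<not> pvanishes p X"
    and Y: "pcauchy p Y" "\<not> pvanishes p Y"
    and XY: "pvanishes p (\<lambda>n. X n - Y n)"
  shows "pvanishes p (\<lambda>n. inverse (X n) - inverse (Y n))"
proof -
  obtain a M where a: "a > 0" "\<And>n. n \<ge> M \<Longrightarrow> rat_pabs p (X n) > a"
    by (rule pcauchy_not_pvanishes[OF X]) blast
  obtain b N where b: "b > 0" "\<And>n. n \<ge> N \<Longrightarrow> rat_pabs p (Y n) > b"
    by (rule pcauchy_not_pvanishes[OF Y]) blast
  have ev: "eventually (\<lambda>n. rat_pabs p (inverse (X n) - inverse (Y n))
      \<le> rat_pabs p (X n - Y n) / (a * b)) sequentially"
    unfolding eventually_sequentially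
    by (rule exI[of _ "max M N"]) (use a b in \<open>auto intro!: rat_pabs_inverse_diff\<close>)
  have "(\<lambda>n. rat_pabs p (X n - Y n) / (a * b)) \<longlonglongrightarrow> 0 / (a * b)"
    using XY a b unfolding pvanishes_def by (intro tendsto_intros) auto
  then show ?thesis unfolding pvanishes_def
    by (intro tendsto_sandwich[OF _ ev tendsto_const]) auto
qed

end

section \<open>The field of p-adic numbers\<close>

text \<open>
  The prime is the cardinality of the type parameter, as for the finite field
  \<^typ>\<open>'p::prime_card mod_ring\<close>.  The p-adic numbers are the completion of the
  rationals: Cauchy sequences modulo null sequences.
\<close>

definition padicrel :: "nat \<Rightarrow> (nat \<Rightarrow> rat) \<Rightarrow> (nat \<Rightarrow> rat) \<Rightarrow> bool" where
  "padicrel p X Y \<longleftrightarrow> pcauchy p X \<and> pcauchy p Y \<and> pvanishes p (\<lambda>n. X n - Y n)"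

lemma padicrel_refl: "pcauchy p X \<Longrightarrow> padicrel p X X"
  by (simp add: padicrel_def)

lemma part_equivp_padicrel:
  assumes p: "prime p"
  shows "part_equivp (padicrel p)"
proof (rule part_equivpI)
  show "\<exists>X. padicrel p X X" by (rule exI[of _ "\<lambda>n. 0"]) (simp add: padicrel_refl)
  show "symp (padicrel p)"
  proof (rule sympI)
    fix X Y :: "nat \<Rightarrow> rat"
    assume "padicrel p X Y"
    then show "padicrel p Y X"
      using rat_pabs_diff_commute[OF p, of "X n" "Y n" for n]
      by (simp add: padicrel_def pvanishes_def)
  qed
  show "transp (padicrel p)"
  proof (rule transpI)
    fix X Y Z :: "nat \<Rightarrow> rat"
    assume "padicrel p X Y" "padicrel p Y Z"
    then show "padicrel p X Z"
      using pvanishes_add[OF p, of "\<lambda>n. X n - Y n" "\<lambda>n. Y n - Z n"]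
      by (simp add: padicrel_def)
  qed
qed

typedef 'a padic =
  "{c. \<exists>X. padicrel CARD('a::prime_card) X X \<and> c = Collect (padicrel CARD('a) X)}"
  morphisms padic_class padic_of_class
  using padicrel_refl[OF pcauchy_const] by blast

definition padic_of_seq :: "(nat \<Rightarrow> rat) \<Rightarrow> 'a::prime_card padic" where
  "padic_of_seq = quot_type.abs (padicrel CARD('a)) padic_of_class"

definition padic_rep :: "'a::prime_card padic \<Rightarrow> nat \<Rightarrow> rat" where
  "padic_rep = quot_type.rep padic_class"

definition cr_padic :: "(nat \<Rightarrow> rat) \<Rightarrow> 'a::prime_card padic \<Rightarrow> bool" where
  "cr_padic X x \<longleftrightarrow> padicrel CARD('a) X X \<and> padic_of_seq X = x"

lemma Quotient_padic:
  "Quotient (padicrel CARD('a::prime_card)) (padic_of_seq :: _ \<Rightarrow> 'a padic) padic_rep cr_padic"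
proof -
  have "quot_type (padicrel CARD('a)) (padic_of_class :: _ \<Rightarrow> 'a padic) padic_class"
  proof (rule quot_type.intro)
    show "part_equivp (padicrel CARD('a))" by (rule part_equivp_padicrel[OF prime_card])
    show "\<exists>X. padicrel CARD('a) X X \<and> padic_class x = Collect (padicrel CARD('a) X)"
      for x :: "'a padic"
      using padic_class[of x] by (rule CollectD)
    show "padic_of_class (padic_class x) = x" for x :: "'a padic"
      by (rule padic_class_inverse)
    show "padic_class (padic_of_class c :: 'a padic) = c"
      if "\<exists>X. padicrel CARD('a) X X \<and> c = Collect (padicrel CARD('a) X)" for c
      using that by (intro padic_of_class_inverse CollectI)
    show "padic_class x = padic_class y \<longleftrightarrow> x = y" for x y :: "'a padic"
      by (rule padic_class_inject)
  qed
  then have "Quotient3 (padicrel CARD('a)) (padic_of_seq :: _ \<Rightarrow> 'a padic) padic_rep"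
    unfolding padic_of_seq_def padic_rep_def by (rule quot_type.Quotient)
  moreover have "cr_padic \<equiv> \<lambda>X (x :: 'a padic). padicrel CARD('a) X X \<and> padic_of_seq X = x"
    by (rule eq_reflection) (simp add: cr_padic_def fun_eq_iff)
  ultimately show ?thesis by (rule Quotient3_to_Quotient)
qed

setup_lifting Quotient_padic

instantiation padic :: (prime_card) field
begin

lift_definition zero_padic :: "'a padic" is "\<lambda>n. 0" by (simp add: padicrel_refl)

lift_definition one_padic :: "'a padic" is "\<lambda>n. 1" by (simp add: padicrel_refl)

lift_definition plus_padic :: "'a padic \<Rightarrow> 'a padic \<Rightarrow> 'a padic" is "\<lambda>X Y n. X n + Y n"
  unfolding padicrel_def add_diff_add
  by (simp add: pcauchy_add[OF prime_card] pvanishes_add[OF prime_card])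

lift_definition uminus_padic :: "'a padic \<Rightarrow> 'a padic" is "\<lambda>X n. - X n"
  unfolding padicrel_def minus_diff_minus
  by (simp only: pcauchy_minus[OF prime_card] pvanishes_minus[OF prime_card] simp_thms)

lift_definition times_padic :: "'a padic \<Rightarrow> 'a padic \<Rightarrow> 'a padic" is "\<lambda>X Y n. X n * Y n"
proof -
  let ?p = "CARD('a)"
  fix X X' Y Y' :: "nat \<Rightarrow> rat"
  assume "padicrel ?p X X'" "padicrel ?p Y Y'"
  then have *: "pcauchy ?p X" "pcauchy ?p X'" "pcauchy ?p Y" "pcauchy ?p Y'"
    "pvanishes ?p (\<lambda>n. X n - X' n)" "pvanishes ?p (\<lambda>n. Y n - Y' n)"
    by (simp_all add: padicrel_def)
  have "pvanishes ?p (\<lambda>n. X n * (Y n - Y' n) + Y' n * (X n - X' n))"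
    by (intro pvanishes_add[OF prime_card] pvanishes_mult_bounded[OF prime_card] *)
  then have "pvanishes ?p (\<lambda>n. X n * Y n - X' n * Y' n)"
    by (simp add: algebra_simps)
  then show "padicrel ?p (\<lambda>n. X n * Y n) (\<lambda>n. X' n * Y' n)"
    by (simp add: padicrel_def * pcauchy_mult[OF prime_card])
qed

lift_definition inverse_padic :: "'a padic \<Rightarrow> 'a padic"
  is "\<lambda>X. if pvanishes CARD('a) X then (\<lambda>n. 0) else (\<lambda>n. inverse (X n))"
proof -
  let ?p = "CARD('a)"
  fix X Y :: "nat \<Rightarrow> rat"
  assume "padicrel ?p X Y"
  then have X: "pcauchy ?p X" and Y: "pcauchy ?p Y" and XY: "pvanishes ?p (\<lambda>n. X n - Y n)"
    by (simp_all add: padicrel_def)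
  have "pvanishes ?p X \<longleftrightarrow> pvanishes ?p Y"
    using pvanishes_diff[OF prime_card _ XY] pvanishes_add[OF prime_card XY] by force
  then show "padicrel ?p (if pvanishes ?p X then (\<lambda>n. 0) else (\<lambda>n. inverse (X n)))
      (if pvanishes ?p Y then (\<lambda>n. 0) else (\<lambda>n. inverse (Y n)))"
    by (simp add: padicrel_def X Y XY pvanishes_diff_inverse[OF prime_card]
        pcauchy_inverse[OF prime_card])
qed

definition "x - y = x + - y" for x y :: "'a padic"

definition "x div y = x * inverse y" for x y :: "'a padic"

instance
proof
  fix a b c :: "'a padic"
  note [simp] = pcauchy_add[OF prime_card] pcauchy_mult[OF prime_card]
    pcauchy_minus[OF prime_card] pcauchy_inverse[OF prime_card]
  show "a + b = b + a"
    by transfer (simp add: ac_simps padicrel_def)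
  show "(a + b) + c = a + (b + c)"
    by transfer (simp add: ac_simps padicrel_def)
  show "0 + a = a"
    by transfer (simp add: padicrel_def)
  show "- a + a = 0"
    by transfer (simp add: padicrel_def)
  show "a - b = a + - b"
    by (rule minus_padic_def)
  show "(a * b) * c = a * (b * c)"
    by transfer (simp add: ac_simps padicrel_def)
  show "a * b = b * a"
    by transfer (simp add: ac_simps padicrel_def)
  show "1 * a = a"
    by transfer (simp add: ac_simps padicrel_def)
  show "(a + b) * c = a * c + b * c"
    by transfer (simp add: distrib_right padicrel_def)
  show "(0::'a padic) \<noteq> 1"
    by transfer (simp add: padicrel_def pvanishes_const[OF prime_card])
  have "pvanishes CARD('a) (\<lambda>n. inverse (X n) * X n - 1)"
    if X: "pcauchy CARD('a) X" "\<not> pvanishes CARD('a) X" for X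
  proof -
    obtain b N where bN: "b > 0" "\<And>n. n \<ge> N \<Longrightarrow> rat_pabs CARD('a) (X n) > b"
      by (rule pcauchy_not_pvanishes[OF prime_card X]) blast
    have "rat_pabs CARD('a) (inverse (X n) * X n - 1) = 0" if "n \<ge> N" for n
      using bN(1) bN(2)[OF that] by (cases "X n = 0") auto
    then have "eventually (\<lambda>n. rat_pabs CARD('a) (inverse (X n) * X n - 1) = 0) sequentially"
      by (auto simp: eventually_sequentially)
    then show ?thesis unfolding pvanishes_def by (rule tendsto_eventually)
  qed
  then show "a \<noteq> 0 \<Longrightarrow> inverse a * a = 1"
    by transfer (simp add: padicrel_def)
  show "a div b = a * inverse b"
    by (rule divide_padic_def)
  show "inverse (0::'a padic) = 0"
    by transfer (simp add: padicrel_def)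
qed

end

text \<open>The norm is the continuous extension of the p-adic absolute value of the rationals.\<close>

lift_definition padic_norm :: "'a::prime_card padic \<Rightarrow> real" is "\<lambda>X. lim (\<lambda>n. rat_pabs CARD('a) (X n))"
proof -
  let ?p = "CARD('a)"
  fix X Y :: "nat \<Rightarrow> rat"
  assume "padicrel ?p X Y"
  then have Y: "pcauchy ?p Y" and XY: "pvanishes ?p (\<lambda>n. X n - Y n)"
    by (simp_all add: padicrel_def)
  obtain L where L: "(\<lambda>n. rat_pabs ?p (Y n)) \<longlonglongrightarrow> L"
    using pcauchy_abs_convergent[OF prime_card Y] by (auto simp: convergent_def)
  have "(\<lambda>n. rat_pabs ?p (X n) - rat_pabs ?p (Y n)) \<longlonglongrightarrow> 0"
    by (rule Lim_null_comparison[OF _ XY[unfolded pvanishes_def]])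
      (simp add: rat_pabs_abs_diff[OF prime_card])
  from tendsto_add[OF this L] have "(\<lambda>n. rat_pabs ?p (X n)) \<longlonglongrightarrow> L" by simp
  then show "lim (\<lambda>n. rat_pabs ?p (X n)) = lim (\<lambda>n. rat_pabs ?p (Y n))"
    using limI[OF L] limI by metis
qed

lemma pcauchy_abs_tendsto:
  assumes "pcauchy CARD('a::prime_card) X"
  shows "(\<lambda>n. rat_pabs CARD('a) (X n)) \<longlonglongrightarrow> lim (\<lambda>n. rat_pabs CARD('a) (X n))"
  using pcauchy_abs_convergent[OF prime_card assms] by (simp add: convergent_LIMSEQ_iff)

lemma padic_norm_eq_0 [simp]: "padic_norm (x :: 'a::prime_card padic) = 0 \<longleftrightarrow> x = 0"
proof transfer
  fix X :: "nat \<Rightarrow> rat"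
  assume "padicrel CARD('a) X X"
  then have X: "pcauchy CARD('a) X" by (simp add: padicrel_def)
  have "lim (\<lambda>n. rat_pabs CARD('a) (X n)) = 0 \<longleftrightarrow> pvanishes CARD('a) X"
    unfolding pvanishes_def using pcauchy_abs_tendsto[OF X] limI by metis
  then show "lim (\<lambda>n. rat_pabs CARD('a) (X n)) = 0 \<longleftrightarrow> padicrel CARD('a) X (\<lambda>n. 0)"
    using X by (simp add: padicrel_def)
qed

lemma padic_norm_minus [simp]: "padic_norm (- x :: 'a::prime_card padic) = padic_norm x"
  by transfer (simp add: rat_pabs_minus[OF prime_card])

lemma padic_norm_add_le_max: "padic_norm (x + y :: 'a::prime_card padic) \<le> max (padic_norm x) (padic_norm y)"
proof transfer
  fix X Y :: "nat \<Rightarrow> rat"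
  assume "padicrel CARD('a) X X" "padicrel CARD('a) Y Y"
  then have X: "pcauchy CARD('a) X" and Y: "pcauchy CARD('a) Y" by (simp_all add: padicrel_def)
  show "lim (\<lambda>n. rat_pabs CARD('a) (X n + Y n)) \<le>
      max (lim (\<lambda>n. rat_pabs CARD('a) (X n))) (lim (\<lambda>n. rat_pabs CARD('a) (Y n)))"
    by (rule LIMSEQ_le[OF pcauchy_abs_tendsto[OF pcauchy_add[OF prime_card X Y]]
          tendsto_max[OF pcauchy_abs_tendsto[OF X] pcauchy_abs_tendsto[OF Y]]])
      (auto intro: rat_pabs_add_le_max[OF prime_card])
qed

lemma padic_norm_nonneg [simp]: "0 \<le> padic_norm (x :: 'a::prime_card padic)"
proof -
  have 0: "padic_norm (0 :: 'a padic) = 0" by (simp only: padic_norm_eq_0)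
  show ?thesis using padic_norm_add_le_max[of x "- x"] by (simp add: 0)
qed

instantiation padic :: (prime_card) metric_space
begin

definition "dist x y = padic_norm (x - y)" for x y :: "'a padic"

definition "(uniformity :: ('a padic \<times> 'a padic) filter) =
  (INF e\<in>{0<..}. principal {(x, y). dist x y < e})"

definition "open (U :: 'a padic set) \<longleftrightarrow>
  (\<forall>x\<in>U. eventually (\<lambda>(x', y). x' = x \<longrightarrow> y \<in> U) uniformity)"

instance
proof
  show "dist x y = 0 \<longleftrightarrow> x = y" for x y :: "'a padic"
    by (simp add: dist_padic_def)
  show "dist x y \<le> dist x z + dist y z" for x y z :: "'a padic"
  proof -
    have "padic_norm (x - y) \<le> max (padic_norm (x - z)) (padic_norm (- (y - z)))"
      using padic_norm_add_le_max[of "x - z" "- (y - z)"] by simp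
    then show ?thesis
      unfolding padic_norm_minus dist_padic_def
      using padic_norm_nonneg[of "x - z"] padic_norm_nonneg[of "y - z"] by linarith
  qed
qed (simp_all add: uniformity_padic_def open_padic_def)

end

definition padic_ints :: "'p::prime_card padic set" where
  "padic_ints = {x. padic_norm x \<le> 1}"

section \<open>Matrices over the p-adic numbers and Haar measure\<close>

definition int_mats :: "nat \<Rightarrow> 'p::prime_card padic mat set" where
  "int_mats n = {z \<in> carrier_mat n n. \<forall>i<n. \<forall>j<n. z $$ (i, j) \<in> padic_ints}"

definition GL_int :: "nat \<Rightarrow> 'p::prime_card padic mat set" where
  "GL_int n = {A \<in> int_mats n. \<exists>B \<in> int_mats n. A * B = 1\<^sub>m n \<and> B * A = 1\<^sub>m n}"

text \<open>
  The Borel sets of the space of matrices, identified with a product of \<open>n\<^sup>2\<close> copies of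
  the field.  The latter is separable, so this product sigma-algebra is the Borel
  sigma-algebra of the product topology.
\<close>

definition borel_mat :: "nat \<Rightarrow> 'p::prime_card padic mat measure" where
  "borel_mat n = vimage_algebra (carrier_mat n n)
     (\<lambda>z. \<lambda>ij \<in> {..<n} \<times> {..<n}. z $$ ij) (\<Pi>\<^sub>M ij \<in> {..<n} \<times> {..<n}. borel)"

definition normalized_haar :: "nat \<Rightarrow> 'p::prime_card padic mat measure \<Rightarrow> bool" where
  "normalized_haar n M \<longleftrightarrow> sets M = sets (borel_mat n)
     \<and> (\<forall>A \<in> carrier_mat n n. \<forall>X \<in> sets M. emeasure M ((\<lambda>z. A + z) ` X) = emeasure M X)
     \<and> emeasure M (int_mats n) = 1"

definition vol :: "nat \<Rightarrow> 'p::prime_card padic mat measure" where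
  "vol n = (THE M. normalized_haar n M)"

section \<open>The measures on matrices\<close>

text \<open>
  The exponents \<open>k\<^sub>j\<close> have type \<^typ>\<open>int option\<close>, with \<^const>\<open>None\<close> (the least element)
  for minus infinity.
\<close>

definition sing_entry :: "int option \<Rightarrow> 'p::prime_card padic" where
  "sing_entry k = (case k of None \<Rightarrow> 0 | Some k \<Rightarrow> of_nat CARD('p) powi (- k))"

definition sing_exps :: "'p::prime_card padic mat \<Rightarrow> int option list" where
  "sing_exps z = (let n = dim_row z in THE ks. length ks = n \<and> sorted_wrt (\<ge>) ks \<and>
     (\<exists>A \<in> GL_int n. \<exists>B \<in> GL_int n. z = A * mat_diag n (\<lambda>j. sing_entry (ks ! j)) * B))"

definition gamma :: "'p::prime_card padic mat \<Rightarrow> real" where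
  "gamma z = (\<Prod>k \<leftarrow> sing_exps z. case k of None \<Rightarrow> 1
     | Some k \<Rightarrow> if k > 0 then real CARD('p) powi k else 1)"

text \<open>The type argument of the normalizing constant only supplies the prime.\<close>

definition norm_const :: "'p::prime_card itself \<Rightarrow> nat \<Rightarrow> real \<Rightarrow> ennreal" where
  "norm_const _ n \<alpha> = (\<integral>\<^sup>+ z. ennreal (gamma z powr (- \<alpha>)) \<partial>(vol n :: 'p padic mat measure))"

definition mu :: "real \<Rightarrow> nat \<Rightarrow> 'p::prime_card padic mat measure" where
  "mu s n = density (vol n)
     (\<lambda>z. ennreal (gamma z powr (- s - 2 * real n)) / norm_const TYPE('p) n (s + 2 * real n))"

definition upper_left_block :: "nat \<Rightarrow> 'p::prime_card padic mat \<Rightarrow> 'p padic mat" where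
  "upper_left_block n z = (case split_block z n n of (z11, z12, z21, z22) \<Rightarrow> z11)"

end

theory Submission
  imports Defs "Jordan_Normal_Form.Gauss_Jordan_Elimination"
begin

text \<open>
  The function \<open>\<gamma>(z)\<^bsup>-1\<^esup>\<close> is the Haar volume of the lattice \<open>{x \<in> O\<^sup>n. z x \<in> O\<^sup>n}\<close>, as one sees from the
  Smith normal form \<open>z = A D B\<close> and the invariance of Haar measure under \<open>GL(n, O)\<close>.
  This lattice is \<open>g O\<^sup>n\<close> for some \<open>g\<close> with \<open>\<bar>det g\<bar> = \<gamma>(z)\<^bsup>-1\<^esup>\<close>.  Appending a row \<open>r\<close> to \<open>z\<close> cuts out of
  it the vectors with \<open>r \<cdot> x \<in> O\<close>, and the substitution \<open>r \<mapsto> r g\<close> shows that integrating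
  \<open>\<gamma>\<^bsup>-\<alpha>\<^esup>\<close> over \<open>r\<close> gives a constant times \<open>\<gamma>(z)\<^bsup>-(\<alpha>-1)\<^esup>\<close>.  Since \<open>\<gamma>\<close> is invariant
  under transposition the same holds for columns, so integrating out one row and one column
  lowers the exponent by 2 and produces a constant, which is finite because
  the exponent exceeds the number of variables.
  The value of that constant is irrelevant: it cancels against the normalization.
\<close>

section \<open>Basic properties of the p-adic norm\<close>

text \<open>\<open>vol\<close> and \<open>sing_exps\<close> are definite descriptions, so nothing
  can be computed before existence and uniqueness are known for both. Haar measure is therefore
  built on the field, extended to finite powers as a product, and characterised by a uniqueness
  theorem. That theorem does double duty: it identifies \<open>vol\<close>, and it yields linear
  changes of variables without determinants, since the image of Haar measure under an invertible map
  is again invariant, with a factor read off from the preimage of O^n. The lattice volume, called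
  \<open>int_vol\<close>, replaces \<open>gamma\<close> because it makes sense for the rectangular
  matrices that occur once the last row is gone and the last column is not; there the Smith form,
  proved for square matrices, is reached by padding with zeros. The row and column integrations
  carry along a test function of the upper left block: an indicator gives the numerator of the
  pushforward, the constant 1 the normalization, and the same constant comes out of both.\<close>

lift_definition padic_of_rat :: "rat \<Rightarrow> 'p::prime_card padic" is "\<lambda>q n. q"
  by (simp add: padicrel_refl)

lemma padic_of_rat_0 [simp]: "padic_of_rat 0 = 0"
  by transfer (simp add: padicrel_refl)

lemma padic_of_rat_1 [simp]: "padic_of_rat 1 = 1"
  by transfer (simp add: padicrel_refl)

lemma padic_of_rat_add: "padic_of_rat (x + y) = padic_of_rat x + padic_of_rat y"
  by transfer (simp add: padicrel_refl)

lemma padic_of_rat_minus: "padic_of_rat (- x) = - padic_of_rat x"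
  by transfer (simp add: padicrel_refl)

lemma padic_of_rat_diff: "padic_of_rat (x - y) = padic_of_rat x - padic_of_rat y"
  using padic_of_rat_add[of x "- y"] by (simp add: padic_of_rat_minus)

lemma padic_of_rat_mult: "padic_of_rat (x * y) = padic_of_rat x * padic_of_rat y"
  by transfer (simp add: padicrel_refl)

lemma padic_of_rat_of_nat [simp]: "padic_of_rat (of_nat n) = of_nat n"
  by (induction n) (simp_all add: padic_of_rat_add)

lemma padic_of_rat_of_int [simp]: "padic_of_rat (of_int n) = of_int n"
  by (cases n rule: int_cases2) (simp_all add: padic_of_rat_minus)

lemma padic_norm_of_rat: "padic_norm (padic_of_rat q :: 'p::prime_card padic) = rat_pabs CARD('p) q"
  by transfer simp

lemma padic_norm_mult: "padic_norm (x * y :: 'p::prime_card padic) = padic_norm x * padic_norm y"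
proof transfer
  fix X Y :: "nat \<Rightarrow> rat"
  assume "padicrel CARD('p) X X" "padicrel CARD('p) Y Y"
  then have X: "pcauchy CARD('p) X" and Y: "pcauchy CARD('p) Y" by (simp_all add: padicrel_def)
  show "lim (\<lambda>n. rat_pabs CARD('p) (X n * Y n)) =
      lim (\<lambda>n. rat_pabs CARD('p) (X n)) * lim (\<lambda>n. rat_pabs CARD('p) (Y n))"
    unfolding rat_pabs_mult[OF prime_card]
    by (rule limI) (intro tendsto_mult pcauchy_abs_tendsto X Y)
qed

lemma padic_norm_0 [simp]: "padic_norm (0 :: 'p::prime_card padic) = 0"
  by simp

lemma padic_norm_1 [simp]: "padic_norm (1 :: 'p::prime_card padic) = 1"
  using padic_norm_of_rat[of 1, where 'p='p] by (simp add: rat_pabs_1[OF prime_card])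

lemma padic_norm_pos [simp]: "0 < padic_norm (x :: 'p::prime_card padic) \<longleftrightarrow> x \<noteq> 0"
  using padic_norm_nonneg[of x] padic_norm_eq_0[of x] by linarith

lemma padic_norm_inverse: "padic_norm (inverse x :: 'p::prime_card padic) = inverse (padic_norm x)"
proof (cases "x = 0")
  case False
  then have "padic_norm x * padic_norm (inverse x) = 1"
    unfolding padic_norm_mult[symmetric] by simp
  then show ?thesis by (metis inverse_unique)
qed simp

lemma padic_norm_divide: "padic_norm (x / y :: 'p::prime_card padic) = padic_norm x / padic_norm y"
  by (simp add: divide_inverse padic_norm_mult padic_norm_inverse)

lemma padic_norm_power: "padic_norm (x ^ n :: 'p::prime_card padic) = padic_norm x ^ n"
  by (induction n) (simp_all add: padic_norm_mult)

lemma padic_norm_powi: "padic_norm (x powi k :: 'p::prime_card padic) = padic_norm x powi k"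
  by (simp add: power_int_def padic_norm_power padic_norm_inverse)

lemma padic_norm_diff_le_max:
  "padic_norm (x - y :: 'p::prime_card padic) \<le> max (padic_norm x) (padic_norm y)"
  using padic_norm_add_le_max[of x "- y"] by simp

lemma padic_norm_add_le:
  "padic_norm x \<le> c \<Longrightarrow> padic_norm y \<le> c \<Longrightarrow> padic_norm (x + y :: 'p::prime_card padic) \<le> c"
  using padic_norm_add_le_max[of x y] by linarith

lemma padic_norm_diff_le:
  "padic_norm x \<le> c \<Longrightarrow> padic_norm y \<le> c \<Longrightarrow> padic_norm (x - y :: 'p::prime_card padic) \<le> c"
  using padic_norm_diff_le_max[of x y] by linarith

lemma padic_norm_diff_commute: "padic_norm (x - y :: 'p::prime_card padic) = padic_norm (y - x)"
  using padic_norm_minus[of "x - y"] by simp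

lemma padic_norm_sum_le:
  assumes "0 \<le> c" "\<And>i. i \<in> I \<Longrightarrow> padic_norm (f i :: 'p::prime_card padic) \<le> c"
  shows "padic_norm (\<Sum>i\<in>I. f i) \<le> c"
  using assms by (induction I rule: infinite_finite_induct) (auto intro: padic_norm_add_le)

lemma padic_norm_eqI_diff_less:
  assumes "padic_norm (x - y :: 'p::prime_card padic) < padic_norm x"
  shows "padic_norm y = padic_norm x"
  using padic_norm_diff_le_max[of x "x - y"] padic_norm_add_le_max[of "x - y" y] assms by simp

lemma padic_ints_iff: "x \<in> padic_ints \<longleftrightarrow> padic_norm x \<le> 1"
  by (simp add: padic_ints_def)

lemma padic_ints_0 [simp]: "0 \<in> padic_ints" and padic_ints_1 [simp]: "1 \<in> padic_ints"
  by (simp_all add: padic_ints_iff)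

lemma padic_ints_minus [simp]: "- x \<in> padic_ints \<longleftrightarrow> x \<in> padic_ints"
  by (simp add: padic_ints_iff)

lemma padic_ints_mult: "x \<in> padic_ints \<Longrightarrow> y \<in> padic_ints \<Longrightarrow> x * y \<in> padic_ints"
  by (simp add: padic_ints_iff padic_norm_mult mult_le_one)

lemma padic_ints_cancel_scale:
  fixes x d :: "'p::prime_card padic"
  assumes "\<not> padic_norm d \<le> 1" "d * x \<in> padic_ints"
  shows "x \<in> padic_ints"
proof -
  have "1 * padic_norm x \<le> padic_norm d * padic_norm x" using assms by (intro mult_right_mono) auto
  also have "\<dots> \<le> 1" using assms by (simp add: padic_ints_iff padic_norm_mult)
  finally show ?thesis by (simp add: padic_ints_iff)
qed

lemma padic_ints_sum: "(\<And>i. i \<in> I \<Longrightarrow> f i \<in> padic_ints) \<Longrightarrow> (\<Sum>i\<in>I. f i) \<in> padic_ints"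
  by (simp add: padic_ints_iff padic_norm_sum_le)

text \<open>A late term of a representing Cauchy sequence is close to its class. The Cauchy
  condition is used with \<open>e / 2\<close> because only a weak inequality survives in the
  limit.\<close>

lemma padic_of_rat_dense:
  assumes "e > 0"
  shows "\<exists>q. padic_norm (x - padic_of_rat q :: 'p::prime_card padic) < e"
  \<comment> \<open>Subtraction is defined from \<open>+\<close> and unary minus rather than lifted,
    so it is rewritten before transfer.\<close>
  using assms unfolding diff_conv_add_uminus
proof (transfer fixing: e)
  fix X :: "nat \<Rightarrow> rat"
  assume "padicrel CARD('p) X X"
  then have X: "pcauchy CARD('p) X" by (simp_all add: padicrel_def)
  have "e / 2 > 0" using assms by simp
  from pcauchyD[OF X this] obtain N where
    N: "\<And>m n. m \<ge> N \<Longrightarrow> n \<ge> N \<Longrightarrow> rat_pabs CARD('p) (X m - X n) < e / 2"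
    by blast
  have "pcauchy CARD('p) (\<lambda>n. X n + - X N)"
    by (intro pcauchy_add[OF prime_card X] pcauchy_const)
  then have "pcauchy CARD('p) (\<lambda>n. X n - X N)" by simp
  moreover have "\<exists>M. \<forall>n\<ge>M. rat_pabs CARD('p) (X n - X N) \<le> e / 2"
    using N less_imp_le by blast
  ultimately have "lim (\<lambda>n. rat_pabs CARD('p) (X n - X N)) \<le> e / 2"
    using LIMSEQ_le_const2[OF pcauchy_abs_tendsto] by blast
  also have "\<dots> < e" using assms by simp
  finally show "\<exists>q. lim (\<lambda>n. rat_pabs CARD('p) (X n + - q)) < e" by auto
qed

section \<open>Norms of integers, the value group and the residue field\<close>

lemma prime_card_gt_1: "real CARD('p::prime_card) > 1"
  using prime_gt_1_nat[OF prime_card[where 'a='p]] by simp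

lemma rat_pabs_of_int:
  "a \<noteq> 0 \<Longrightarrow> rat_pabs CARD('p::prime_card) (of_int a)
    = inverse (real CARD('p)) ^ multiplicity (int CARD('p)) a"
  using rat_pabs_frac[OF prime_card[where 'a='p], of a 1]
  by (simp add: power_int_minus power_inverse)

lemma padic_norm_of_int_le_1: "padic_norm (of_int a :: 'p::prime_card padic) \<le> 1"
proof (cases "a = 0")
  case False
  then show ?thesis
    using padic_norm_of_rat[of "of_int a", where 'p='p] rat_pabs_of_int[OF False, where 'p='p]
      prime_card_gt_1[where 'p='p]
    by (simp add: power_le_one inverse_le_1_iff)
qed simp

lemma padic_ints_of_nat [simp]: "(of_nat n :: 'p::prime_card padic) \<in> padic_ints"
  using padic_norm_of_int_le_1[of "int n", where 'p='p] by (simp add: padic_ints_iff)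

text \<open>The norm of a nonzero integer is p^(-v) with v its multiplicity of p, so the threshold
  1/p means v at least 1. Through this equivalence congruences modulo p enter statements about
  norms.\<close>

lemma padic_norm_of_int_le_inverse_card_iff:
  "padic_norm (of_int a :: 'p::prime_card padic) \<le> inverse (real CARD('p)) \<longleftrightarrow> int CARD('p) dvd a"
proof (cases "a = 0")
  case False
  have "prime_elem (int CARD('p))" using prime_card[where 'a='p] by simp
  then have nu: "\<not> is_unit (int CARD('p))" by (rule prime_elem_not_unit)
  have 1: "padic_norm (of_int a :: 'p padic) = inverse (real CARD('p)) ^ multiplicity (int CARD('p)) a"
    using padic_norm_of_rat[of "of_int a", where 'p='p] rat_pabs_of_int[OF False, where 'p='p]
    by simp
  have 2: "inverse (real CARD('p)) < 1" "inverse (real CARD('p)) > 0"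
    using prime_card_gt_1[where 'p='p] by (auto simp: inverse_less_1_iff)
  have "int CARD('p) dvd a \<longleftrightarrow> multiplicity (int CARD('p)) a \<ge> 1"
    using False nu multiplicity_eq_zero_iff[of a "int CARD('p)"] by (auto simp: not_less_eq_eq)
  also have "\<dots> \<longleftrightarrow> padic_norm (of_int a :: 'p padic) \<le> inverse (real CARD('p))"
    unfolding 1 using 2 power_decreasing_iff[of "inverse (real CARD('p))" "multiplicity (int CARD('p)) a" 1]
    by simp
  finally show ?thesis by simp
qed simp

lemma padic_norm_card: "padic_norm (of_nat CARD('p) :: 'p::prime_card padic) = inverse (real CARD('p))"
proof -
  have "int CARD('p) \<noteq> 0" using prime_card_gt_1[where 'p='p] by simp
  moreover have "multiplicity (int CARD('p)) (int CARD('p)) = 1"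
    using prime_card[where 'a='p] by (intro multiplicity_prime) simp
  ultimately show ?thesis
    using rat_pabs_of_int[of "int CARD('p)", where 'p='p]
      padic_norm_of_rat[of "of_nat CARD('p)", where 'p='p] by simp
qed

text \<open>By the ultrametric inequality a rational that approximates \<open>x\<close> to within
  less than the norm of \<open>x\<close> has the same norm. Hence the completion has the value group
  of the rationals.\<close>

lemma padic_norm_values:
  assumes "x \<noteq> 0"
  shows "\<exists>k::int. padic_norm (x :: 'p::prime_card padic) = real CARD('p) powi k"
proof -
  obtain q where q: "padic_norm (x - padic_of_rat q) < padic_norm x"
    using padic_of_rat_dense[of "padic_norm x" x] assms by auto
  then have "rat_pabs CARD('p) q = padic_norm x"
    using padic_norm_eqI_diff_less padic_norm_of_rat by metis
  then show ?thesis using assms unfolding rat_pabs_def by (metis padic_norm_eq_0)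
qed

lemma powi_card_le_iff:
  "real CARD('p::prime_card) powi k \<le> real CARD('p) powi l \<longleftrightarrow> k \<le> l"
  using power_int_increasing[of k l "real CARD('p)"] power_int_strict_increasing[of l k "real CARD('p)"]
    prime_card_gt_1[where 'p='p]
  by (meson less_imp_le not_le)

lemma powi_card_less_iff:
  "real CARD('p::prime_card) powi k < real CARD('p) powi l \<longleftrightarrow> k < l"
  using powi_card_le_iff[of l k, where 'p='p] by linarith

text \<open>Discreteness of the value group: no norm lies strictly between consecutive powers of
  p.\<close>

lemma padic_norm_less_powi_iff:
  "padic_norm (x :: 'p::prime_card padic) < real CARD('p) powi k
    \<longleftrightarrow> padic_norm x \<le> real CARD('p) powi (k - 1)"
proof (cases "x = 0")
  case True
  then show ?thesis by simp
next
  case False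
  then obtain l where l: "padic_norm x = real CARD('p) powi l" using padic_norm_values by blast
  show ?thesis
    unfolding l powi_card_le_iff powi_card_less_iff by simp
qed

text \<open>The residue field is Z/p. The element \<open>x\<close> is replaced by a close rational
  a/b in lowest terms, p does not divide b because a/b is integral, and the digit is a times an
  inverse of b modulo p.\<close>

lemma padic_residue:
  assumes "padic_norm (x :: 'p::prime_card padic) \<le> 1"
  shows "\<exists>d<CARD('p). padic_norm (x - of_nat d) \<le> inverse (real CARD('p))"
proof -
  let ?p = "int CARD('p)"
  have pp: "prime ?p" using prime_card[where 'a='p] by simp
  have p0: "inverse (real CARD('p)) > 0" using prime_card_gt_1[where 'p='p] by simp
  have p1: "inverse (real CARD('p)) \<le> 1" using prime_card_gt_1[where 'p='p] by (simp add: inverse_le_1_iff)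
  obtain q where q: "padic_norm (x - padic_of_rat q) < inverse (real CARD('p))"
    using padic_of_rat_dense[OF p0] by blast
  have "padic_norm (padic_of_rat q :: 'p padic) \<le> 1"
  proof -
    have "padic_norm (x - (x - padic_of_rat q)) \<le> 1"
      using q assms p1 by (intro padic_norm_diff_le[of x 1 "x - padic_of_rat q"]) linarith+
    then show ?thesis by simp
  qed
  obtain a b where ab: "quotient_of q = (a, b)" by fastforce
  have b: "b > 0" using quotient_of_denom_pos[OF ab] .
  have cop: "coprime a b" using quotient_of_coprime[OF ab] .
  have qab: "q = of_int a / of_int b" using quotient_of_div[OF ab] .
  have qb: "padic_of_rat q * of_int b = (of_int a :: 'p padic)"
    using padic_of_rat_mult[of q "of_int b", where 'a='p] b by (simp add: qab)
  have nb: "\<not> ?p dvd b"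
  proof
    assume dvd: "?p dvd b"
    then have "padic_norm (of_int b :: 'p padic) \<le> inverse (real CARD('p))"
      by (simp add: padic_norm_of_int_le_inverse_card_iff)
    then have "padic_norm (of_int a :: 'p padic) \<le> inverse (real CARD('p))"
      unfolding qb[symmetric] padic_norm_mult
      using \<open>padic_norm (padic_of_rat q) \<le> 1\<close> by (metis mult_left_le_one_le order_trans padic_norm_nonneg)
    then have "?p dvd a" by (simp add: padic_norm_of_int_le_inverse_card_iff)
    with dvd cop pp show False by (meson coprime_common_divisor not_prime_unit)
  qed
  have nb1: "padic_norm (of_int b :: 'p padic) = 1"
  proof -
    have "\<not> padic_norm (of_int b :: 'p padic) < real CARD('p) powi 0"
      unfolding padic_norm_less_powi_iff using nb by (simp add: padic_norm_of_int_le_inverse_card_iff power_int_minus)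
    then show ?thesis using padic_norm_of_int_le_1[of b, where 'p='p] by simp
  qed
  have "coprime b ?p" using nb pp by (metis coprime_commute prime_imp_coprime)
  then obtain c where c: "[b * c = 1] (mod ?p)" using cong_solve_coprime_int by blast
  define d where "d = nat ((a * c) mod ?p)"
  have d: "int d = (a * c) mod ?p" using pp prime_gt_0_int by (simp add: d_def)
  have "d < CARD('p)" using d pp prime_gt_0_int[OF pp] pos_mod_bound[of ?p "a * c"] by linarith
  have "int d * b mod ?p = a * c * b mod ?p" by (simp only: d mod_mult_left_eq)
  then have "[int d * b = a * (b * c)] (mod ?p)" by (simp add: cong_def mult_ac)
  also have "[a * (b * c) = a * 1] (mod ?p)" using c by (rule cong_scalar_left)
  finally have "?p dvd a - int d * b" by (simp add: cong_iff_dvd_diff dvd_diff_commute)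
  then have "padic_norm (of_int (a - int d * b) :: 'p padic) \<le> inverse (real CARD('p))"
    by (simp only: padic_norm_of_int_le_inverse_card_iff)
  also have "of_int (a - int d * b) = (padic_of_rat q - of_nat d) * (of_int b :: 'p padic)"
    by (simp add: left_diff_distrib qb)
  finally have "padic_norm (padic_of_rat q - of_nat d :: 'p padic) \<le> inverse (real CARD('p))"
    by (simp add: padic_norm_mult nb1)
  then have "padic_norm ((x - padic_of_rat q) + (padic_of_rat q - of_nat d)) \<le> inverse (real CARD('p))"
    using q by (intro padic_norm_add_le) auto
  then show ?thesis using \<open>d < CARD('p)\<close> by auto
qed

lemma padic_residue_unique:
  assumes "d < CARD('p::prime_card)" "e < CARD('p)"
    "padic_norm (of_nat d - of_nat e :: 'p padic) \<le> inverse (real CARD('p))"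
  shows "d = e"
proof -
  have "int CARD('p) dvd (int d - int e)"
    using assms(3) padic_norm_of_int_le_inverse_card_iff[of "int d - int e", where 'p='p] by simp
  then have "int d mod int CARD('p) = int e mod int CARD('p)" by (simp add: mod_eq_dvd_iff)
  then show ?thesis using assms(1,2) by simp
qed

section \<open>Balls and the topology of the p-adic field\<close>

instance padic :: (prime_card) topological_monoid_add
proof
  fix a b :: "'a padic"
  show "((\<lambda>x. fst x + snd x) \<longlongrightarrow> a + b) (nhds a \<times>\<^sub>F nhds b)"
    unfolding tendsto_iff
  proof (intro allI impI)
    fix e :: real assume "e > 0"
    then have "eventually (\<lambda>x. dist x a < e) (nhds a)" "eventually (\<lambda>x. dist x b < e) (nhds b)"
      by (auto simp: eventually_nhds_metric)
    moreover have "dist (x + y) (a + b) < e" if "dist x a < e" "dist y b < e" for x y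
      using that padic_norm_add_le_max[of "x - a" "y - b"]
      by (simp add: dist_padic_def algebra_simps)
    ultimately show "eventually (\<lambda>x. dist (fst x + snd x) (a + b) < e) (nhds a \<times>\<^sub>F nhds b)"
      unfolding eventually_prod_filter
      by (intro exI[of _ "\<lambda>x. dist x a < e"] exI[of _ "\<lambda>y. dist y b < e"]) simp
  qed
qed

instance padic :: (prime_card) topological_semigroup_mult
proof
  fix a b :: "'a padic"
  show "((\<lambda>x. fst x * snd x) \<longlongrightarrow> a * b) (nhds a \<times>\<^sub>F nhds b)"
    unfolding tendsto_iff
  proof (intro allI impI)
    fix e :: real assume e: "e > 0"
    have ev: "eventually (\<lambda>x. dist x c < d) (nhds c)" if "d > 0" for c :: "'a padic" and d
      using that by (auto simp: eventually_nhds_metric)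
    define A where "A = 1 + padic_norm a"
    define B where "B = 1 + padic_norm b"
    have AB: "A \<ge> 1" "B \<ge> 1" by (simp_all add: A_def B_def)
    have "eventually (\<lambda>x. dist x a < min 1 (e / B)) (nhds a)"
      "eventually (\<lambda>x. dist x b < e / A) (nhds b)"
      by (rule ev, use e AB in simp)+
    moreover have "dist (x * y) (a * b) < e" if "dist x a < min 1 (e / B)" "dist y b < e / A" for x y
    proof -
      have x: "padic_norm (x - a) < 1" "padic_norm (x - a) < e / B" and y: "padic_norm (y - b) < e / A"
        using that by (auto simp: dist_padic_def)
      have "padic_norm ((x - a) + a) \<le> max (padic_norm (x - a)) (padic_norm a)"
        by (rule padic_norm_add_le_max)
      also have "\<dots> \<le> A" using x padic_norm_nonneg[of a] unfolding A_def by linarith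
      finally have xA: "padic_norm x \<le> A" by simp
      have "x * y - a * b = x * (y - b) + (x - a) * b" by (simp add: algebra_simps)
      then have "padic_norm (x * y - a * b) \<le> max (padic_norm (x * (y - b))) (padic_norm ((x - a) * b))"
        using padic_norm_add_le_max by metis
      also have "padic_norm (x * (y - b)) \<le> A * padic_norm (y - b)"
        using xA by (simp add: padic_norm_mult mult_right_mono)
      also have "padic_norm ((x - a) * b) \<le> padic_norm (x - a) * B"
        by (simp add: padic_norm_mult B_def mult_left_mono)
      finally have "padic_norm (x * y - a * b) \<le> max (A * padic_norm (y - b)) (padic_norm (x - a) * B)"
        by linarith
      also have "\<dots> < e" using x y AB by (simp add: pos_less_divide_eq mult.commute)
      finally show ?thesis by (simp add: dist_padic_def)
    qed
    ultimately show "eventually (\<lambda>x. dist (fst x * snd x) (a * b) < e) (nhds a \<times>\<^sub>F nhds b)"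
      unfolding eventually_prod_filter
      by (intro exI[of _ "\<lambda>x. dist x a < min 1 (e / B)"] exI[of _ "\<lambda>y. dist y b < e / A"]) simp
  qed
qed

definition pball :: "'p::prime_card padic \<Rightarrow> int \<Rightarrow> 'p padic set" where
  "pball a k = {x. padic_norm (x - a) \<le> real CARD('p) powi k}"

lemma pball_0_0: "pball 0 0 = padic_ints"
  by (simp add: pball_def padic_ints_def)

lemma center_in_pball [simp]: "a \<in> pball a k"
  by (simp add: pball_def)

text \<open>By the ultrametric inequality every point of a ball is a centre of it.\<close>

lemma pball_eq:
  assumes "x \<in> pball a k"
  shows "pball x k = pball (a :: 'p::prime_card padic) k"
proof -
  have xa: "padic_norm (x - a) \<le> real CARD('p) powi k"
    using assms by (simp add: pball_def)
  have "padic_norm (y - x) \<le> real CARD('p) powi k \<longleftrightarrow> padic_norm (y - a) \<le> real CARD('p) powi k" for y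
    using xa padic_norm_add_le[of "y - x" _ "x - a"] padic_norm_diff_le[of "y - a" _ "x - a"]
    by auto
  then show ?thesis by (simp add: pball_def)
qed

lemma pball_mono: "k \<le> l \<Longrightarrow> pball a k \<subseteq> pball (a :: 'p::prime_card padic) l"
  using powi_card_le_iff[of k l, where 'p='p] by (auto simp: pball_def intro: order_trans)

lemma open_pball: "open (pball (a :: 'p::prime_card padic) k)"
  unfolding open_dist
proof (intro ballI exI conjI allI impI)
  fix x y assume x: "x \<in> pball a k" and y: "dist y x < real CARD('p) powi k"
  then show "y \<in> pball a k"
    unfolding pball_eq[OF x, symmetric] by (simp add: dist_padic_def pball_def)
qed (use prime_card_gt_1[where 'p='p] in simp)

lemma pball_arbitrarily_small:
  assumes "e > 0"
  shows "\<exists>k::nat. real CARD('p::prime_card) powi (- int k) < e"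
proof -
  have "inverse (real CARD('p)) < 1" using prime_card_gt_1[where 'p='p] by (simp add: inverse_less_1_iff)
  then obtain k where "inverse (real CARD('p)) ^ k < e"
    using real_arch_pow_inv[of e "inverse (real CARD('p))"] assms by blast
  then show ?thesis by (intro exI[of _ k]) (simp add: power_int_minus power_inverse)
qed

text \<open>Radii are restricted to at most 1. This is enough for a base of the topology, and every
  such ball lies in a unit ball, which will have finite measure.\<close>

definition rat_pballs :: "'p::prime_card padic set set" where
  "rat_pballs = (\<lambda>(q, k). pball (padic_of_rat q) (- int k)) ` (UNIV :: (rat \<times> nat) set)"

lemma countable_rat_pballs: "countable rat_pballs"
  unfolding rat_pballs_def by simp

lemma pball_in_rat_pballs: "pball (a :: 'p::prime_card padic) (- int k) \<in> rat_pballs"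
proof -
  have "real CARD('p) powi (- int k) > 0" using prime_card_gt_1[where 'p='p] by simp
  then obtain q where "padic_norm (a - padic_of_rat q) < real CARD('p) powi (- int k)"
    using padic_of_rat_dense by blast
  then have "padic_of_rat q \<in> pball a (- int k)"
    by (simp add: pball_def padic_norm_diff_commute)
  from pball_eq[OF this] show ?thesis unfolding rat_pballs_def by force
qed

lemma open_imp_Union_rat_pballs:
  assumes "open (S :: 'p::prime_card padic set)"
  shows "S = \<Union>{B \<in> rat_pballs. B \<subseteq> S}"
proof
  show "S \<subseteq> \<Union>{B \<in> rat_pballs. B \<subseteq> S}"
  proof
    fix x assume "x \<in> S"
    with assms obtain e where e: "e > 0" "\<And>y. dist y x < e \<Longrightarrow> y \<in> S" by (auto simp: open_dist)
    obtain k :: nat where k: "real CARD('p) powi (- int k) < e" using pball_arbitrarily_small e(1) by blast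
    have "pball x (- int k) \<subseteq> S" using e(2) k by (auto simp: pball_def dist_padic_def)
    then show "x \<in> \<Union>{B \<in> rat_pballs. B \<subseteq> S}"
      using pball_in_rat_pballs[of x k] center_in_pball[of x "- int k"] by blast
  qed
qed auto

instance padic :: (prime_card) second_countable_topology
proof
  have "open S \<longleftrightarrow> generate_topology rat_pballs S" for S :: "'a padic set"
  proof
    assume "open S"
    have "generate_topology rat_pballs (\<Union>{B \<in> rat_pballs. B \<subseteq> S})"
      by (rule generate_topology.UN) (auto intro: generate_topology.Basis)
    then show "generate_topology rat_pballs S"
      using open_imp_Union_rat_pballs[OF \<open>open S\<close>] by simp
  next
    show "generate_topology rat_pballs S \<Longrightarrow> open S"
      by (induction rule: generate_topology.induct) (auto simp: rat_pballs_def open_pball)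
  qed
  then show "\<exists>B :: 'a padic set set. countable B \<and> open = generate_topology B"
    using countable_rat_pballs by blast
qed

lemma borel_eq_sigma_rat_pballs: "sets (borel :: 'p::prime_card padic measure) = sigma_sets UNIV (insert {} rat_pballs)"
proof -
  have "sigma_sets UNIV (Collect open) = sigma_sets UNIV (insert {} (rat_pballs :: 'p padic set set))"
  proof (rule sigma_sets_eqI)
    fix S :: "'p padic set" assume "S \<in> Collect open"
    then have "S = \<Union>{B \<in> rat_pballs. B \<subseteq> S}" using open_imp_Union_rat_pballs by simp
    moreover have "\<Union>{B \<in> rat_pballs. B \<subseteq> S} \<in> sigma_sets UNIV (insert {} rat_pballs)"
      by (rule sigma_sets_UNION) (auto intro: countable_subset[OF _ countable_rat_pballs])
    ultimately show "S \<in> sigma_sets UNIV (insert {} rat_pballs)" by simp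
  qed (auto simp: rat_pballs_def open_pball)
  then show ?thesis by (simp add: borel_def)
qed

text \<open>Two balls that meet have a common centre and are therefore nested, so the smaller one is
  the intersection.\<close>

lemma Int_stable_rat_pballs: "Int_stable (insert {} (rat_pballs :: 'p::prime_card padic set set))"
proof -
  have *: "pball a (- int k) \<inter> pball b (- int l) \<in> insert {} rat_pballs" if "k \<le> l"
    for a b :: "'p padic" and k l
  proof (cases "pball a (- int k) \<inter> pball b (- int l) = {}")
    case False
    then obtain x where x: "x \<in> pball a (- int k)" "x \<in> pball b (- int l)" by blast
    have "pball x (- int l) \<subseteq> pball x (- int k)" using that by (intro pball_mono) simp
    then have "pball a (- int k) \<inter> pball b (- int l) = pball x (- int l)"
      using pball_eq[OF x(1)] pball_eq[OF x(2)] by blast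
    then show ?thesis using pball_in_rat_pballs by auto
  qed auto
  show ?thesis
  proof (rule Int_stableI)
    fix A B :: "'p padic set"
    assume AB: "A \<in> insert {} rat_pballs" "B \<in> insert {} rat_pballs"
    show "A \<inter> B \<in> insert {} rat_pballs"
    proof (cases "A = {} \<or> B = {}")
      case False
      with AB obtain a k b l where "A = pball a (- int k)" "B = pball b (- int l)"
        by (auto simp: rat_pballs_def)
      then show ?thesis using *[of k l a b] *[of l k b a] by (cases "k \<le> l") (auto simp: Int_commute)
    qed auto
  qed
qed

lemma Union_unit_pballs: "(\<Union>q. pball (padic_of_rat q :: 'p::prime_card padic) 0) = UNIV"
proof -
  have "\<exists>q. x \<in> pball (padic_of_rat q) 0" for x :: "'p padic"
    using padic_of_rat_dense[of 1 x] by (auto simp: pball_def intro: less_imp_le)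
  then show ?thesis by blast
qed

text \<open>The balls of radius at most 1 form a pi-system generating the Borel sets, and countably
  many unit balls of finite mass cover the field.\<close>

lemma padic_measure_eqI:
  fixes M N :: "'p::prime_card padic measure"
  assumes "sets M = sets borel" "sets N = sets borel"
    and eq: "\<And>a k. emeasure M (pball a (- int k)) = emeasure N (pball a (- int k))"
    and fin: "\<And>a. emeasure M (pball a 0) \<noteq> \<infinity>"
  shows "M = N"
proof (rule measure_eqI_generator_eq_countable[OF Int_stable_rat_pballs])
  show "emeasure M X = emeasure N X" if "X \<in> insert {} rat_pballs" for X
    using that eq by (auto simp: rat_pballs_def)
  show "range (\<lambda>q. pball (padic_of_rat q :: 'p padic) 0) \<subseteq> insert {} rat_pballs"
    using pball_in_rat_pballs[of _ 0] by auto
  show "\<Union>(range (\<lambda>q. pball (padic_of_rat q :: 'p padic) 0)) = UNIV" by (rule Union_unit_pballs)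
qed (use assms borel_eq_sigma_rat_pballs fin[simplified] in auto)

section \<open>Haar measure on the p-adic field\<close>

text \<open>The radical inverse of van der Corput: sum d_i p^i goes to sum d_i p^(-i-1). For prime p
  its values represent each coset of the p-adic integers in the p-adic numbers exactly once.
  Returning 0 for \<open>p < 2\<close> makes the recursion terminate for all arguments.\<close>

function digit_rev :: "nat \<Rightarrow> nat \<Rightarrow> rat" where
  "digit_rev p m = (if m = 0 \<or> p < 2 then 0
     else (of_nat (m mod p) + digit_rev p (m div p)) / of_nat p)"
  by pat_completeness auto
termination by (relation "Wellfounded.measure snd") auto

declare digit_rev.simps [simp del]

lemma digit_rev_0 [simp]: "digit_rev p 0 = 0"
  by (simp add: digit_rev.simps)

lemma digit_rev_rec: "p \<ge> 2 \<Longrightarrow> digit_rev p m * of_nat p = of_nat (m mod p) + digit_rev p (m div p)"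
  by (cases "m = 0") (simp_all add: digit_rev.simps[of p m])

lemma padic_of_rat_power: "padic_of_rat (x ^ n) = padic_of_rat x ^ n"
  by (induction n) (simp_all add: padic_of_rat_mult)

lemma padic_digit_rev_rec:
  "padic_of_rat (digit_rev CARD('p) m) * of_nat CARD('p)
    = of_nat (m mod CARD('p)) + (padic_of_rat (digit_rev CARD('p) (m div CARD('p))) :: 'p::prime_card padic)"
proof -
  have "CARD('p) \<ge> 2" using prime_card[where 'a='p] by (rule prime_ge_2_nat)
  from arg_cong[OF digit_rev_rec[OF this, of m], of "padic_of_rat :: rat \<Rightarrow> 'p padic"] show ?thesis
    by (simp only: padic_of_rat_add padic_of_rat_mult padic_of_rat_of_nat)
qed

text \<open>Multiplication by p turns the leading digits into integers. The remainders after them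
  are then congruent modulo O, so the quotients by p agree by induction. What is left bounds the
  difference of the two digits by 1/p, which forces the digits to agree.\<close>

lemma digit_rev_inj:
  assumes "padic_norm (padic_of_rat (digit_rev CARD('p) m) - padic_of_rat (digit_rev CARD('p) n) :: 'p::prime_card padic) \<le> 1"
  shows "m = n"
  using assms
proof (induction "m + n" arbitrary: m n rule: less_induct)
  case less
  let ?p = "CARD('p)" and ?r = "\<lambda>m. padic_of_rat (digit_rev CARD('p) m) :: 'p padic"
  show ?case
  proof (cases "m + n = 0")
    case False
    have p: "?p \<ge> 2" using prime_card[where 'a='p] by (rule prime_ge_2_nat)
    have eq: "(?r m - ?r n) * of_nat ?p
        = (of_nat (m mod ?p) - of_nat (n mod ?p)) + (?r (m div ?p) - ?r (n div ?p))"
      by (simp add: left_diff_distrib padic_digit_rev_rec)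
    have p1: "inverse (real ?p) \<le> 1" using p by (simp add: inverse_le_1_iff)
    have le: "padic_norm ((?r m - ?r n) * of_nat ?p) \<le> inverse (real ?p)"
      using less.prems p by (simp only: padic_norm_mult padic_norm_card) (simp add: mult_left_le_one_le)
    have "padic_norm (of_nat (m mod ?p) - of_nat (n mod ?p) :: 'p padic) \<le> 1"
      by (intro padic_norm_diff_le) (simp_all add: padic_ints_iff[symmetric])
    moreover have "?r (m div ?p) - ?r (n div ?p)
        = (?r m - ?r n) * of_nat ?p - (of_nat (m mod ?p) - of_nat (n mod ?p))"
      by (simp add: eq)
    ultimately have "padic_norm (?r (m div ?p) - ?r (n div ?p)) \<le> 1"
      using padic_norm_diff_le[OF order_trans[OF le p1]] by simp
    moreover have "m div ?p + n div ?p < m + n"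
      using False p by (cases "m = 0"; cases "n = 0") (auto intro!: add_strict_mono)
    ultimately have div_eq: "m div ?p = n div ?p" by (intro less.hyps)
    have "padic_norm (of_nat (m mod ?p) - of_nat (n mod ?p) :: 'p padic) \<le> inverse (real ?p)"
      using le unfolding eq div_eq by (simp only: diff_self add_0_right)
    then have "m mod ?p = n mod ?p"
      using p by (intro padic_residue_unique[where 'p='p]) auto
    then have "m div ?p * ?p + m mod ?p = n div ?p * ?p + n mod ?p"
      by (simp only: div_eq)
    then show ?thesis by (simp only: div_mult_mod_eq)
  qed simp
qed

text \<open>Induction on the size of \<open>a\<close>: \<open>a\<close> times p is smaller and is
  represented by some \<open>m\<close> up to an integer, and the residue \<open>d\<close> of that
  integer supplies the next digit, so that \<open>m * p + d\<close> represents
  \<open>a\<close>.\<close>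

lemma digit_rev_surj:
  assumes "padic_norm (a :: 'p::prime_card padic) \<le> real CARD('p) ^ N"
  shows "\<exists>m. padic_norm (padic_of_rat (digit_rev CARD('p) m) - a) \<le> 1"
  using assms
proof (induction N arbitrary: a)
  case 0
  then show ?case by (intro exI[of _ 0]) simp
next
  case (Suc N)
  let ?p = "CARD('p)" and ?r = "\<lambda>m. padic_of_rat (digit_rev CARD('p) m) :: 'p padic"
  have p: "real ?p > 1" using prime_card_gt_1[where 'p='p] .
  have "padic_norm (a * of_nat ?p) \<le> real ?p ^ N"
    using Suc.prems p by (simp only: padic_norm_mult padic_norm_card) (simp add: field_simps)
  from Suc.IH[OF this] obtain m where "padic_norm (?r m - a * of_nat ?p) \<le> 1" by blast
  then obtain d where d: "d < ?p" "padic_norm (a * of_nat ?p - ?r m - of_nat d) \<le> inverse (real ?p)"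
    using padic_residue[of "a * of_nat ?p - ?r m"] by (auto simp: padic_norm_diff_commute)
  have "(?r (m * ?p + d) - a) * of_nat ?p = - (a * of_nat ?p - ?r m - of_nat d)"
    using d(1) by (simp add: left_diff_distrib padic_digit_rev_rec)
  then have "padic_norm (?r (m * ?p + d) - a) * inverse (real ?p) \<le> inverse (real ?p)"
    using d(2) by (simp only: padic_norm_card[symmetric] padic_norm_mult[symmetric] padic_norm_minus)
  then show ?case using p by (intro exI[of _ "m * ?p + d"]) (simp add: field_simps)
qed

text \<open>
  Haar measure on the p-adic numbers is the image of Lebesgue measure on \<open>[0, \<infinity>)\<close> under the map
  that reverses digits, sending \<open>\<Sum> d\<^sub>i p\<^sup>i\<close> to \<open>\<Sum> d\<^sub>i p\<^bsup>-i-1\<^esup>\<close>: preimages of balls are half-open intervals.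
\<close>

definition monna_seq :: "nat \<Rightarrow> real \<Rightarrow> nat \<Rightarrow> rat" where
  "monna_seq p x k = of_nat p ^ k * digit_rev p (nat \<lfloor>x * real p ^ k\<rfloor>)"

definition monna :: "real \<Rightarrow> 'p::prime_card padic" where
  "monna x = padic_of_seq (monna_seq CARD('p) x)"

text \<open>One step reads one more base p digit of the fractional part of \<open>x\<close> and adds
  it with weight p^k. These increments tend to 0 p-adically, which makes the sequence
  Cauchy.\<close>

lemma monna_seq_Suc:
  assumes "p \<ge> 2" "x \<ge> 0"
  shows "monna_seq p x (Suc k) - monna_seq p x k = of_nat p ^ k * of_nat (nat \<lfloor>x * real p ^ Suc k\<rfloor> mod p)"
proof -
  have "\<lfloor>x * real p ^ k\<rfloor> = \<lfloor>x * real p ^ Suc k / of_int (int p)\<rfloor>"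
    using assms(1) by (intro arg_cong[where f=floor]) simp
  also have "\<dots> = \<lfloor>x * real p ^ Suc k\<rfloor> div int p"
    by (rule floor_divide_real_eq_div) simp
  finally have "nat \<lfloor>x * real p ^ Suc k\<rfloor> div p = nat \<lfloor>x * real p ^ k\<rfloor>"
    using assms(2) by (simp add: nat_div_distrib)
  with digit_rev_rec[OF assms(1), of "nat \<lfloor>x * real p ^ Suc k\<rfloor>"]
  have *: "of_nat p * digit_rev p (nat \<lfloor>x * real p ^ Suc k\<rfloor>)
      = of_nat (nat \<lfloor>x * real p ^ Suc k\<rfloor> mod p) + digit_rev p (nat \<lfloor>x * real p ^ k\<rfloor>)"
    by (simp only: mult.commute)
  have "monna_seq p x (Suc k) = of_nat p ^ k * (of_nat p * digit_rev p (nat \<lfloor>x * real p ^ Suc k\<rfloor>))"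
    by (simp only: monna_seq_def power_Suc mult_ac)
  then show ?thesis
    unfolding * by (simp add: monna_seq_def distrib_left)
qed

lemma monna_seq_diff:
  assumes "x \<ge> 0" "k \<le> l"
  shows "padic_norm (padic_of_rat (monna_seq CARD('p) x l - monna_seq CARD('p) x k) :: 'p::prime_card padic)
    \<le> real CARD('p) powi (- int k)"
  using assms(2)
proof (induction l rule: dec_induct)
  case base
  then show ?case by simp
next
  case (step l)
  have p: "CARD('p) \<ge> 2" using prime_card[where 'a='p] by (rule prime_ge_2_nat)
  have "padic_of_rat (monna_seq CARD('p) x (Suc l) - monna_seq CARD('p) x l)
      = (of_nat (CARD('p)) ^ l * of_nat (nat \<lfloor>x * real CARD('p) ^ Suc l\<rfloor> mod CARD('p)) :: 'p padic)"
    unfolding monna_seq_Suc[OF p assms(1)]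
    by (simp only: padic_of_rat_mult padic_of_rat_power padic_of_rat_of_nat)
  then have "padic_norm (padic_of_rat (monna_seq CARD('p) x (Suc l) - monna_seq CARD('p) x l) :: 'p padic)
      \<le> inverse (real CARD('p)) ^ l * 1"
    using padic_ints_of_nat[where 'p='p]
    by (simp only: padic_norm_mult padic_norm_power padic_norm_card) (intro mult_left_mono, simp_all add: padic_ints_iff)
  also have "\<dots> = real CARD('p) powi (- int l)" by (simp add: power_int_minus power_inverse)
  also have "\<dots> \<le> real CARD('p) powi (- int k)" using step by (simp add: powi_card_le_iff)
  finally have "padic_norm (padic_of_rat (monna_seq CARD('p) x (Suc l) - monna_seq CARD('p) x l)
      + padic_of_rat (monna_seq CARD('p) x l - monna_seq CARD('p) x k) :: 'p padic)
    \<le> real CARD('p) powi (- int k)"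
    using step.IH by (rule padic_norm_add_le)
  then show ?case by (simp add: padic_of_rat_diff)
qed

lemma pcauchy_monna_seq:
  assumes "x \<ge> 0"
  shows "pcauchy CARD('p::prime_card) (monna_seq CARD('p) x)"
  unfolding pcauchy_def
proof (intro allI impI)
  fix e :: real assume "e > 0"
  then obtain k :: nat where k: "real CARD('p) powi (- int k) < e" using pball_arbitrarily_small by blast
  have "rat_pabs CARD('p) (monna_seq CARD('p) x m - monna_seq CARD('p) x n) < e" if "m \<ge> k" "n \<ge> k" for m n
  proof -
    let ?s = "\<lambda>m. padic_of_rat (monna_seq CARD('p) x m) :: 'p padic"
    have "padic_norm ((?s m - ?s k) - (?s n - ?s k)) \<le> real CARD('p) powi (- int k)"
      using monna_seq_diff[OF assms that(1), where 'p='p] monna_seq_diff[OF assms that(2), where 'p='p]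
      unfolding padic_of_rat_diff by (rule padic_norm_diff_le)
    also have "(?s m - ?s k) - (?s n - ?s k) = padic_of_rat (monna_seq CARD('p) x m - monna_seq CARD('p) x n)"
      by (simp add: padic_of_rat_diff)
    finally show ?thesis using k by (simp add: padic_norm_of_rat)
  qed
  then show "\<exists>N. \<forall>m\<ge>N. \<forall>n\<ge>N. rat_pabs CARD('p) (monna_seq CARD('p) x m - monna_seq CARD('p) x n) < e"
    by blast
qed

lemma monna_approx:
  assumes "x \<ge> 0"
  shows "padic_norm (monna x - padic_of_rat (monna_seq CARD('p) x k) :: 'p::prime_card padic)
    \<le> real CARD('p) powi (- int k)"
proof -
  let ?X = "monna_seq CARD('p) x"
  have c: "pcauchy CARD('p) ?X" by (rule pcauchy_monna_seq[OF assms])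
  have c': "pcauchy CARD('p) (\<lambda>n. ?X n + - ?X k)" by (intro pcauchy_add[OF prime_card] c pcauchy_const)
  have "monna x - padic_of_rat (?X k) = (padic_of_seq (\<lambda>n. ?X n + - ?X k) :: 'p padic)"
    unfolding diff_conv_add_uminus monna_def padic_of_rat.abs_eq
    by (simp add: plus_padic.abs_eq uminus_padic.abs_eq padicrel_refl c pcauchy_minus[OF prime_card])
  then have "padic_norm (monna x - padic_of_rat (?X k) :: 'p padic)
      = lim (\<lambda>n. rat_pabs CARD('p) (?X n + - ?X k))"
    by (simp add: padic_norm.abs_eq padicrel_refl c' del: add_uminus_conv_diff)
  also have "\<dots> \<le> real CARD('p) powi (- int k)"
    using LIMSEQ_le_const2[OF pcauchy_abs_tendsto[OF c'], of "real CARD('p) powi (- int k)"]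
      monna_seq_diff[OF assms, of k, where 'p='p]
    by (auto simp: padic_norm_of_rat)
  finally show ?thesis .
qed

text \<open>Division by p^k turns the ball into a coset of O, which contains exactly one value
  \<open>digit_rev p m\<close>. Only the k-th approximation of \<open>monna x\<close> matters for
  membership, and it lies in the ball exactly when the integer part of x p^k is
  \<open>m\<close>.\<close>

lemma monna_vimage_pball:
  "\<exists>m::nat. {x. x \<ge> 0 \<and> monna x \<in> pball (a :: 'p::prime_card padic) (- int k)}
    = {real m / real CARD('p) ^ k ..< (real m + 1) / real CARD('p) ^ k}"
proof -
  let ?p = "CARD('p)" and ?r = "\<lambda>m. padic_of_rat (digit_rev CARD('p) m) :: 'p padic"
  have p: "real ?p > 1" using prime_card_gt_1[where 'p='p] .
  have p0: "(of_nat ?p :: 'p padic) \<noteq> 0" using padic_norm_card[where 'p='p] p by auto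
  define b where "b = a / of_nat ?p ^ k"
  have ab: "a = of_nat ?p ^ k * b" using p0 by (simp add: b_def)
  obtain N where "padic_norm b \<le> real ?p ^ N"
    using real_arch_pow[OF p, of "padic_norm b"] by (auto intro: less_imp_le)
  then obtain m where m: "padic_norm (?r m - b) \<le> 1" using digit_rev_surj by blast
  have "monna x \<in> pball a (- int k) \<longleftrightarrow> nat \<lfloor>x * real ?p ^ k\<rfloor> = m" if "x \<ge> 0" for x
  proof -
    have 1: "padic_of_rat (monna_seq ?p x k) - a = of_nat ?p ^ k * (?r (nat \<lfloor>x * real ?p ^ k\<rfloor>) - b)"
      unfolding monna_seq_def ab right_diff_distrib
      by (simp only: padic_of_rat_mult padic_of_rat_power padic_of_rat_of_nat)
    have "monna x \<in> pball a (- int k) \<longleftrightarrow> a \<in> pball (monna x) (- int k)"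
      by (simp add: pball_def padic_norm_diff_commute)
    also have "pball (monna x :: 'p padic) (- int k) = pball (padic_of_rat (monna_seq ?p x k)) (- int k)"
      using monna_approx[OF that, of k, where 'p='p] by (intro pball_eq) (simp add: pball_def)
    also have "a \<in> pball (padic_of_rat (monna_seq ?p x k)) (- int k)
        \<longleftrightarrow> padic_norm (padic_of_rat (monna_seq ?p x k) - a) \<le> real ?p powi (- int k)"
      by (simp add: pball_def padic_norm_diff_commute)
    also have "\<dots> \<longleftrightarrow> padic_norm (?r (nat \<lfloor>x * real ?p ^ k\<rfloor>) - b) \<le> 1"
      unfolding 1 padic_norm_mult padic_norm_power padic_norm_card
      using p by (simp add: power_int_minus field_simps)
    also have "\<dots> \<longleftrightarrow> nat \<lfloor>x * real ?p ^ k\<rfloor> = m"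
    proof
      assume "padic_norm (?r (nat \<lfloor>x * real ?p ^ k\<rfloor>) - b) \<le> 1"
      from padic_norm_diff_le[OF this m] show "nat \<lfloor>x * real ?p ^ k\<rfloor> = m"
        by (intro digit_rev_inj[where 'p='p]) simp
    qed (use m in simp)
    finally show ?thesis .
  qed
  moreover have "nat \<lfloor>x * real ?p ^ k\<rfloor> = m \<longleftrightarrow> real m / real ?p ^ k \<le> x \<and> x < (real m + 1) / real ?p ^ k"
    if "x \<ge> 0" for x
  proof -
    have "0 \<le> \<lfloor>x * real ?p ^ k\<rfloor>" using that by simp
    then have "nat \<lfloor>x * real ?p ^ k\<rfloor> = m \<longleftrightarrow> \<lfloor>x * real ?p ^ k\<rfloor> = int m" by linarith
    also have "\<dots> \<longleftrightarrow> real m \<le> x * real ?p ^ k \<and> x * real ?p ^ k < real m + 1"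
      by (simp add: floor_eq_iff)
    finally show ?thesis using p by (simp add: pos_divide_le_eq pos_less_divide_eq)
  qed
  moreover have "x \<ge> 0" if "real m / real ?p ^ k \<le> x" for x
    using that p by (auto intro: order_trans[of 0 "real m / real ?p ^ k"])
  ultimately show ?thesis by (intro exI[of _ m]) (auto simp del: of_nat_le_0_iff)
qed

definition padic_haar :: "'p::prime_card padic measure" where
  "padic_haar = distr (restrict_space lborel {0..}) borel monna"

lemma sets_padic_haar [simp, measurable_cong]: "sets padic_haar = sets borel"
  by (simp add: padic_haar_def)

lemma space_padic_haar [simp]: "space padic_haar = UNIV"
  by (simp add: padic_haar_def)

lemma measurable_monna: "monna \<in> restrict_space lborel {0..} \<rightarrow>\<^sub>M (borel :: 'p::prime_card padic measure)"
proof (rule measurable_sigma_sets[OF borel_eq_sigma_rat_pballs])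
  fix y :: "'p padic set" assume "y \<in> insert {} rat_pballs"
  then consider "y = {}" | a k where "y = pball a (- int k)" by (auto simp: rat_pballs_def)
  then show "monna -` y \<inter> space (restrict_space lborel {0..}) \<in> sets (restrict_space lborel {0..})"
  proof cases
    case 2
    obtain m :: nat where "{x. x \<ge> 0 \<and> monna x \<in> pball a (- int k)}
        = {real m / real CARD('p) ^ k ..< (real m + 1) / real CARD('p) ^ k}"
      using monna_vimage_pball by blast
    moreover have "monna -` y \<inter> space (restrict_space lborel {0..}) = {x. x \<ge> 0 \<and> monna x \<in> pball a (- int k)}"
      by (auto simp: space_restrict_space 2)
    moreover have "\<dots> \<subseteq> {0..}" by auto
    ultimately show ?thesis by (auto simp: sets_restrict_space_iff)
  qed simp
qed auto

lemma emeasure_padic_haar_pball_nonpos: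
  "emeasure padic_haar (pball (a :: 'p::prime_card padic) (- int k)) = ennreal (real CARD('p) powi (- int k))"
proof -
  obtain m :: nat where m: "{x. x \<ge> 0 \<and> monna x \<in> pball a (- int k)}
      = {real m / real CARD('p) ^ k ..< (real m + 1) / real CARD('p) ^ k}"
    using monna_vimage_pball by blast
  have eq: "monna -` pball a (- int k) \<inter> space (restrict_space lborel {0..}) = {x. x \<ge> 0 \<and> monna x \<in> pball a (- int k)}"
    by (auto simp: space_restrict_space)
  have "emeasure padic_haar (pball a (- int k))
      = emeasure (restrict_space lborel {0..}) {x. x \<ge> 0 \<and> monna x \<in> pball a (- int k)}"
    unfolding padic_haar_def eq[symmetric]
    by (intro emeasure_distr measurable_monna) (simp add: open_pball)
  also have "\<dots> = emeasure lborel {x. x \<ge> 0 \<and> monna x \<in> pball a (- int k)}"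
    by (rule emeasure_restrict_space) auto
  also have "\<dots> = ennreal ((real m + 1) / real CARD('p) ^ k - real m / real CARD('p) ^ k)"
    unfolding m using prime_card_gt_1[where 'p='p] by (simp add: divide_right_mono)
  also have "(real m + 1) / real CARD('p) ^ k - real m / real CARD('p) ^ k = real CARD('p) powi (- int k)"
    by (simp add: power_int_minus divide_inverse left_diff_distrib[symmetric])
  finally show ?thesis .
qed

lemma emeasure_padic_haar_ints [simp]: "emeasure padic_haar (padic_ints :: 'p::prime_card padic set) = 1"
  using emeasure_padic_haar_pball_nonpos[of "0 :: 'p padic" 0] by (simp add: pball_0_0)

section \<open>Measurability of the field operations and translation invariance\<close>

lemma measurable_padic_plus [measurable (raw)]:
  fixes f g :: "'a \<Rightarrow> 'p::prime_card padic"
  assumes "f \<in> borel_measurable M" "g \<in> borel_measurable M"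
  shows "(\<lambda>x. f x + g x) \<in> borel_measurable M"
  using assms by (rule borel_measurable_continuous_Pair) (intro continuous_intros)

lemma measurable_padic_mult [measurable (raw)]:
  fixes f g :: "'a \<Rightarrow> 'p::prime_card padic"
  assumes "f \<in> borel_measurable M" "g \<in> borel_measurable M"
  shows "(\<lambda>x. f x * g x) \<in> borel_measurable M"
proof (rule borel_measurable_continuous_Pair[OF assms])
  show "continuous_on UNIV (\<lambda>x :: 'p padic \<times> 'p padic. fst x * snd x)"
    unfolding continuous_on_def by (intro ballI tendsto_mult tendsto_intros)
qed

text \<open>Translation permutes the balls of each radius, and balls of equal radius have equal
  mass.\<close>

lemma padic_haar_translate:
  "distr padic_haar borel (\<lambda>x. c + x) = (padic_haar :: 'p::prime_card padic measure)"
proof (rule padic_measure_eqI)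
  show 1: "emeasure (distr padic_haar borel (\<lambda>x. c + x)) (pball a (- int k))
      = emeasure padic_haar (pball a (- int k))" for a :: "'p padic" and k
  proof -
    have "(\<lambda>x. c + x) -` pball a (- int k) \<inter> space padic_haar = pball (a - c) (- int k)"
      by (auto simp: pball_def algebra_simps)
    then show ?thesis
      by (subst emeasure_distr) (simp_all add: open_pball emeasure_padic_haar_pball_nonpos)
  qed
  show "emeasure (distr padic_haar borel (\<lambda>x. c + x)) (pball a 0) \<noteq> \<infinity>" for a :: "'p padic"
    using 1[of a 0] emeasure_padic_haar_pball_nonpos[of a 0] by simp
qed simp_all

interpretation padic_haar: sigma_finite_measure "padic_haar :: 'p::prime_card padic measure"
proof
  let ?A = "range (\<lambda>q. pball (padic_of_rat q :: 'p padic) 0)"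
  show "\<exists>A. countable A \<and> A \<subseteq> sets (padic_haar :: 'p padic measure) \<and> \<Union>A = space padic_haar \<and>
      (\<forall>a\<in>A. emeasure padic_haar a \<noteq> \<infinity>)"
    using emeasure_padic_haar_pball_nonpos[of "_ :: 'p padic" 0] Union_unit_pballs[where 'p='p]
    by (intro exI[of _ ?A]) (auto simp: open_pball)
qed

section \<open>Haar measure on finite powers of the field\<close>

interpretation padic_prod: product_sigma_finite "\<lambda>_ :: 'i. padic_haar :: 'p::prime_card padic measure"
  by (rule product_sigma_finite.intro) (rule padic_haar.sigma_finite_measure_axioms)

abbreviation haar_prod :: "'i set \<Rightarrow> ('i \<Rightarrow> 'p::prime_card padic) measure" where
  "haar_prod I \<equiv> PiM I (\<lambda>_. padic_haar)"

abbreviation int_funs :: "'i set \<Rightarrow> ('i \<Rightarrow> 'p::prime_card padic) set" where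
  "int_funs I \<equiv> I \<rightarrow>\<^sub>E padic_ints"

lemma open_padic_ints: "open (padic_ints :: 'p::prime_card padic set)"
  unfolding pball_0_0[symmetric] by (rule open_pball)

lemma padic_ints_borel [measurable]: "padic_ints \<in> sets borel"
  by (simp add: open_padic_ints)

lemma measurable_padic_haar_eq [simp]:
  "measurable padic_haar N = measurable borel N" "measurable N padic_haar = measurable N borel"
  by (auto intro!: measurable_cong_sets)

lemma measurable_padic_translate: "(+) c \<in> borel_measurable (borel :: 'p::prime_card padic measure)"
  by (intro measurable_padic_plus measurable_const measurable_ident_sets) auto

lemma measurable_padic_uminus [measurable (raw)]:
  fixes f :: "'a \<Rightarrow> 'p::prime_card padic"
  assumes "f \<in> borel_measurable M"
  shows "(\<lambda>x. - f x) \<in> borel_measurable M"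
proof -
  have "(\<lambda>x. (- 1) * f x) \<in> borel_measurable M"
    by (intro measurable_padic_mult measurable_const assms) simp
  then show ?thesis by (simp only: mult_minus1)
qed

lemma sets_haar_prod: "sets (haar_prod I) = sets (PiM I (\<lambda>_. borel))"
  by (rule sets_PiM_cong) simp_all

lemma space_haar_prod [simp]: "space (haar_prod I) = extensional I"
  by (simp add: space_PiM PiE_def)

lemma sigma_finite_haar_prod: "finite I \<Longrightarrow> sigma_finite_measure (haar_prod I)"
  by (rule padic_prod.sigma_finite)

lemma int_funs_sets [measurable]: "finite I \<Longrightarrow> int_funs I \<in> sets (haar_prod I)"
  by (intro sets_PiM_I_finite) (simp_all add: open_padic_ints)

lemma emeasure_haar_prod_int_funs [simp]: "finite I \<Longrightarrow> emeasure (haar_prod I) (int_funs I) = 1"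
  by (subst padic_prod.emeasure_PiM) (simp_all add: open_padic_ints)

lemma measurable_padic_sum [measurable (raw)]:
  fixes f :: "'i \<Rightarrow> 'a \<Rightarrow> 'p::prime_card padic"
  assumes "\<And>i. i \<in> I \<Longrightarrow> f i \<in> borel_measurable M"
  shows "(\<lambda>x. \<Sum>i\<in>I. f i x) \<in> borel_measurable M"
  using assms by (induction I rule: infinite_finite_induct) simp_all

lemma measurable_haar_prod_component:
  assumes "i \<in> I" "f \<in> M \<rightarrow>\<^sub>M haar_prod I"
  shows "(\<lambda>x. f x i) \<in> borel_measurable M"
  using measurable_compose[OF assms(2) measurable_component_singleton[OF assms(1)]]
    measurable_cong_sets[OF refl sets_padic_haar] by blast

lemma measurable_haar_prod_proj: "i \<in> I \<Longrightarrow> (\<lambda>x. x i) \<in> borel_measurable (haar_prod I)"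
  using measurable_component_singleton[of i I "\<lambda>_. padic_haar"] by simp

lemma sets_Collect_padic_ints:
  assumes "f \<in> borel_measurable M"
  shows "{x \<in> space M. f x \<in> (padic_ints :: 'p::prime_card padic set)} \<in> sets M"
proof -
  have "f -` padic_ints \<inter> space M = {x \<in> space M. f x \<in> padic_ints}" by blast
  then show ?thesis using measurable_sets[OF assms padic_ints_borel] by simp
qed

lemma measurable_into_haar_prod:
  assumes "\<And>i. i \<in> I \<Longrightarrow> (\<lambda>x. f x i) \<in> borel_measurable M"
  shows "(\<lambda>x. \<lambda>i\<in>I. f x i) \<in> M \<rightarrow>\<^sub>M haar_prod I"
  using assms by (intro measurable_restrict) simp

section \<open>Translations on finite powers and uniqueness of the invariant measure\<close>

definition vec_add :: "'i set \<Rightarrow> ('i \<Rightarrow> 'a::plus) \<Rightarrow> ('i \<Rightarrow> 'a) \<Rightarrow> 'i \<Rightarrow> 'a" where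
  "vec_add I x y = (\<lambda>i\<in>I. x i + y i)"

lemma measurable_vec_add [measurable (raw)]:
  assumes "f \<in> M \<rightarrow>\<^sub>M haar_prod I" "g \<in> M \<rightarrow>\<^sub>M haar_prod I"
  shows "(\<lambda>x. vec_add I (f x) (g x)) \<in> M \<rightarrow>\<^sub>M haar_prod I"
  unfolding vec_add_def
  by (intro measurable_into_haar_prod measurable_padic_plus measurable_haar_prod_component[OF _ assms(1)]
      measurable_haar_prod_component[OF _ assms(2)])

lemma measurable_vec_add_const: "vec_add I c \<in> haar_prod I \<rightarrow>\<^sub>M haar_prod I"
  unfolding vec_add_def
  by (intro measurable_into_haar_prod measurable_padic_plus measurable_const measurable_haar_prod_proj) auto

lemma haar_prod_translate:
  assumes "finite I"
  shows "distr (haar_prod I) (haar_prod I) (vec_add I c) = (haar_prod I :: ('i \<Rightarrow> 'p::prime_card padic) measure)"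
proof (rule padic_prod.PiM_eqI[OF assms])
  fix A :: "'i \<Rightarrow> 'p padic set" assume A: "\<And>i. i \<in> I \<Longrightarrow> A i \<in> sets padic_haar"
  have m: "(\<lambda>x. c i + x) -` A i \<in> sets padic_haar" if "i \<in> I" for i
    using A[OF that] measurable_sets[of "(+) (c i)" padic_haar borel "A i"]
    by (simp add: measurable_padic_translate)
  note m' = measurable_vec_add_const[of I c]
  have "vec_add I c -` Pi\<^sub>E I A \<inter> space (haar_prod I) = (\<Pi>\<^sub>E i\<in>I. (\<lambda>x. c i + x) -` A i)"
    by (auto simp: vec_add_def PiE_iff extensional_def)
  then have "emeasure (distr (haar_prod I) (haar_prod I) (vec_add I c)) (Pi\<^sub>E I A)
      = emeasure (haar_prod I) (\<Pi>\<^sub>E i\<in>I. (\<lambda>x. c i + x) -` A i)"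
    using A assms by (subst emeasure_distr[OF m']) (auto intro!: sets_PiM_I_finite)
  also have "\<dots> = (\<Prod>i\<in>I. emeasure padic_haar ((\<lambda>x. c i + x) -` A i))"
    using m by (intro padic_prod.emeasure_PiM assms)
  also have "\<dots> = (\<Prod>i\<in>I. emeasure padic_haar (A i))"
  proof (rule prod.cong)
    fix i assume "i \<in> I"
    then have "emeasure (distr padic_haar borel (\<lambda>x. c i + x)) (A i) = emeasure padic_haar ((\<lambda>x. c i + x) -` A i)"
      using A[of i] by (subst emeasure_distr) (auto simp: measurable_padic_translate)
    then show "emeasure padic_haar ((\<lambda>x. c i + x) -` A i) = emeasure padic_haar (A i)"
      by (simp add: padic_haar_translate)
  qed simp
  finally show "emeasure (distr (haar_prod I) (haar_prod I) (vec_add I c)) (Pi\<^sub>E I A)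
      = (\<Prod>i\<in>I. emeasure padic_haar (A i))" .
qed simp

text \<open>Invariance is phrased with preimages because these are measurable as soon as the
  translation is; for images this would need an extra argument.\<close>

definition trans_invariant :: "'i set \<Rightarrow> ('i \<Rightarrow> 'p::prime_card padic) measure \<Rightarrow> bool" where
  "trans_invariant I M \<longleftrightarrow> sets M = sets (haar_prod I) \<and>
    (\<forall>c\<in>extensional I. \<forall>X\<in>sets M. emeasure M (vec_add I c -` X \<inter> space M) = emeasure M X)"

lemma trans_invariant_space: "trans_invariant I M \<Longrightarrow> space M = extensional I"
  unfolding trans_invariant_def by (metis sets_eq_imp_space_eq space_haar_prod)

lemma trans_invariant_distr:
  assumes "trans_invariant I M" "c \<in> extensional I"
  shows "distr M M (vec_add I c) = M"
proof (rule measure_eqI)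
  have [measurable_cong, simp]: "sets M = sets (haar_prod I)"
    using assms(1) by (simp add: trans_invariant_def)
  fix X assume X: "X \<in> sets (distr M M (vec_add I c))"
  have "vec_add I c \<in> M \<rightarrow>\<^sub>M M"
    using measurable_vec_add_const[of I c] by (simp cong: measurable_cong_sets)
  with X show "emeasure (distr M M (vec_add I c)) X = emeasure M X"
    using assms by (subst emeasure_distr) (auto simp: trans_invariant_def)
qed simp

lemma trans_invariant_haar_prod:
  assumes "finite I"
  shows "trans_invariant I (haar_prod I)"
  unfolding trans_invariant_def
proof (intro conjI ballI refl)
  fix c :: "'a \<Rightarrow> 'b padic" and X :: "('a \<Rightarrow> 'b padic) set"
  assume c: "c \<in> extensional I" and X: "X \<in> sets (haar_prod I)"
  from emeasure_distr[OF measurable_vec_add_const X]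
  show "emeasure (haar_prod I) (vec_add I c -` X \<inter> space (haar_prod I)) = emeasure (haar_prod I) X"
    by (simp add: haar_prod_translate[OF assms])
qed

text \<open>The rationals are dense and \<open>I\<close> is finite, so countably many rational
  translates of O^I cover the space, all with the finite mass of O^I. This is what licenses Fubini
  in the uniqueness proof.\<close>

lemma trans_invariant_sigma_finite:
  assumes I: "finite I" and M: "trans_invariant I (M :: ('i \<Rightarrow> 'p::prime_card padic) measure)"
    and fin: "emeasure M (int_funs I) \<noteq> \<infinity>"
  shows "sigma_finite_measure M"
proof
  have sM: "sets M = sets (haar_prod I)" using M by (simp add: trans_invariant_def)
  have spM: "space M = extensional I" using M by (rule trans_invariant_space)
  \<comment> \<open>\<open>?B q\<close> is the coset q + O^I, written as the preimage of O^I under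
    translation by -q.\<close>
  let ?B = "\<lambda>q. vec_add I (\<lambda>i\<in>I. - padic_of_rat (q i)) -` int_funs I \<inter> space M"
  let ?A = "?B ` (I \<rightarrow>\<^sub>E (UNIV :: rat set))"
  have "countable ?A" using I by (intro countable_image countable_PiE) auto
  moreover have B: "?B q \<in> sets M" for q
    using measurable_sets[OF measurable_vec_add_const int_funs_sets[OF I]] by (simp add: sM spM)
  moreover have "\<Union>?A = space M"
  proof
    show "space M \<subseteq> \<Union>?A"
    proof
      fix x assume x: "x \<in> space M"
      have "\<exists>q. padic_norm (x i - padic_of_rat q) < 1" for i
        using padic_of_rat_dense[of 1 "x i"] by simp
      then obtain q where q: "\<And>i. padic_norm (x i - padic_of_rat (q i)) < 1" by metis
      have "restrict q I \<in> I \<rightarrow>\<^sub>E UNIV" by simp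
      moreover have "x \<in> ?B (restrict q I)"
        using x q by (auto simp: vec_add_def PiE_iff padic_ints_iff less_imp_le)
      ultimately show "x \<in> \<Union>?A" by (rule UN_I[where B = ?B])
    qed
  qed auto
  moreover have "emeasure M (?B q) = emeasure M (int_funs I)" for q
    using M int_funs_sets[OF I] by (auto simp: trans_invariant_def)
  ultimately show "\<exists>A. countable A \<and> A \<subseteq> sets M \<and> \<Union>A = space M \<and> (\<forall>a\<in>A. emeasure M a \<noteq> \<infinity>)"
    using fin by (intro exI[of _ ?A]) auto
qed

text \<open>
  Evaluate \<open>\<integral>\<integral> 1\<^sub>O(y) 1\<^sub>X(y + x) dy dM(x)\<close> in both orders.
\<close>

theorem trans_invariant_unique:
  assumes I: "finite I" and M: "trans_invariant I (M :: ('i \<Rightarrow> 'p::prime_card padic) measure)"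
    and fin: "emeasure M (int_funs I) \<noteq> \<infinity>"
  shows "M = scale_measure (emeasure M (int_funs I)) (haar_prod I)"
proof (rule measure_eqI)
  have sM[measurable_cong]: "sets M = sets (haar_prod I)" using M by (simp add: trans_invariant_def)
  then show "sets M = sets (scale_measure (emeasure M (int_funs I)) (haar_prod I))" by simp
  have spM: "space M = extensional I" using M by (rule trans_invariant_space)
  interpret M: sigma_finite_measure M by (rule trans_invariant_sigma_finite[OF I M fin])
  interpret L: sigma_finite_measure "haar_prod I :: ('i \<Rightarrow> 'p padic) measure"
    by (rule sigma_finite_haar_prod[OF I])
  interpret PM: pair_sigma_finite M "haar_prod I :: ('i \<Rightarrow> 'p padic) measure" ..
  let ?O = "int_funs I :: ('i \<Rightarrow> 'p padic) set"
  let ?m = "\<lambda>x. \<lambda>i\<in>I. - x i :: 'p padic"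
  note int_funs_sets[OF I, measurable]
  fix X assume X: "X \<in> sets M"
  then have [measurable]: "X \<in> sets (haar_prod I)" by (simp add: sM)
  have mneg: "?m \<in> haar_prod I \<rightarrow>\<^sub>M haar_prod I"
    by (intro measurable_into_haar_prod measurable_padic_uminus measurable_haar_prod_proj)
  note mneg[measurable]
  have mneg'[measurable]: "(\<lambda>x. ?m (f x)) \<in> N \<rightarrow>\<^sub>M haar_prod I" if "f \<in> N \<rightarrow>\<^sub>M haar_prod I" for f and N :: "'b measure"
    using measurable_compose[OF that mneg] .
  \<comment> \<open>The factor inserted here is the Haar mass 1 of O^I; invariance of
    \<open>M\<close> then allows a shift of \<open>X\<close> by \<open>y\<close> inside.\<close>
  have "emeasure M X = (\<integral>\<^sup>+y. indicator ?O y * emeasure M X \<partial>haar_prod I)"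
    by (subst nn_integral_multc) (simp_all add: I)
  also have "\<dots> = (\<integral>\<^sup>+y. (\<integral>\<^sup>+x. indicator ?O y * indicator X (vec_add I y x) \<partial>M) \<partial>haar_prod I)"
  proof (rule nn_integral_cong)
    fix y :: "'i \<Rightarrow> 'p padic" assume "y \<in> space (haar_prod I)"
    then have y: "y \<in> extensional I" by simp
    have [measurable]: "vec_add I y \<in> M \<rightarrow>\<^sub>M haar_prod I"
      using measurable_vec_add_const[of I y] by (simp cong: measurable_cong_sets add: sM)
    have m: "vec_add I y \<in> M \<rightarrow>\<^sub>M M"
      using measurable_vec_add_const[of I y] by (simp cong: measurable_cong_sets add: sM)
    have "(\<integral>\<^sup>+x. indicator X (vec_add I y x) \<partial>M) = (\<integral>\<^sup>+x. indicator X x \<partial>distr M M (vec_add I y))"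
      using X by (intro nn_integral_distr[symmetric, OF m]) simp
    also have "\<dots> = emeasure M X" using X by (simp add: trans_invariant_distr[OF M y])
    finally show "indicator ?O y * emeasure M X = (\<integral>\<^sup>+x. indicator ?O y * indicator X (vec_add I y x) \<partial>M)"
      by (subst nn_integral_cmult) simp_all
  qed
  also have "\<dots> = (\<integral>\<^sup>+x. (\<integral>\<^sup>+y. indicator ?O y * indicator X (vec_add I y x) \<partial>haar_prod I) \<partial>M)"
    by (rule PM.Fubini') measurable
  \<comment> \<open>Replacing \<open>y\<close> by y - x, by invariance of \<open>haar_prod\<close>,
    moves \<open>x\<close> out of the condition on \<open>X\<close> into the condition on
    O^I.\<close>
  also have "\<dots> = (\<integral>\<^sup>+x. (\<integral>\<^sup>+y. indicator ?O (vec_add I y (?m x)) * indicator X y \<partial>haar_prod I) \<partial>M)"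
  proof (rule nn_integral_cong)
    fix x assume "x \<in> space M"
    then have x: "x \<in> extensional I" by (simp add: spM)
    have mx: "vec_add I x \<in> haar_prod I \<rightarrow>\<^sub>M haar_prod I" by (rule measurable_vec_add_const)
    have mx2: "(\<lambda>y. vec_add I y (?m x)) \<in> haar_prod I \<rightarrow>\<^sub>M haar_prod I" using x by measurable
    note mx2[measurable]
    have "(\<integral>\<^sup>+y. indicator ?O (vec_add I y (?m x)) * indicator X y \<partial>haar_prod I)
      = (\<integral>\<^sup>+y. indicator ?O (vec_add I y (?m x)) * indicator X y \<partial>distr (haar_prod I) (haar_prod I) (vec_add I x))"
      by (simp add: haar_prod_translate[OF I])
    also have "\<dots> = (\<integral>\<^sup>+y. indicator ?O (vec_add I (vec_add I x y) (?m x)) * indicator X (vec_add I x y) \<partial>haar_prod I)"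
      by (rule nn_integral_distr[OF mx]) measurable
    also have "\<dots> = (\<integral>\<^sup>+y. indicator ?O y * indicator X (vec_add I y x) \<partial>haar_prod I)"
    proof (rule nn_integral_cong)
      fix y :: "'i \<Rightarrow> 'p padic" assume "y \<in> space (haar_prod I)"
      then have "vec_add I (vec_add I x y) (?m x) = y" "vec_add I x y = vec_add I y x"
        by (auto simp: vec_add_def extensional_def fun_eq_iff)
      then show "indicator ?O (vec_add I (vec_add I x y) (?m x)) * indicator X (vec_add I x y)
          = (indicator ?O y * indicator X (vec_add I y x) :: ennreal)" by simp
    qed
    finally show "(\<integral>\<^sup>+y. indicator ?O y * indicator X (vec_add I y x) \<partial>haar_prod I)
      = (\<integral>\<^sup>+y. indicator ?O (vec_add I y (?m x)) * indicator X y \<partial>haar_prod I)" ..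
  qed
  also have "\<dots> = (\<integral>\<^sup>+y. (\<integral>\<^sup>+x. indicator ?O (vec_add I y (?m x)) * indicator X y \<partial>M) \<partial>haar_prod I)"
    by (rule PM.Fubini'[symmetric]) measurable
  also have "\<dots> = (\<integral>\<^sup>+y. emeasure M ?O * indicator X y \<partial>haar_prod I)"
  proof (rule nn_integral_cong)
    fix y :: "'i \<Rightarrow> 'p padic" assume "y \<in> space (haar_prod I)"
    then have y: "y \<in> extensional I" by simp
    have [measurable]: "(\<lambda>x. vec_add I y (?m x)) \<in> M \<rightarrow>\<^sub>M haar_prod I"
      using measurable_compose[OF mneg measurable_vec_add_const[of I y]]
      by (simp cong: measurable_cong_sets add: sM)
    have m: "vec_add I (?m y) \<in> M \<rightarrow>\<^sub>M M"
      using measurable_vec_add_const[of I "?m y"] by (simp cong: measurable_cong_sets add: sM)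
    \<comment> \<open>O is symmetric under negation, so the condition on y - x is one on x - y, a
      translate in \<open>x\<close> to which the invariance of \<open>M\<close> applies.\<close>
    have "y i - x i \<in> padic_ints \<longleftrightarrow> x i - y i \<in> padic_ints" for x i
      by (simp add: padic_ints_iff padic_norm_diff_commute)
    then have "vec_add I y (?m x) \<in> ?O \<longleftrightarrow> vec_add I (?m y) x \<in> ?O" for x
      by (simp add: vec_add_def PiE_iff)
    then have "(\<integral>\<^sup>+x. indicator ?O (vec_add I y (?m x)) \<partial>M) = (\<integral>\<^sup>+x. indicator ?O (vec_add I (?m y) x) \<partial>M)"
      by (simp only: indicator_def)
    also have "\<dots> = (\<integral>\<^sup>+x. indicator ?O x \<partial>distr M M (vec_add I (?m y)))"
      using int_funs_sets[OF I] by (intro nn_integral_distr[symmetric, OF m]) (simp add: sM)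
    also have "\<dots> = emeasure M ?O"
      using int_funs_sets[OF I] by (simp add: trans_invariant_distr[OF M] sM)
    finally show "(\<integral>\<^sup>+x. indicator ?O (vec_add I y (?m x)) * indicator X y \<partial>M) = emeasure M ?O * indicator X y"
      by (subst nn_integral_multc) simp_all
  qed
  also have "\<dots> = emeasure M ?O * emeasure (haar_prod I) X"
    by (subst nn_integral_cmult) simp_all
  finally show "emeasure M X = emeasure (scale_measure (emeasure M ?O) (haar_prod I)) X" by simp
qed

section \<open>Linear changes of variables\<close>

lemma trans_invariantD:
  assumes "trans_invariant I M" "c \<in> extensional I" "X \<in> sets M"
  shows "emeasure M (vec_add I c -` X \<inter> space M) = emeasure M X"
  using assms by (simp add: trans_invariant_def)

text \<open>Vectors are functions supported on an initial segment of the naturals, and not elements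
  of the vector type, so that the product measures apply to them directly.\<close>

definition mat_act :: "'a::comm_semiring_0 mat \<Rightarrow> (nat \<Rightarrow> 'a) \<Rightarrow> nat \<Rightarrow> 'a" where
  "mat_act A x = (\<lambda>i\<in>{..<dim_row A}. \<Sum>j<dim_col A. A $$ (i, j) * x j)"

lemma mat_act_extensional [simp]: "A \<in> carrier_mat n m \<Longrightarrow> mat_act A x \<in> extensional {..<n}"
  by (auto simp: mat_act_def)

lemma mat_act_mult:
  assumes "A \<in> carrier_mat n k" "B \<in> carrier_mat k m"
  shows "mat_act (A * B) x = mat_act A (mat_act B x)"
proof
  fix i
  show "mat_act (A * B) x i = mat_act A (mat_act B x) i"
  proof (cases "i < n")
    case True
    then have "mat_act (A * B) x i = (\<Sum>j<m. (\<Sum>l<k. A $$ (i, l) * B $$ (l, j)) * x j)"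
      using assms by (auto simp: mat_act_def scalar_prod_def atLeast0LessThan intro!: sum.cong)
    also have "\<dots> = (\<Sum>l<k. A $$ (i, l) * (\<Sum>j<m. B $$ (l, j) * x j))"
      by (simp add: sum_distrib_left sum_distrib_right mult.assoc) (rule sum.swap)
    also have "\<dots> = mat_act A (mat_act B x) i"
      using assms True by (auto simp: mat_act_def intro!: sum.cong)
    finally show ?thesis .
  qed (use assms in \<open>simp add: mat_act_def\<close>)
qed

lemma mat_act_one:
  fixes x :: "nat \<Rightarrow> 'a::comm_semiring_1"
  shows "x \<in> extensional {..<n} \<Longrightarrow> mat_act (1\<^sub>m n) x = x"
  by (auto simp: mat_act_def fun_eq_iff extensional_def if_distrib[of "\<lambda>a. a * _"] cong: if_cong)

lemma mat_act_diag: "mat_act (mat_diag n d) x = (\<lambda>i\<in>{..<n}. d i * x i)"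
  by (auto simp: mat_act_def fun_eq_iff mat_diag_def if_distrib[of "\<lambda>a. a * _"] cong: if_cong)

lemma mat_act_vec_add:
  assumes "A \<in> carrier_mat n m"
  shows "mat_act A (vec_add {..<m} x y) = vec_add {..<n} (mat_act A x) (mat_act A y)"
  using assms by (auto simp: mat_act_def vec_add_def fun_eq_iff distrib_left sum.distrib)

lemma vec_add_extensional [simp]: "vec_add I x y \<in> extensional I"
  by (simp add: vec_add_def)

lemma measurable_mat_act:
  assumes "A \<in> carrier_mat n m"
  shows "mat_act A \<in> haar_prod {..<m} \<rightarrow>\<^sub>M (haar_prod {..<n} :: (nat \<Rightarrow> 'p::prime_card padic) measure)"
  using assms unfolding mat_act_def
  by (auto intro!: measurable_into_haar_prod measurable_padic_sum measurable_padic_mult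
      measurable_haar_prod_proj)

lemma int_mats_carrier: "A \<in> int_mats n \<Longrightarrow> A \<in> carrier_mat n n"
  by (simp add: int_mats_def)

lemma GL_int_carrier: "A \<in> GL_int n \<Longrightarrow> A \<in> carrier_mat n n"
  by (simp add: GL_int_def int_mats_def)

lemma mat_act_int_mats:
  assumes "A \<in> int_mats n" "x \<in> int_funs {..<n}"
  shows "mat_act A x \<in> int_funs {..<n}"
  using assms
  by (auto simp: int_mats_def mat_act_def PiE_iff intro!: padic_ints_sum padic_ints_mult)

text \<open>A translation by \<open>e\<close> pulls back along \<open>A\<close> to the translation
  by \<open>B\<close> applied to \<open>e\<close>, so the image measure is again invariant. By
  uniqueness it is a multiple of Haar measure, and evaluation at O^n gives the factor. This stands
  in for the determinant formula.\<close>

lemma distr_mat_act: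
  fixes A B :: "'p::prime_card padic mat"
  assumes A: "A \<in> carrier_mat n n" and B: "B \<in> carrier_mat n n" and AB: "A * B = 1\<^sub>m n"
  defines "c \<equiv> emeasure (haar_prod {..<n}) {x \<in> extensional {..<n}. mat_act A x \<in> int_funs {..<n}}"
  assumes fin: "c \<noteq> \<infinity>"
  shows "distr (haar_prod {..<n}) (haar_prod {..<n}) (mat_act A) = scale_measure c (haar_prod {..<n})"
proof -
  let ?L = "haar_prod {..<n} :: (nat \<Rightarrow> 'p padic) measure"
  let ?M = "distr ?L ?L (mat_act A)"
  have m: "mat_act A \<in> ?L \<rightarrow>\<^sub>M ?L" by (rule measurable_mat_act[OF A])
  have c: "c = emeasure ?M (int_funs {..<n})"
    unfolding c_def by (subst emeasure_distr[OF m int_funs_sets]) (auto intro!: arg_cong[where f = "emeasure _"])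
  have "trans_invariant {..<n} ?M"
    unfolding trans_invariant_def
  proof (intro conjI ballI)
    fix e :: "nat \<Rightarrow> 'p padic" and X assume e: "e \<in> extensional {..<n}" and "X \<in> sets ?M"
    then have X: "X \<in> sets ?L" by simp
    have X': "mat_act A -` X \<inter> space ?L \<in> sets ?L" by (rule measurable_sets[OF m X])
    have *: "mat_act A (mat_act B e) = e"
      using mat_act_mult[OF A B, of e] AB e by (simp add: mat_act_one)
    have "emeasure ?M (vec_add {..<n} e -` X \<inter> space ?M)
        = emeasure ?L (mat_act A -` (vec_add {..<n} e -` X \<inter> space ?L) \<inter> space ?L)"
      using measurable_sets[OF measurable_vec_add_const X] by (subst emeasure_distr[OF m]) auto
    also have "mat_act A -` (vec_add {..<n} e -` X \<inter> space ?L) \<inter> space ?L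
        = vec_add {..<n} (mat_act B e) -` (mat_act A -` X \<inter> space ?L) \<inter> space ?L"
      using A B by (auto simp: mat_act_vec_add[OF A] *)
    also have "emeasure ?L \<dots> = emeasure ?L (mat_act A -` X \<inter> space ?L)"
      using X' B by (intro trans_invariantD[OF trans_invariant_haar_prod]) auto
    also have "\<dots> = emeasure ?M X" by (rule emeasure_distr[OF m X, symmetric])
    finally show "emeasure ?M (vec_add {..<n} e -` X \<inter> space ?M) = emeasure ?M X" .
  qed simp
  from trans_invariant_unique[OF _ this] fin show ?thesis by (simp add: c)
qed

lemma mat_act_GL_int_iff:
  assumes "A \<in> GL_int n" "x \<in> extensional {..<n}"
  shows "mat_act A x \<in> int_funs {..<n} \<longleftrightarrow> x \<in> int_funs {..<n}"
proof -
  obtain B where A: "A \<in> int_mats n" and B: "B \<in> int_mats n" "B * A = 1\<^sub>m n"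
    using assms(1) by (auto simp: GL_int_def)
  have "mat_act B (mat_act A x) = x"
    using mat_act_mult[OF int_mats_carrier[OF B(1)] int_mats_carrier[OF A], of x] B(2) assms(2)
    by (simp add: mat_act_one)
  then show ?thesis using mat_act_int_mats[OF A] mat_act_int_mats[OF B(1)] by metis
qed

text \<open>O^n is its own preimage under \<open>A\<close>, so the scaling factor is 1.\<close>

lemma distr_mat_act_GL_int:
  assumes "A \<in> GL_int n"
  shows "distr (haar_prod {..<n}) (haar_prod {..<n}) (mat_act A)
    = (haar_prod {..<n} :: (nat \<Rightarrow> 'p::prime_card padic) measure)"
proof -
  obtain B where AB: "A \<in> carrier_mat n n" "B \<in> carrier_mat n n" "A * B = 1\<^sub>m n"
    using assms by (auto simp: GL_int_def int_mats_def)
  have "{x \<in> extensional {..<n}. mat_act A x \<in> int_funs {..<n}} = int_funs {..<n}"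
    using mat_act_GL_int_iff[OF assms] by (auto simp: PiE_def)
  with distr_mat_act[OF AB] show ?thesis by simp
qed

section \<open>Scaling in one variable and by diagonal matrices\<close>

lemma emeasure_padic_haar_pball_translate:
  "emeasure padic_haar (pball (a :: 'p::prime_card padic) k) = emeasure padic_haar (pball (0 :: 'p padic) k)"
proof -
  have "emeasure padic_haar (pball a k) = emeasure (distr padic_haar borel (\<lambda>x. a + x)) (pball a k)"
    by (simp add: padic_haar_translate)
  also have "\<dots> = emeasure padic_haar ((\<lambda>x. a + x) -` pball a k \<inter> space padic_haar)"
    by (rule emeasure_distr) (simp_all add: measurable_padic_translate open_pball)
  also have "(\<lambda>x. a + x) -` pball a k \<inter> space padic_haar = pball 0 k" by (auto simp: pball_def)
  finally show ?thesis .
qed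

lemma emeasure_haar_prod_1:
  assumes "X \<in> sets borel"
  shows "emeasure (haar_prod {..<1::nat}) {x \<in> extensional {..<1}. x 0 \<in> X} = emeasure padic_haar X"
proof -
  have "{x \<in> extensional {..<1}. x 0 \<in> X} = ({..<1::nat} \<rightarrow>\<^sub>E X)" by (auto simp: PiE_def)
  then show ?thesis using assms by (simp add: padic_prod.emeasure_PiM)
qed

lemma pball_borel [measurable, simp]: "pball a k \<in> sets borel"
  by (simp add: open_pball)

text \<open>Large balls are reached by scaling. Multiplication by d = p^(-k) pulls the unit ball
  back to the ball of radius p^(-k), whose mass is known and is the scaling factor; it pulls the
  ball of radius p^k back to the unit ball.\<close>

lemma emeasure_padic_haar_pball:
  "emeasure padic_haar (pball (a :: 'p::prime_card padic) k) = ennreal (real CARD('p) powi k)"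
proof (cases "k \<le> 0")
  case True
  then show ?thesis using emeasure_padic_haar_pball_nonpos[of a "nat (- k)"] by simp
next
  case False
  let ?L = "haar_prod {..<1} :: (nat \<Rightarrow> 'p padic) measure"
  have p: "real CARD('p) > 1" by (rule prime_card_gt_1)
  define d where "d = (of_nat CARD('p) :: 'p padic) powi (- k)"
  have d: "padic_norm d = real CARD('p) powi k"
    unfolding d_def padic_norm_powi padic_norm_card by (simp add: power_int_minus power_int_inverse)
  then have d0: "d \<noteq> 0" using p by auto
  let ?A = "mat_diag 1 (\<lambda>_. d)" and ?B = "mat_diag 1 (\<lambda>_. inverse d)"
  have AB: "?A \<in> carrier_mat 1 1" "?B \<in> carrier_mat 1 1" "?A * ?B = 1\<^sub>m 1"
    using d0 by (auto simp: mat_diag_def scalar_prod_def)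
  have scale: "d * x \<in> pball 0 l \<longleftrightarrow> x \<in> pball 0 (l - k)" for x l
    using p by (simp add: pball_def padic_norm_mult d power_int_diff field_simps)
  have "{x \<in> extensional {..<1}. mat_act ?A x \<in> int_funs {..<1}}
      = {x \<in> extensional {..<1::nat}. x 0 \<in> pball 0 (- k)}"
    using scale[of _ 0] by (auto simp: mat_act_diag PiE_iff pball_0_0)
  then have c: "emeasure ?L {x \<in> extensional {..<1}. mat_act ?A x \<in> int_funs {..<1}} = ennreal (real CARD('p) powi (- k))"
    using False emeasure_padic_haar_pball_nonpos[of "0 :: 'p padic" "nat k"]
    by (simp only: emeasure_haar_prod_1 pball_borel) simp
  have D: "distr ?L ?L (mat_act ?A) = scale_measure (ennreal (real CARD('p) powi (- k))) ?L"
    using distr_mat_act[OF AB] c by simp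
  let ?S = "\<lambda>k. {x \<in> extensional {..<1::nat}. x 0 \<in> pball (0 :: 'p padic) k}"
  have S: "?S k \<in> sets ?L" for k
  proof -
    have "?S k = ({..<1::nat} \<rightarrow>\<^sub>E pball 0 k)" by (auto simp: PiE_def)
    then show ?thesis by (simp only:) (intro sets_PiM_I_finite, auto)
  qed
  have "ennreal (real CARD('p) powi (- k)) * emeasure padic_haar (pball (0 :: 'p padic) k)
      = emeasure (distr ?L ?L (mat_act ?A)) (?S k)"
    unfolding D by (simp only: emeasure_scale_measure emeasure_haar_prod_1 pball_borel)
  also have "\<dots> = emeasure ?L (mat_act ?A -` ?S k \<inter> space ?L)"
    by (rule emeasure_distr[OF measurable_mat_act S]) (rule AB)
  also have "mat_act ?A -` ?S k \<inter> space ?L = ?S 0"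
    using scale[of _ k] by (auto simp: mat_act_diag)
  also have "emeasure ?L (?S 0) = 1" by (simp only: emeasure_haar_prod_1 pball_0_0 padic_ints_borel emeasure_padic_haar_ints)
  finally have eq: "ennreal (real CARD('p) powi (- k)) * emeasure padic_haar (pball (0 :: 'p padic) k) = 1" .
  have "emeasure padic_haar (pball (0 :: 'p padic) k)
      = ennreal (real CARD('p) powi k) * ennreal (real CARD('p) powi (- k)) * emeasure padic_haar (pball (0 :: 'p padic) k)"
    using p by (simp add: ennreal_mult[symmetric] power_int_add[symmetric])
  also have "\<dots> = ennreal (real CARD('p) powi k)"
    using eq by (simp add: mult.assoc)
  finally show ?thesis by (simp add: emeasure_padic_haar_pball_translate[of a])
qed

lemma padic_affine_ints_borel: "{y. d * y + e \<in> (padic_ints :: 'p::prime_card padic set)} \<in> sets borel"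
proof -
  have "(\<lambda>y. d * y + e) \<in> borel_measurable (borel :: 'p padic measure)"
    by (intro measurable_padic_plus measurable_padic_mult measurable_const measurable_ident_sets) auto
  from sets_Collect_padic_ints[OF this] show ?thesis by simp
qed

lemma padic_scaled_ints_borel: "{x. d * x \<in> (padic_ints :: 'p::prime_card padic set)} \<in> sets borel"
  using padic_affine_ints_borel[of d 0] by simp

lemma emeasure_padic_haar_affine_ints:
  assumes "d \<noteq> 0"
  shows "emeasure padic_haar {x. d * x + c \<in> padic_ints} = ennreal (1 / padic_norm (d :: 'p::prime_card padic))"
proof -
  obtain k where k: "padic_norm d = real CARD('p) powi k" using padic_norm_values[OF assms] by blast
  have p: "real CARD('p) > 1" by (rule prime_card_gt_1)
  have "d * x + c \<in> padic_ints \<longleftrightarrow> x \<in> pball (- c / d) (- k)" for x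
  proof -
    have "d * x + c = d * (x - - c / d)" using assms by (simp add: field_simps)
    then have "padic_norm (d * x + c) = real CARD('p) powi k * padic_norm (x - - c / d)"
      by (simp only: padic_norm_mult k)
    then show ?thesis using p by (simp add: padic_ints_iff pball_def power_int_minus field_simps)
  qed
  then have "{x. d * x + c \<in> padic_ints} = pball (- c / d) (- k)" by blast
  then show ?thesis by (simp add: emeasure_padic_haar_pball k power_int_minus divide_inverse)
qed

text \<open>The preimage of O^n is a box with sides of volume 1 / |d_i|. The factor is the inverse
  of |det| because the measure is pushed forward.\<close>

lemma distr_mat_act_diag:
  fixes d :: "nat \<Rightarrow> 'p::prime_card padic"
  assumes d: "\<And>i. i < n \<Longrightarrow> d i \<noteq> 0"
  shows "distr (haar_prod {..<n}) (haar_prod {..<n}) (mat_act (mat_diag n d))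
    = scale_measure (ennreal (\<Prod>i<n. 1 / padic_norm (d i))) (haar_prod {..<n})"
proof -
  let ?L = "haar_prod {..<n} :: (nat \<Rightarrow> 'p padic) measure"
  let ?A = "mat_diag n d" and ?B = "mat_diag n (\<lambda>i. inverse (d i))"
  have AB: "?A \<in> carrier_mat n n" "?B \<in> carrier_mat n n" "?A * ?B = 1\<^sub>m n"
    using d by (auto simp: mat_diag_mult_left) (auto simp: mat_diag_def intro!: eq_matI)
  have "{x \<in> extensional {..<n}. mat_act ?A x \<in> int_funs {..<n}} = (\<Pi>\<^sub>E i\<in>{..<n}. {x. d i * x \<in> padic_ints})"
  proof (rule Set.set_eqI)
    fix x
    have "mat_act ?A x \<in> int_funs {..<n} \<longleftrightarrow> (\<forall>i\<in>{..<n}. d i * x i \<in> padic_ints)"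
      by (simp add: mat_act_diag PiE_iff)
    then show "x \<in> {x \<in> extensional {..<n}. mat_act ?A x \<in> int_funs {..<n}}
        \<longleftrightarrow> x \<in> (\<Pi>\<^sub>E i\<in>{..<n}. {x. d i * x \<in> padic_ints})"
      by (simp only: mem_Collect_eq PiE_iff conj_commute)
  qed
  then have c: "emeasure ?L {x \<in> extensional {..<n}. mat_act ?A x \<in> int_funs {..<n}}
      = (\<Prod>i<n. emeasure padic_haar {x. d i * x \<in> padic_ints})"
    by (simp add: padic_prod.emeasure_PiM padic_scaled_ints_borel)
  also have "\<dots> = (\<Prod>i<n. ennreal (1 / padic_norm (d i)))"
    using d emeasure_padic_haar_affine_ints[of "d _" 0] by (intro prod.cong) auto
  also have "\<dots> = ennreal (\<Prod>i<n. 1 / padic_norm (d i))"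
    by (rule prod_ennreal) simp
  finally show ?thesis using distr_mat_act[OF AB] by simp
qed

section \<open>Identification of \<open>vol\<close> with a product measure\<close>

abbreviation mat_index :: "nat \<Rightarrow> (nat \<times> nat) set" where
  "mat_index n \<equiv> {..<n} \<times> {..<n}"

text \<open>Together with \<open>Matrix.mat n n\<close> this is the bijection between
  \<open>carrier_mat n n\<close> and \<open>extensional (mat_index n)\<close> along which Haar
  measure is transported.\<close>

definition mat_entries :: "nat \<Rightarrow> 'a mat \<Rightarrow> nat \<times> nat \<Rightarrow> 'a" where
  "mat_entries n z = (\<lambda>ij\<in>mat_index n. z $$ ij)"

lemma mat_entries_extensional [simp]: "mat_entries n z \<in> extensional (mat_index n)"
  by (simp add: mat_entries_def)

lemma mat_of_mat_entries: "z \<in> carrier_mat n n \<Longrightarrow> Matrix.mat n n (mat_entries n z) = z"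
  by (auto simp: mat_entries_def)

lemma mat_entries_of_mat: "x \<in> extensional (mat_index n) \<Longrightarrow> mat_entries n (Matrix.mat n n x) = x"
  by (auto simp: mat_entries_def fun_eq_iff extensional_def)

lemma mat_entries_add:
  "z \<in> carrier_mat n n \<Longrightarrow> mat_entries n (A + z) = vec_add (mat_index n) (mat_entries n A) (mat_entries n z)"
  by (auto simp: mat_entries_def vec_add_def fun_eq_iff)

lemma space_borel_mat [simp]: "space (borel_mat n) = carrier_mat n n"
  by (simp add: borel_mat_def)

lemma measurable_mat_entries: "mat_entries n \<in> borel_mat n \<rightarrow>\<^sub>M (haar_prod (mat_index n) :: (_ \<Rightarrow> 'p::prime_card padic) measure)"
proof -
  have "mat_entries n \<in> borel_mat n \<rightarrow>\<^sub>M (\<Pi>\<^sub>M ij\<in>mat_index n. (borel :: 'p padic measure))"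
    unfolding borel_mat_def mat_entries_def[abs_def]
    by (rule measurable_vimage_algebra1) (auto simp: space_PiM)
  then show ?thesis by (simp cong: measurable_cong_sets add: sets_haar_prod)
qed

lemma measurable_mat: "Matrix.mat n n \<in> (haar_prod (mat_index n) :: (_ \<Rightarrow> 'p::prime_card padic) measure) \<rightarrow>\<^sub>M borel_mat n"
  unfolding borel_mat_def
proof (rule measurable_vimage_algebra2)
  have "(\<lambda>x. mat_entries n (Matrix.mat n n x)) \<in> (haar_prod (mat_index n) :: (_ \<Rightarrow> 'p padic) measure) \<rightarrow>\<^sub>M haar_prod (mat_index n)"
    by (subst measurable_cong[where g = "\<lambda>x. x"]) (simp_all add: mat_entries_of_mat)
  then show "(\<lambda>x. \<lambda>ij\<in>mat_index n. Matrix.mat n n x $$ ij) \<in>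
      (haar_prod (mat_index n) :: (_ \<Rightarrow> 'p padic) measure) \<rightarrow>\<^sub>M (\<Pi>\<^sub>M ij\<in>mat_index n. borel)"
    unfolding mat_entries_def by (simp cong: measurable_cong_sets add: sets_haar_prod)
qed auto

lemma int_mats_eq: "int_mats n = mat_entries n -` int_funs (mat_index n) \<inter> carrier_mat n n"
proof (rule Set.set_eqI)
  fix z :: "'a padic mat"
  have "mat_entries n z \<in> int_funs (mat_index n) \<longleftrightarrow> (\<forall>i<n. \<forall>j<n. z $$ (i, j) \<in> padic_ints)"
    by (simp add: mat_entries_def PiE_iff Ball_def) blast
  then show "z \<in> int_mats n \<longleftrightarrow> z \<in> mat_entries n -` int_funs (mat_index n) \<inter> carrier_mat n n"
    by (simp only: int_mats_def mem_Collect_eq Int_iff vimage_eq conj_commute)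
qed

text \<open>\<open>normalized_haar\<close> speaks of images under translation while measurability
  concerns preimages; the inverse translation converts one into the other.\<close>

lemma image_add_carrier_mat:
  fixes A :: "'a::ab_group_add mat"
  assumes A: "A \<in> carrier_mat n n" and X: "X \<subseteq> carrier_mat n n"
  shows "(\<lambda>z. A + z) ` X = {z \<in> carrier_mat n n. - A + z \<in> X}"
proof
  show "{z \<in> carrier_mat n n. - A + z \<in> X} \<subseteq> (\<lambda>z. A + z) ` X"
  proof
    fix z assume z: "z \<in> {z \<in> carrier_mat n n. - A + z \<in> X}"
    then have "z = A + (- A + z)" using A by (auto intro!: eq_matI)
    with z show "z \<in> (\<lambda>z. A + z) ` X" by blast
  qed
  have "- A + (A + z) = z" if "z \<in> carrier_mat n n" for z
    using A that by (auto intro!: eq_matI)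
  then show "(\<lambda>z. A + z) ` X \<subseteq> {z \<in> carrier_mat n n. - A + z \<in> X}"
    using A X by (auto simp: subset_eq)
qed

text \<open>Existence half of the description that defines \<open>vol\<close>.\<close>

lemma normalized_haar_distr_mat:
  "normalized_haar n (distr (haar_prod (mat_index n)) (borel_mat n) (Matrix.mat n n) :: 'p::prime_card padic mat measure)"
  (is "normalized_haar n ?V")
  unfolding normalized_haar_def
proof (intro conjI ballI)
  let ?L = "haar_prod (mat_index n) :: (_ \<Rightarrow> 'p padic) measure"
  have fin: "finite (mat_index n)" by simp
  have int: "int_mats n \<in> sets (borel_mat n :: 'p padic mat measure)"
    using measurable_sets[OF measurable_mat_entries int_funs_sets[OF fin]] by (simp add: int_mats_eq)
  have "Matrix.mat n n -` int_mats n \<inter> space ?L = int_funs (mat_index n)"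
    by (auto simp: int_mats_eq mat_entries_of_mat PiE_def)
  then show "emeasure ?V (int_mats n) = 1"
    using emeasure_distr[OF measurable_mat int] by simp
  fix A :: "'p padic mat" and X :: "'p padic mat set"
  assume A: "A \<in> carrier_mat n n" and "X \<in> sets ?V"
  then have X: "X \<in> sets (borel_mat n)" by simp
  have Xc: "X \<subseteq> carrier_mat n n" using sets.sets_into_space[OF X] by simp
  let ?Y = "Matrix.mat n n -` X \<inter> space ?L"
  let ?Z = "vec_add (mat_index n) (mat_entries n (- A)) -` ?Y \<inter> space ?L"
  have Y: "?Y \<in> sets ?L" by (rule measurable_sets[OF measurable_mat X])
  have Z: "?Z \<in> sets ?L" by (rule measurable_sets[OF measurable_vec_add_const Y])
  have mA: "- A + z \<in> carrier_mat n n" if "z \<in> carrier_mat n n" for z using A that by auto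
  have img: "(\<lambda>z. A + z) ` X = mat_entries n -` ?Z \<inter> space (borel_mat n)"
    unfolding image_add_carrier_mat[OF A Xc]
    using mA by (auto simp: mat_entries_add[symmetric] mat_of_mat_entries)
  have img_sets: "(\<lambda>z. A + z) ` X \<in> sets (borel_mat n)"
    unfolding img by (rule measurable_sets[OF measurable_mat_entries Z])
  have "Matrix.mat n n -` ((\<lambda>z. A + z) ` X) \<inter> space ?L = ?Z"
    unfolding img by (auto simp: mat_entries_of_mat)
  then have "emeasure ?V ((\<lambda>z. A + z) ` X) = emeasure ?L ?Z"
    using emeasure_distr[OF measurable_mat img_sets] by simp
  also have "\<dots> = emeasure ?L ?Y"
    using Y by (intro trans_invariantD[OF trans_invariant_haar_prod[OF fin]]) auto
  also have "\<dots> = emeasure ?V X" using emeasure_distr[OF measurable_mat X] by simp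
  finally show "emeasure ?V ((\<lambda>z. A + z) ` X) = emeasure ?V X" .
qed simp

text \<open>Uniqueness half: \<open>M\<close> is carried to functions on index pairs, where it is
  invariant and gives mass 1 to the integral functions, hence equals the product measure; carrying
  it back recovers \<open>M\<close>.\<close>

lemma normalized_haar_unique:
  assumes M: "normalized_haar n (M :: 'p::prime_card padic mat measure)"
  shows "M = distr (haar_prod (mat_index n)) (borel_mat n) (Matrix.mat n n)"
proof -
  let ?L = "haar_prod (mat_index n) :: (_ \<Rightarrow> 'p padic) measure"
  have fin: "finite (mat_index n)" by simp
  have sM: "sets M = sets (borel_mat n)" using M by (simp add: normalized_haar_def)
  have spM: "space M = carrier_mat n n" using sets_eq_imp_space_eq[OF sM] by simp
  have me: "mat_entries n \<in> M \<rightarrow>\<^sub>M ?L"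
    using measurable_mat_entries by (simp cong: measurable_cong_sets add: sM)
  let ?N = "distr M ?L (mat_entries n)"
  have "trans_invariant (mat_index n) ?N"
    unfolding trans_invariant_def
  proof (intro conjI ballI)
    fix c :: "nat \<times> nat \<Rightarrow> 'p padic" and X :: "(nat \<times> nat \<Rightarrow> 'p padic) set"
    assume c: "c \<in> extensional (mat_index n)" and "X \<in> sets ?N"
    then have X: "X \<in> sets ?L" by simp
    let ?C = "Matrix.mat n n c"
    let ?Y = "vec_add (mat_index n) c -` X \<inter> space ?L"
    let ?Z = "mat_entries n -` ?Y \<inter> space M"
    have Y: "?Y \<in> sets ?L" by (rule measurable_sets[OF measurable_vec_add_const X])
    have Z: "?Z \<in> sets M" by (rule measurable_sets[OF me Y])
    have C: "?C \<in> carrier_mat n n" by simp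
    have "emeasure ?N (vec_add (mat_index n) c -` X \<inter> space ?N) = emeasure M ?Z"
      using emeasure_distr[OF me Y] by simp
    also have "\<dots> = emeasure M ((\<lambda>z. ?C + z) ` ?Z)"
      using M Z C by (simp add: normalized_haar_def)
    also have "(\<lambda>z. ?C + z) ` ?Z = mat_entries n -` X \<inter> space M"
    proof -
      have "mat_entries n (?C + z) = vec_add (mat_index n) c (mat_entries n z)" if "z \<in> carrier_mat n n" for z
        using mat_entries_add[OF that, of ?C] c by (simp add: mat_entries_of_mat)
      moreover have "?C + (- ?C + z) = z" "- ?C + z \<in> carrier_mat n n" if "z \<in> carrier_mat n n" for z
        using that by (auto intro!: eq_matI)
      ultimately have "vec_add (mat_index n) c (mat_entries n (- ?C + z)) = mat_entries n z" if "z \<in> carrier_mat n n" for z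
        using that by metis
      moreover have "- ?C + z \<in> carrier_mat n n" if "z \<in> carrier_mat n n" for z
        using that by auto
      moreover have "?Z \<subseteq> carrier_mat n n" by (simp add: spM)
      ultimately show ?thesis
        by (subst image_add_carrier_mat[OF C]) (auto simp: spM)
    qed
    also have "emeasure M \<dots> = emeasure ?N X" by (rule emeasure_distr[OF me X, symmetric])
    finally show "emeasure ?N (vec_add (mat_index n) c -` X \<inter> space ?N) = emeasure ?N X" .
  qed simp
  moreover have "emeasure ?N (int_funs (mat_index n)) = 1"
    using emeasure_distr[OF me int_funs_sets[OF fin]] M by (simp add: normalized_haar_def int_mats_eq spM)
  ultimately have N: "?N = ?L" using trans_invariant_unique[OF fin] by fastforce
  have mm: "Matrix.mat n n \<in> ?L \<rightarrow>\<^sub>M borel_mat n" by (rule measurable_mat)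
  have "distr ?N (borel_mat n) (Matrix.mat n n) = distr M (borel_mat n) (Matrix.mat n n \<circ> mat_entries n)"
    by (rule distr_distr[OF mm me])
  also have "\<dots> = distr M M (\<lambda>z. z)"
    by (rule distr_cong) (simp_all add: sM spM mat_of_mat_entries)
  also have "\<dots> = M" by simp
  finally show ?thesis by (simp only: N)
qed

lemma vol_eq: "vol n = distr (haar_prod (mat_index n)) (borel_mat n) (Matrix.mat n n)"
  unfolding vol_def
  by (rule the_equality) (use normalized_haar_distr_mat normalized_haar_unique in blast)+

section \<open>Smith normal form\<close>

lemma padic_norm_le_0 [simp]: "padic_norm (x :: 'p::prime_card padic) \<le> 0 \<longleftrightarrow> x = 0"
  using padic_norm_pos[of x] by linarith

section \<open>The group GL(n, O)\<close>

lemma int_mats_one [simp]: "1\<^sub>m n \<in> int_mats n"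
  by (simp add: int_mats_def)

lemma int_mats_mult:
  assumes "A \<in> int_mats n" "B \<in> int_mats n"
  shows "A * B \<in> int_mats n"
  using assms by (auto simp: int_mats_def scalar_prod_def intro!: padic_ints_sum padic_ints_mult)

lemma int_mats_transpose: "A \<in> int_mats n \<Longrightarrow> transpose_mat A \<in> int_mats n"
  by (auto simp: int_mats_def)

lemma GL_intI:
  "A \<in> int_mats n \<Longrightarrow> B \<in> int_mats n \<Longrightarrow> A * B = 1\<^sub>m n \<Longrightarrow> B * A = 1\<^sub>m n \<Longrightarrow> A \<in> GL_int n"
  by (auto simp: GL_int_def)

lemma GL_int_obtain_inverse:
  assumes "A \<in> GL_int n"
  obtains B where "B \<in> GL_int n" "A * B = 1\<^sub>m n" "B * A = 1\<^sub>m n"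
  using assms by (auto simp: GL_int_def)

lemma GL_int_one [simp]: "1\<^sub>m n \<in> GL_int n"
  by (rule GL_intI[of _ _ "1\<^sub>m n"]) simp_all

lemma GL_int_mult:
  assumes "A \<in> GL_int n" "B \<in> GL_int n"
  shows "A * B \<in> GL_int n"
proof -
  obtain A' where A': "A' \<in> GL_int n" "A * A' = 1\<^sub>m n" "A' * A = 1\<^sub>m n"
    using GL_int_obtain_inverse[OF assms(1)] .
  obtain B' where B': "B' \<in> GL_int n" "B * B' = 1\<^sub>m n" "B' * B = 1\<^sub>m n"
    using GL_int_obtain_inverse[OF assms(2)] .
  note c = GL_int_carrier[OF assms(1)] GL_int_carrier[OF assms(2)] GL_int_carrier[OF A'(1)] GL_int_carrier[OF B'(1)]
  have "(A * B) * (B' * A') = A * (B * B') * A'"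
    using c by (simp add: assoc_mult_mat[of _ n n _ n _ n])
  then have 1: "(A * B) * (B' * A') = 1\<^sub>m n" using c A' B' by simp
  have "(B' * A') * (A * B) = B' * (A' * A) * B"
    using c by (simp add: assoc_mult_mat[of _ n n _ n _ n])
  then have 2: "(B' * A') * (A * B) = 1\<^sub>m n" using c A' B' by simp
  show ?thesis
    by (rule GL_intI[OF _ _ 1 2]) (use assms A' B' in \<open>auto simp: GL_int_def intro: int_mats_mult\<close>)
qed

lemma GL_int_transpose:
  assumes "A \<in> GL_int n"
  shows "transpose_mat A \<in> GL_int n"
proof -
  obtain B where B: "B \<in> GL_int n" "A * B = 1\<^sub>m n" "B * A = 1\<^sub>m n"
    using GL_int_obtain_inverse[OF assms] .
  note c = GL_int_carrier[OF assms] GL_int_carrier[OF B(1)]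
  have "transpose_mat A * transpose_mat B = 1\<^sub>m n" "transpose_mat B * transpose_mat A = 1\<^sub>m n"
    by (simp_all only: transpose_mult[OF c(2) c(1), symmetric] transpose_mult[OF c, symmetric] B transpose_one)
  then show ?thesis
    using assms B by (intro GL_intI[of _ _ "transpose_mat B"]) (auto simp: GL_int_def intro: int_mats_transpose)
qed

lemma GL_int_diag:
  assumes "\<And>i. i < n \<Longrightarrow> padic_norm (u i) = 1"
  shows "mat_diag n u \<in> GL_int n"
proof (rule GL_intI)
  show "mat_diag n u \<in> int_mats n" "mat_diag n (\<lambda>i. inverse (u i)) \<in> int_mats n"
    using assms by (auto simp: int_mats_def mat_diag_def padic_ints_iff padic_norm_inverse)
  have "u i \<noteq> 0" if "i < n" for i using assms[OF that] by auto
  then show "mat_diag n u * mat_diag n (\<lambda>i. inverse (u i)) = 1\<^sub>m n"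
    "mat_diag n (\<lambda>i. inverse (u i)) * mat_diag n u = 1\<^sub>m n"
    by (auto simp: mat_diag_mult_left) (auto simp: mat_diag_def intro!: eq_matI)
qed

section \<open>Equivalence under GL(n, O) and elementary operations\<close>

definition int_equiv :: "nat \<Rightarrow> 'p::prime_card padic mat \<Rightarrow> 'p padic mat \<Rightarrow> bool" where
  "int_equiv n z w \<longleftrightarrow> z \<in> carrier_mat n n \<and> w \<in> carrier_mat n n \<and>
    (\<exists>A\<in>GL_int n. \<exists>B\<in>GL_int n. z = A * w * B)"

lemma int_equiv_refl: "z \<in> carrier_mat n n \<Longrightarrow> int_equiv n z z"
  unfolding int_equiv_def by (intro conjI bexI[of _ "1\<^sub>m n"]) auto

lemma int_equiv_trans:
  assumes "int_equiv n x y" "int_equiv n y z"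
  shows "int_equiv n x z"
proof -
  obtain A B where 1: "A \<in> GL_int n" "B \<in> GL_int n" "x = A * y * B"
    using assms(1) by (auto simp: int_equiv_def)
  obtain C D where 2: "C \<in> GL_int n" "D \<in> GL_int n" "y = C * z * D"
    using assms(2) by (auto simp: int_equiv_def)
  have z: "z \<in> carrier_mat n n" "x \<in> carrier_mat n n" using assms by (auto simp: int_equiv_def)
  have "x = (A * C) * z * (D * B)"
    unfolding 1(3) 2(3)
    using z 1(1,2)[THEN GL_int_carrier] 2(1,2)[THEN GL_int_carrier]
    by (simp add: assoc_mult_mat[of _ n n _ n _ n])
  then show ?thesis
    unfolding int_equiv_def using z GL_int_mult[OF 1(1) 2(1)] GL_int_mult[OF 2(2) 1(2)] by blast
qed

lemma int_equiv_transpose: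
  assumes "int_equiv n z w"
  shows "int_equiv n (transpose_mat z) (transpose_mat w)"
proof -
  obtain A B where 1: "A \<in> GL_int n" "B \<in> GL_int n" "z = A * w * B"
    using assms by (auto simp: int_equiv_def)
  have c: "w \<in> carrier_mat n n" "z \<in> carrier_mat n n" using assms by (auto simp: int_equiv_def)
  note c' = 1(1,2)[THEN GL_int_carrier]
  have "transpose_mat z = transpose_mat B * transpose_mat (A * w)"
    unfolding 1(3) using c c' by (intro transpose_mult) auto
  also have "transpose_mat (A * w) = transpose_mat w * transpose_mat A"
    using c c' by (intro transpose_mult) auto
  also have "transpose_mat B * (transpose_mat w * transpose_mat A) = transpose_mat B * transpose_mat w * transpose_mat A"
    using c c' by (intro assoc_mult_mat[symmetric]) auto
  finally have "transpose_mat z = transpose_mat B * transpose_mat w * transpose_mat A" .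
  moreover have "transpose_mat z \<in> carrier_mat n n" "transpose_mat w \<in> carrier_mat n n" using c by auto
  ultimately show ?thesis
    unfolding int_equiv_def using 1(1,2)[THEN GL_int_transpose] by blast
qed

lemma int_equiv_mult_left:
  assumes "A \<in> GL_int n" "z \<in> carrier_mat n n"
  shows "int_equiv n z (A * z)"
proof -
  obtain B where B: "B \<in> GL_int n" "B * A = 1\<^sub>m n"
    using GL_int_obtain_inverse[OF assms(1)] .
  note c = GL_int_carrier[OF assms(1)] GL_int_carrier[OF B(1)]
  have "B * (A * z) * 1\<^sub>m n = B * A * z"
    using c assms(2) by (simp add: assoc_mult_mat[of _ n n _ n _ n])
  also have "\<dots> = z" using B assms(2) by simp
  finally show ?thesis unfolding int_equiv_def using c assms(2) B(1)
    by (intro conjI bexI[of _ B] bexI[of _ "1\<^sub>m n"]) auto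
qed

text \<open>A whole elimination in one matrix: it adds \<open>c i\<close> times row \<open>k\<close>
  to row \<open>i\<close> for all \<open>i\<close> at once. If \<open>c k = 0\<close>, negating
  \<open>c\<close> gives the inverse.\<close>

definition row_elim_mat :: "nat \<Rightarrow> nat \<Rightarrow> (nat \<Rightarrow> 'a::comm_ring_1) \<Rightarrow> 'a mat" where
  "row_elim_mat n k c = Matrix.mat n n (\<lambda>(i, j). (if i = j then 1 else 0) + (if j = k then c i else 0))"

lemma row_elim_mat_mult:
  assumes "k < n" "z \<in> carrier_mat n n"
  shows "row_elim_mat n k c * z = Matrix.mat n n (\<lambda>(i, j). z $$ (i, j) + c i * z $$ (k, j))"
proof (rule eq_matI)
  fix i j assume ij: "i < dim_row (Matrix.mat n n (\<lambda>(i, j). z $$ (i, j) + c i * z $$ (k, j)))"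
    "j < dim_col (Matrix.mat n n (\<lambda>(i, j). z $$ (i, j) + c i * z $$ (k, j)))"
  then have "(row_elim_mat n k c * z) $$ (i, j)
      = (\<Sum>l<n. ((if i = l then 1 else 0) + (if l = k then c i else 0)) * z $$ (l, j))"
    using assms by (simp add: row_elim_mat_def scalar_prod_def atLeast0LessThan)
  also have "\<dots> = (\<Sum>l<n. (if i = l then z $$ (l, j) else 0) + (if l = k then c i * z $$ (l, j) else 0))"
    by (intro sum.cong) (auto simp: distrib_right)
  also have "\<dots> = z $$ (i, j) + c i * z $$ (k, j)"
    using assms ij by (simp add: sum.distrib)
  finally show "(row_elim_mat n k c * z) $$ (i, j) = Matrix.mat n n (\<lambda>(i, j). z $$ (i, j) + c i * z $$ (k, j)) $$ (i, j)"
    using ij by simp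
qed (use assms in \<open>auto simp: row_elim_mat_def\<close>)

lemma row_elim_mat_inverse:
  assumes "k < n" "c k = 0"
  shows "row_elim_mat n k c * row_elim_mat n k (\<lambda>i. - c i) = 1\<^sub>m n"
  using assms by (subst row_elim_mat_mult) (auto simp: row_elim_mat_def intro!: eq_matI)

lemma row_elim_mat_GL_int:
  assumes "k < n" "c k = 0" "\<And>i. i < n \<Longrightarrow> c i \<in> padic_ints"
  shows "row_elim_mat n k c \<in> GL_int n"
proof (rule GL_intI)
  show "row_elim_mat n k c \<in> int_mats n" "row_elim_mat n k (\<lambda>i. - c i) \<in> int_mats n"
    using assms by (auto simp: int_mats_def row_elim_mat_def)
  show "row_elim_mat n k c * row_elim_mat n k (\<lambda>i. - c i) = 1\<^sub>m n"
    by (rule row_elim_mat_inverse) (use assms in auto)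
  show "row_elim_mat n k (\<lambda>i. - c i) * row_elim_mat n k c = 1\<^sub>m n"
    using row_elim_mat_inverse[of k n "\<lambda>i. - c i"] assms by simp
qed

lemma int_equiv_row_elim:
  assumes "k < n" "c k = 0" "\<And>i. i < n \<Longrightarrow> c i \<in> padic_ints" "z \<in> carrier_mat n n"
  shows "int_equiv n z (Matrix.mat n n (\<lambda>(i, j). z $$ (i, j) + c i * z $$ (k, j)))"
  using int_equiv_mult_left[OF row_elim_mat_GL_int[of k n c, OF assms(1-3)] assms(4)]
  by (simp add: row_elim_mat_mult assms)

lemma int_equiv_col_elim:
  assumes "k < n" "c k = 0" "\<And>i. i < n \<Longrightarrow> c i \<in> padic_ints" "z \<in> carrier_mat n n"
  shows "int_equiv n z (Matrix.mat n n (\<lambda>(i, j). z $$ (i, j) + c j * z $$ (i, k)))"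
proof -
  have "int_equiv n (transpose_mat z)
      (Matrix.mat n n (\<lambda>(i, j). transpose_mat z $$ (i, j) + c i * transpose_mat z $$ (k, j)))"
    by (rule int_equiv_row_elim) (use assms in auto)
  from int_equiv_transpose[OF this]
  have "int_equiv n z (transpose_mat
      (Matrix.mat n n (\<lambda>(i, j). transpose_mat z $$ (i, j) + c i * transpose_mat z $$ (k, j))))"
    by simp
  also have "transpose_mat (Matrix.mat n n (\<lambda>(i, j). transpose_mat z $$ (i, j) + c i * transpose_mat z $$ (k, j)))
      = Matrix.mat n n (\<lambda>(i, j). z $$ (i, j) + c j * z $$ (i, k))"
    using assms by (auto intro!: eq_matI)
  finally show ?thesis .
qed

lemma swaprows_mat_GL_int:
  assumes "k < n" "l < n"
  shows "swaprows_mat n k l \<in> GL_int n"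
proof (rule GL_intI)
  show "swaprows_mat n k l \<in> int_mats n" "swaprows_mat n k l \<in> int_mats n"
    by (auto simp: int_mats_def swaprows_mat_def)
qed (use swaprows_mat_inv[OF assms] in auto)

lemma int_equiv_swap_rows:
  assumes "k < n" "l < n" "z \<in> carrier_mat n n"
  shows "int_equiv n z (Matrix.mat n n (\<lambda>(i, j). z $$ (Transposition.transpose k l i, j)))"
proof -
  have "int_equiv n z (swaprows k l z)"
    using int_equiv_mult_left[OF swaprows_mat_GL_int[OF assms(1,2)] assms(3)] swaprows_mat[OF assms(3,1,2)] by simp
  also have "swaprows k l z = Matrix.mat n n (\<lambda>(i, j). z $$ (Transposition.transpose k l i, j))"
    using assms by (auto intro!: eq_matI simp: Transposition.transpose_def)
  finally show ?thesis .
qed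


lemma int_equiv_swap_cols:
  assumes "k < n" "l < n" "z \<in> carrier_mat n n"
  shows "int_equiv n z (Matrix.mat n n (\<lambda>(i, j). z $$ (i, Transposition.transpose k l j)))"
proof -
  have lt: "Transposition.transpose k l j < n" if "j < n" for j
    using assms that by (simp add: Transposition.transpose_def)
  have "int_equiv n (transpose_mat z)
      (Matrix.mat n n (\<lambda>(i, j). transpose_mat z $$ (Transposition.transpose k l i, j)))"
    by (rule int_equiv_swap_rows) (use assms in auto)
  from int_equiv_transpose[OF this]
  have "int_equiv n z (transpose_mat
      (Matrix.mat n n (\<lambda>(i, j). transpose_mat z $$ (Transposition.transpose k l i, j))))"
    by simp
  also have "transpose_mat (Matrix.mat n n (\<lambda>(i, j). transpose_mat z $$ (Transposition.transpose k l i, j)))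
      = Matrix.mat n n (\<lambda>(i, j). z $$ (i, Transposition.transpose k l j))"
    by (rule eq_matI) (simp_all add: carrier_matD[OF assms(3)] lt)
  finally show ?thesis .
qed

text \<open>The pivot at \<open>(k, k)\<close> has maximal norm in the remaining block, so the
  quotients used to clear its column and then its row are integral and the operations stay in GL(n,
  O). The ultrametric inequality keeps the bound on the block.\<close>

lemma int_equiv_clear_cross:
  fixes w :: "'p::prime_card padic mat"
  assumes k: "k < n" and w: "w \<in> carrier_mat n n"
    and zero: "\<And>i j. i < n \<Longrightarrow> j < n \<Longrightarrow> i \<noteq> j \<Longrightarrow> i < k \<or> j < k \<Longrightarrow> w $$ (i, j) = 0"
    and max: "\<And>i j. i < n \<Longrightarrow> j < n \<Longrightarrow> k \<le> i \<Longrightarrow> k \<le> j \<Longrightarrow> padic_norm (w $$ (i, j)) \<le> padic_norm (w $$ (k, k))"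
  shows "\<exists>v. int_equiv n w v
    \<and> (\<forall>i<n. \<forall>j<n. i \<noteq> j \<longrightarrow> i < Suc k \<or> j < Suc k \<longrightarrow> v $$ (i, j) = 0)
    \<and> (\<forall>i<Suc k. v $$ (i, i) = w $$ (i, i))
    \<and> (\<forall>i<n. \<forall>j<n. k \<le> i \<longrightarrow> k \<le> j \<longrightarrow> padic_norm (v $$ (i, j)) \<le> padic_norm (w $$ (k, k)))"
proof -
  \<comment> \<open>If the pivot is 0, the convention x / 0 = 0 makes the multipliers vanish; this
    is correct because maximality of the pivot makes the entries to be cleared 0 already.\<close>
  define c where "c i = (if k < i then - (w $$ (i, k) / w $$ (k, k)) else 0)" for i
  define u where "u = Matrix.mat n n (\<lambda>(i, j). w $$ (i, j) + c i * w $$ (k, j))"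
  define d where "d j = (if k < j then - (u $$ (k, j) / u $$ (k, k)) else 0)" for j
  define v where "v = Matrix.mat n n (\<lambda>(i, j). u $$ (i, j) + d j * u $$ (i, k))"
  have cint: "c i \<in> padic_ints" if "i < n" for i
    using max[of i k] that k by (auto simp: c_def padic_ints_iff padic_norm_divide divide_le_eq_1)
  have u: "u $$ (i, j) = w $$ (i, j) + c i * w $$ (k, j)" if "i < n" "j < n" for i j
    using that by (simp add: u_def)
  have urow: "u $$ (i, j) = w $$ (i, j)" if "i \<le> k" "j < n" for i j
    using that k by (simp add: u c_def)
  have ucol0: "u $$ (i, k) = 0" if "k < i" "i < n" for i
    using that k max[of i k] by (cases "w $$ (k, k) = 0") (auto simp: u c_def)
  have ucol: "u $$ (i, j) = w $$ (i, j)" if "j < k" "i < n" for i j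
    using that k zero[of k j] by (simp add: u)
  have umax: "padic_norm (u $$ (i, j)) \<le> padic_norm (w $$ (k, k))" if "i < n" "j < n" "k \<le> i" "k \<le> j" for i j
  proof -
    have "padic_norm (c i * w $$ (k, j)) \<le> 1 * padic_norm (w $$ (k, k))"
      unfolding padic_norm_mult using cint[of i] max[of k j] that k
      by (intro mult_mono) (auto simp: padic_ints_iff)
    then show ?thesis
      using that max[of i j] by (simp add: u padic_norm_add_le)
  qed
  have dint: "d j \<in> padic_ints" if "j < n" for j
    using umax[of k j] that k by (auto simp: d_def urow padic_ints_iff padic_norm_divide divide_le_eq_1)
  have v: "v $$ (i, j) = u $$ (i, j) + d j * u $$ (i, k)" if "i < n" "j < n" for i j
    using that by (simp add: v_def)
  have "int_equiv n w u"
    unfolding u_def by (rule int_equiv_row_elim[OF k _ cint w]) (simp add: c_def)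
  moreover have "int_equiv n u v"
    unfolding v_def by (rule int_equiv_col_elim[OF k _ dint]) (simp_all add: d_def u_def)
  ultimately have "int_equiv n w v" by (rule int_equiv_trans)
  moreover have "v $$ (i, j) = 0" if ij: "i < n" "j < n" "i \<noteq> j" "i < Suc k \<or> j < Suc k" for i j
  proof -
    consider "i < k" | "i = k" "j < k" | "i = k" "k < j" | "k < i" "j < k" | "k < i" "j = k" using ij by linarith
    then show ?thesis
    proof cases
      case 1
      then have "u $$ (i, j) = 0" "u $$ (i, k) = 0"
        using ij k zero[of i j] zero[of i k] by (auto simp: urow)
      then show ?thesis using ij by (simp add: v)
    next
      case 2
      then show ?thesis using ij k zero[of i j] by (simp add: v d_def urow)
    next
      case 3
      then show ?thesis using ij k max[of k j] by (cases "w $$ (k, k) = 0") (auto simp: v d_def urow)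
    next
      case 4
      then show ?thesis using ij k zero[of i j] by (simp add: v d_def ucol)
    next
      case 5
      then show ?thesis using ij k by (simp add: v d_def ucol0)
    qed
  qed
  moreover have "v $$ (i, i) = w $$ (i, i)" if "i < Suc k" for i
    using that k by (simp add: v urow d_def)
  moreover have "padic_norm (v $$ (i, j)) \<le> padic_norm (w $$ (k, k))" if "i < n" "j < n" "k \<le> i" "k \<le> j" for i j
  proof -
    have "padic_norm (d j * u $$ (i, k)) \<le> 1 * padic_norm (w $$ (k, k))"
      unfolding padic_norm_mult using dint[of j] umax[of i k] that k
      by (intro mult_mono) (auto simp: padic_ints_iff)
    then show ?thesis
      using that umax[of i j] by (simp add: v padic_norm_add_le)
  qed
  ultimately show ?thesis by blast
qed

text \<open>Induction on the number of finished pivots. The last conjunct, that each pivot dominates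
  everything below and to the right of it, is what later puts the exponents in decreasing
  order.\<close>

lemma int_equiv_diagonal_upto:
  fixes z :: "'p::prime_card padic mat"
  assumes z: "z \<in> carrier_mat n n" and "k \<le> n"
  shows "\<exists>w. int_equiv n z w
    \<and> (\<forall>i<n. \<forall>j<n. i \<noteq> j \<longrightarrow> i < k \<or> j < k \<longrightarrow> w $$ (i, j) = 0)
    \<and> (\<forall>i<k. \<forall>a<n. \<forall>b<n. i \<le> a \<longrightarrow> i \<le> b \<longrightarrow> padic_norm (w $$ (a, b)) \<le> padic_norm (w $$ (i, i)))"
  using \<open>k \<le> n\<close>
proof (induction k)
  case 0
  show ?case using int_equiv_refl[OF z] by auto
next
  case (Suc k)
  then obtain w where zw: "int_equiv n z w"
    and zero': "\<forall>i<n. \<forall>j<n. i \<noteq> j \<longrightarrow> i < k \<or> j < k \<longrightarrow> w $$ (i, j) = 0"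
    and max': "\<forall>i<k. \<forall>a<n. \<forall>b<n. i \<le> a \<longrightarrow> i \<le> b \<longrightarrow> padic_norm (w $$ (a, b)) \<le> padic_norm (w $$ (i, i))"
    using Suc_leD by blast
  have zero: "w $$ (i, j) = 0" if "i < n" "j < n" "i \<noteq> j" "i < k \<or> j < k" for i j
    using zero' that by blast
  have max: "padic_norm (w $$ (a, b)) \<le> padic_norm (w $$ (i, i))"
    if "i < k" "a < n" "b < n" "i \<le> a" "i \<le> b" for i a b
    using max' that by blast
  have kn: "k < n" using Suc.prems by simp
  have w: "w \<in> carrier_mat n n" using zw by (simp add: int_equiv_def)
  let ?N = "\<lambda>(a, b). padic_norm (w $$ (a, b))"
  let ?S = "{k..<n} \<times> {k..<n}"
  have "finite ?S" "?S \<noteq> {}" using Suc.prems by auto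
  then have "Max (?N ` ?S) \<in> ?N ` ?S" by (intro Max_in) simp_all
  then obtain ab where ab: "ab \<in> ?S" "Max (?N ` ?S) = ?N ab" by (elim imageE)
  obtain a b where "ab = (a, b)" by fastforce
  with ab have a: "k \<le> a" "a < n" and b: "k \<le> b" "b < n"
    and M: "Max (?N ` ?S) = padic_norm (w $$ (a, b))" by auto
  have abmax: "padic_norm (w $$ (i, j)) \<le> padic_norm (w $$ (a, b))" if "k \<le> i" "i < n" "k \<le> j" "j < n" for i j
    unfolding M[symmetric] by (rule Max_ge) (use that in \<open>auto intro!: image_eqI[where x = "(i, j)"]\<close>)
  \<comment> \<open>An entry of maximal norm in the remaining block, at position
    \<open>(a, b)\<close>, is moved to \<open>(k, k)\<close>. Both transpositions fix indices below
    \<open>k\<close> and so leave the finished part alone.\<close>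
  let ?s = "Transposition.transpose k a" and ?t = "Transposition.transpose k b"
  define x where "x = Matrix.mat n n (\<lambda>(i, j). w $$ (?s i, j))"
  define y where "y = Matrix.mat n n (\<lambda>(i, j). x $$ (i, ?t j))"
  have st: "?s i < n" "?t i < n" if "i < n" for i
    using that a b by (auto simp: Transposition.transpose_def)
  have y: "y $$ (i, j) = w $$ (?s i, ?t j)" if "i < n" "j < n" for i j
    using that st by (simp add: x_def y_def)
  have sti: "?s i = i" "?t i = i" if "i < k" for i
    using that a b by (auto simp: Transposition.transpose_def)
  have stge: "?s i \<ge> l" "?t i \<ge> l" if "i \<ge> l" "l \<le> k" for i l
    using that a b by (auto simp: Transposition.transpose_def)
  have "int_equiv n w x" unfolding x_def by (rule int_equiv_swap_rows[OF kn a(2) w])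
  moreover have "int_equiv n x y"
    unfolding y_def by (rule int_equiv_swap_cols[OF kn b(2)]) (simp add: x_def)
  ultimately have zy: "int_equiv n z y" using zw int_equiv_trans by blast
  have yc: "y \<in> carrier_mat n n" by (simp add: y_def)
  have ykk: "y $$ (k, k) = w $$ (a, b)" using Suc.prems by (simp add: y)
  have y0: "y $$ (i, j) = 0" if "i < n" "j < n" "i \<noteq> j" "i < k \<or> j < k" for i j
  proof (cases "i < k")
    case True
    have "?t j \<noteq> i" using True that b by (auto simp: Transposition.transpose_def)
    then show ?thesis using zero[of i "?t j"] True that st by (auto simp: y sti)
  next
    case False
    then have "j < k" "?s i \<noteq> j" using that a by (auto simp: Transposition.transpose_def)
    then show ?thesis using zero[of "?s i" j] that st by (auto simp: y sti)
  qed
  have ymax: "padic_norm (y $$ (i, j)) \<le> padic_norm (y $$ (k, k))" if "i < n" "j < n" "k \<le> i" "k \<le> j" for i j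
    using abmax[of "?s i" "?t j"] that st stge[of k] by (simp add: y ykk)
  obtain v where yv: "int_equiv n y v"
    and v0: "\<forall>i<n. \<forall>j<n. i \<noteq> j \<longrightarrow> i < Suc k \<or> j < Suc k \<longrightarrow> v $$ (i, j) = 0"
    and vd': "\<forall>i<Suc k. v $$ (i, i) = y $$ (i, i)"
    and vmax: "\<forall>i<n. \<forall>j<n. k \<le> i \<longrightarrow> k \<le> j \<longrightarrow> padic_norm (v $$ (i, j)) \<le> padic_norm (y $$ (k, k))"
    using int_equiv_clear_cross[OF kn yc y0 ymax] by blast
  have vd: "v $$ (i, i) = y $$ (i, i)" if "i < Suc k" for i using vd' that by blast
  have ydiag: "y $$ (i, i) = w $$ (i, i)" if "i < k" for i
    using that Suc.prems by (simp add: y sti)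
  have "padic_norm (v $$ (e, f)) \<le> padic_norm (v $$ (i, i))"
    if i: "i < Suc k" and ef: "e < n" "f < n" "i \<le> e" "i \<le> f" for i e f
  proof (cases "k \<le> e \<and> k \<le> f")
    case True
    then have "padic_norm (v $$ (e, f)) \<le> padic_norm (w $$ (a, b))" using vmax ef ykk by simp
    \<comment> \<open>The new pivot comes from inside the old block, hence is dominated by every
      earlier pivot.\<close>
    also have "\<dots> \<le> padic_norm (v $$ (i, i))"
      using i max[of i a b] a b ykk by (cases "i = k") (auto simp: vd ydiag)
    finally show ?thesis .
  next
    case False
    show ?thesis
    proof (cases "e = f")
      case True
      then show ?thesis using False ef i max[of i e f] by (simp add: vd ydiag)
    next
      case ne: False
      have "e < Suc k \<or> f < Suc k" using False by auto
      then have "v $$ (e, f) = 0" using v0 ef ne by blast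
      then show ?thesis by simp
    qed
  qed
  then show ?case using int_equiv_trans[OF zy yv] v0 by blast
qed

section \<open>Existence of the Smith form with entries that are powers of p\<close>

lemma padic_norm_sing_entry:
  "padic_norm (sing_entry k :: 'p::prime_card padic) = (case k of None \<Rightarrow> 0 | Some k \<Rightarrow> real CARD('p) powi k)"
proof (cases k)
  case (Some l)
  have "padic_norm (of_nat CARD('p) powi (- l) :: 'p padic) = real CARD('p) powi l"
    unfolding padic_norm_powi padic_norm_card by (simp add: power_int_minus power_int_inverse)
  with Some show ?thesis by (simp add: sing_entry_def)
qed (simp add: sing_entry_def)

text \<open>The entry p^(-k) has norm p^k and the zero entry belongs to the least exponent
  \<open>None\<close>, so the sign in \<open>sing_entry\<close> makes the two orders agree.\<close>

lemma padic_norm_sing_entry_le_iff: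
  "padic_norm (sing_entry k :: 'p::prime_card padic) \<le> padic_norm (sing_entry l :: 'p padic) \<longleftrightarrow> k \<le> l"
proof -
  have "real CARD('p) powi a > 0" for a using prime_card_gt_1[where 'p='p] by simp
  then show ?thesis
    by (cases k; cases l) (simp_all add: padic_norm_sing_entry powi_card_le_iff not_le)
qed

text \<open>In the diagonalised matrix every nonzero diagonal entry is a unit times the power of p
  of the same norm; the diagonal matrix of units is absorbed into \<open>A\<close>.\<close>

theorem smith_normal_form_exists:
  fixes z :: "'p::prime_card padic mat"
  assumes "z \<in> carrier_mat n n"
  shows "\<exists>ks. length ks = n \<and> sorted_wrt (\<ge>) ks \<and>
    (\<exists>A\<in>GL_int n. \<exists>B\<in>GL_int n. z = A * mat_diag n (\<lambda>j. sing_entry (ks ! j)) * B)"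
proof -
  obtain w where zw: "int_equiv n z w"
    and w0: "\<And>i j. i < n \<Longrightarrow> j < n \<Longrightarrow> i \<noteq> j \<Longrightarrow> w $$ (i, j) = 0"
    and wmax: "\<And>i a b. a < n \<Longrightarrow> b < n \<Longrightarrow> i \<le> a \<Longrightarrow> i \<le> b \<Longrightarrow> padic_norm (w $$ (a, b)) \<le> padic_norm (w $$ (i, i))"
    using int_equiv_diagonal_upto[OF assms order_refl]
    by (metis (no_types, lifting) le_less_trans)
  obtain A B where AB: "A \<in> GL_int n" "B \<in> GL_int n" "z = A * w * B" and wc: "w \<in> carrier_mat n n"
    using zw by (auto simp: int_equiv_def)
  have "\<exists>k. padic_norm x = padic_norm (sing_entry k :: 'p padic)" for x :: "'p padic"
  proof (cases "x = 0")
    case True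
    then show ?thesis by (intro exI[of _ None]) (simp add: padic_norm_sing_entry)
  next
    case False
    then obtain k where "padic_norm x = real CARD('p) powi k" using padic_norm_values by blast
    then show ?thesis by (intro exI[of _ "Some k"]) (simp add: padic_norm_sing_entry)
  qed
  then have "\<forall>i. \<exists>k. padic_norm (w $$ (i, i)) = padic_norm (sing_entry k :: 'p padic)" by blast
  from choice[OF this] obtain \<kappa>
    where \<kappa>: "\<And>i. padic_norm (w $$ (i, i)) = padic_norm (sing_entry (\<kappa> i) :: 'p padic)"
    by blast
  define ks where "ks = map \<kappa> [0..<n]"
  \<comment> \<open>The value 1 at zero entries keeps the diagonal matrix of the \<open>u i\<close>
    invertible over O.\<close>
  define u where "u i = (if w $$ (i, i) = 0 then 1 else w $$ (i, i) / sing_entry (\<kappa> i))" for i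
  have s0: "sing_entry (\<kappa> i) = (0 :: 'p padic) \<longleftrightarrow> w $$ (i, i) = 0" for i
    using \<kappa>[of i] by (metis padic_norm_eq_0)
  have u: "padic_norm (u i) = 1" for i
    using \<kappa>[of i] s0[of i] by (auto simp: u_def padic_norm_divide)
  have us: "w $$ (i, i) = u i * sing_entry (\<kappa> i)" for i
    using s0[of i] by (auto simp: u_def)
  have U: "mat_diag n u \<in> GL_int n" by (rule GL_int_diag) (rule u)
  let ?D = "mat_diag n (\<lambda>j. sing_entry (ks ! j)) :: 'p padic mat"
  have "w = mat_diag n u * ?D"
    using wc w0 us by (subst mat_diag_mult_left[of _ n n]) (auto simp: ks_def mat_diag_def intro!: eq_matI)
  then have "z = A * mat_diag n u * ?D * B"
    using AB(3) GL_int_carrier[OF AB(1)] by (simp add: assoc_mult_mat[of _ n n _ n _ n])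
  moreover have "A * mat_diag n u \<in> GL_int n" by (rule GL_int_mult[OF AB(1) U])
  moreover have "length ks = n" by (simp add: ks_def)
  moreover have "sorted_wrt (\<ge>) ks"
    unfolding sorted_wrt_iff_nth_less
  proof (intro allI impI)
    fix i j assume "i < j" "j < length ks"
    then have ij: "i < n" "j < n" "i \<le> j" by (simp_all add: ks_def)
    have "\<kappa> j \<le> \<kappa> i"
      unfolding padic_norm_sing_entry_le_iff[symmetric, where 'p='p] \<kappa>[symmetric]
      by (rule wmax) (use ij in simp_all)
    with ij show "ks ! j \<le> ks ! i" by (simp add: ks_def)
  qed
  ultimately show ?thesis using AB(2) by blast
qed

section \<open>The volume of the integral lattice of a matrix\<close>

definition int_vol :: "'p::prime_card padic mat \<Rightarrow> real" where
  "int_vol z = measure (haar_prod {..<dim_col z})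
     {x \<in> int_funs {..<dim_col z}. mat_act z x \<in> int_funs {..<dim_row z}}"

lemma int_vol_set_measurable:
  assumes "z \<in> carrier_mat n m"
  shows "{x \<in> int_funs {..<m}. mat_act z x \<in> int_funs {..<n}} \<in> sets (haar_prod {..<m})"
proof -
  have "{x \<in> int_funs {..<m}. mat_act z x \<in> int_funs {..<n}}
      = int_funs {..<m} \<inter> (mat_act z -` int_funs {..<n} \<inter> space (haar_prod {..<m}))"
    by (simp add: PiE_def) blast
  then show ?thesis
    by (simp only:) (intro sets.Int measurable_sets[OF measurable_mat_act[OF assms]] int_funs_sets finite_lessThan)
qed

lemma emeasure_subset_int_funs_le_1:
  "finite I \<Longrightarrow> X \<subseteq> int_funs I \<Longrightarrow> emeasure (haar_prod I) X \<le> 1"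
  using emeasure_mono[of X "int_funs I" "haar_prod I"] int_funs_sets[of I] by simp

lemma int_vol_le_1:
  "int_vol z \<le> 1"
proof -
  have "emeasure (haar_prod {..<dim_col z})
     {x \<in> int_funs {..<dim_col z}. mat_act z x \<in> int_funs {..<dim_row z}} \<le> 1"
    by (rule emeasure_subset_int_funs_le_1) auto
  then show ?thesis unfolding int_vol_def measure_def by (simp add: enn2real_leI)
qed

lemma emeasure_int_vol:
  assumes "z \<in> carrier_mat n m"
  shows "emeasure (haar_prod {..<m}) {x \<in> int_funs {..<m}. mat_act z x \<in> int_funs {..<n}} = ennreal (int_vol z)"
proof -
  have "emeasure (haar_prod {..<m}) {x \<in> int_funs {..<m}. mat_act z x \<in> int_funs {..<n}} \<le> 1"
    by (rule emeasure_subset_int_funs_le_1) auto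
  then have "emeasure (haar_prod {..<m}) {x \<in> int_funs {..<m}. mat_act z x \<in> int_funs {..<n}} < \<infinity>"
    by (rule le_less_trans) simp
  then show ?thesis using assms unfolding int_vol_def by (simp add: emeasure_eq_ennreal_measure)
qed

lemma int_vol_nonneg [simp]: "0 \<le> int_vol z"
  by (simp add: int_vol_def)

lemma int_vol_eqI:
  assumes "z \<in> carrier_mat n m" "0 \<le> r"
    "emeasure (haar_prod {..<m}) {x \<in> int_funs {..<m}. mat_act z x \<in> int_funs {..<n}} = ennreal r"
  shows "int_vol z = r"
  using assms emeasure_int_vol[OF assms(1)] by simp

text \<open>On the left, \<open>A\<close> does not change integrality of the result. On the right,
  \<open>B\<close> is a change of variables that preserves both Haar measure and O^n.\<close>

lemma int_vol_GL_int:
  fixes z :: "'p::prime_card padic mat"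
  assumes z: "z \<in> carrier_mat n n" and A: "A \<in> GL_int n" and B: "B \<in> GL_int n"
  shows "int_vol (A * z * B) = int_vol z"
proof (rule int_vol_eqI)
  let ?L = "haar_prod {..<n} :: (nat \<Rightarrow> 'p padic) measure"
  let ?S = "{x \<in> int_funs {..<n}. mat_act z x \<in> int_funs {..<n}}"
  note c = z GL_int_carrier[OF A] GL_int_carrier[OF B]
  show "A * z * B \<in> carrier_mat n n" using c by auto
  have S: "?S \<in> sets ?L" by (rule int_vol_set_measurable[OF z])
  have act: "mat_act (A * z * B) x = mat_act A (mat_act z (mat_act B x))" for x
    using mat_act_mult[of "A * z" n n B n x] mat_act_mult[of A n n z n "mat_act B x"] c by simp
  have "{x \<in> int_funs {..<n}. mat_act (A * z * B) x \<in> int_funs {..<n}} = mat_act B -` ?S \<inter> space ?L"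
  proof (rule Set.set_eqI)
    fix x :: "nat \<Rightarrow> 'p padic"
    have "x \<in> int_funs {..<n} \<longleftrightarrow> x \<in> extensional {..<n} \<and> mat_act B x \<in> int_funs {..<n}"
      using mat_act_GL_int_iff[OF B, of x] by (auto simp: PiE_def)
    moreover have "mat_act (A * z * B) x \<in> int_funs {..<n} \<longleftrightarrow> mat_act z (mat_act B x) \<in> int_funs {..<n}"
      unfolding act by (rule mat_act_GL_int_iff[OF A]) (use c in simp)
    ultimately show "x \<in> {x \<in> int_funs {..<n}. mat_act (A * z * B) x \<in> int_funs {..<n}}
        \<longleftrightarrow> x \<in> mat_act B -` ?S \<inter> space ?L" by simp blast
  qed
  then have "emeasure ?L {x \<in> int_funs {..<n}. mat_act (A * z * B) x \<in> int_funs {..<n}}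
      = emeasure (distr ?L ?L (mat_act B)) ?S"
    using emeasure_distr[OF measurable_mat_act[OF c(3)] S] by simp
  also have "\<dots> = ennreal (int_vol z)"
    by (simp only: distr_mat_act_GL_int[OF B] emeasure_int_vol[OF z])
  finally show "emeasure ?L {x \<in> int_funs {..<n}. mat_act (A * z * B) x \<in> int_funs {..<n}} = ennreal (int_vol z)" .
qed simp

lemma emeasure_padic_ints_scaled:
  "emeasure padic_haar {x \<in> padic_ints. d * x \<in> padic_ints} = ennreal (1 / max 1 (padic_norm (d :: 'p::prime_card padic)))"
proof (cases "padic_norm d \<le> 1")
  case True
  then have "d * x \<in> padic_ints" if "x \<in> padic_ints" for x
    using that by (intro padic_ints_mult) (auto simp: padic_ints_iff)
  then have "{x \<in> padic_ints. d * x \<in> padic_ints} = padic_ints" by auto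
  with True show ?thesis by simp
next
  case False
  then have "{x \<in> padic_ints. d * x \<in> padic_ints} = {x. d * x + 0 \<in> padic_ints}"
    using padic_ints_cancel_scale[of d] by auto
  moreover have "d \<noteq> 0" using False by auto
  ultimately show ?thesis using False emeasure_padic_haar_affine_ints[of d 0] by simp
qed

text \<open>The lattice is a box, and the coordinate \<open>i\<close> is constrained by both x_i and
  d_i x_i being integral, of which the stronger condition wins.\<close>

lemma int_vol_diag:
  "int_vol (mat_diag n d :: 'p::prime_card padic mat) = (\<Prod>i<n. 1 / max 1 (padic_norm (d i)))"
proof (rule int_vol_eqI)
  have "{x \<in> int_funs {..<n}. mat_act (mat_diag n d) x \<in> int_funs {..<n}}
      = (\<Pi>\<^sub>E i\<in>{..<n}. {x \<in> padic_ints. d i * x \<in> padic_ints})"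
  proof (rule Set.set_eqI)
    fix x :: "nat \<Rightarrow> 'p padic"
    have "mat_act (mat_diag n d) x \<in> int_funs {..<n} \<longleftrightarrow> (\<forall>i\<in>{..<n}. d i * x i \<in> padic_ints)"
      by (simp add: mat_act_diag PiE_iff)
    then show "x \<in> {x \<in> int_funs {..<n}. mat_act (mat_diag n d) x \<in> int_funs {..<n}}
        \<longleftrightarrow> x \<in> (\<Pi>\<^sub>E i\<in>{..<n}. {x \<in> padic_ints. d i * x \<in> padic_ints})"
      by (simp only: mem_Collect_eq PiE_iff) blast
  qed
  then have "emeasure (haar_prod {..<n}) {x \<in> int_funs {..<n}. mat_act (mat_diag n d) x \<in> int_funs {..<n}}
      = (\<Prod>i<n. emeasure padic_haar {x \<in> padic_ints. d i * x \<in> padic_ints})"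
    by (simp only:) (subst padic_prod.emeasure_PiM, simp_all add: Collect_conj_eq padic_scaled_ints_borel sets.Int)
  also have "\<dots> = (\<Prod>i<n. ennreal (1 / max 1 (padic_norm (d i))))"
    by (simp only: emeasure_padic_ints_scaled)
  also have "\<dots> = ennreal (\<Prod>i<n. 1 / max 1 (padic_norm (d i)))"
    by (rule prod_ennreal) simp
  finally show "emeasure (haar_prod {..<n}) {x \<in> int_funs {..<n}. mat_act (mat_diag n d) x \<in> int_funs {..<n}}
      = ennreal (\<Prod>i<n. 1 / max 1 (padic_norm (d i)))" .
qed (auto intro!: prod_nonneg)

text \<open>The predicate inside the description \<open>sing_exps\<close>, named so that its
  existence and uniqueness can be stated.\<close>

definition is_sing_exps :: "'p::prime_card padic mat \<Rightarrow> int option list \<Rightarrow> bool" where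
  "is_sing_exps z ks \<longleftrightarrow> length ks = dim_row z \<and> sorted_wrt (\<ge>) ks \<and>
    (\<exists>A\<in>GL_int (dim_row z). \<exists>B\<in>GL_int (dim_row z).
      z = A * mat_diag (dim_row z) (\<lambda>j. sing_entry (ks ! j)) * B)"

text \<open>A scalar commutes with the two outer factors and only rescales the diagonal. The freedom
  in \<open>c\<close> is what makes the exponents recoverable from volumes.\<close>

lemma int_vol_smult_sing_exps:
  fixes z :: "'p::prime_card padic mat"
  assumes "is_sing_exps z ks"
  shows "int_vol (c \<cdot>\<^sub>m z) = (\<Prod>i<length ks. 1 / max 1 (padic_norm c * padic_norm (sing_entry (ks ! i) :: 'p padic)))"
proof -
  let ?n = "length ks"
  let ?D = "\<lambda>c. mat_diag ?n (\<lambda>j. c * sing_entry (ks ! j)) :: 'p padic mat"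
  have len: "dim_row z = ?n" using assms by (simp add: is_sing_exps_def)
  obtain A B where "A \<in> GL_int (dim_row z)" "B \<in> GL_int (dim_row z)"
    "z = A * mat_diag (dim_row z) (\<lambda>j. sing_entry (ks ! j)) * B"
    using assms unfolding is_sing_exps_def by blast
  then have AB: "A \<in> GL_int ?n" "B \<in> GL_int ?n" "z = A * ?D 1 * B"
    by (simp_all only: len mult_1)
  note c = AB(1,2)[THEN GL_int_carrier]
  have D: "c \<cdot>\<^sub>m ?D 1 = ?D c" by (auto simp: mat_diag_def intro!: eq_matI)
  have "c \<cdot>\<^sub>m z = (c \<cdot>\<^sub>m (A * ?D 1)) * B"
    unfolding AB(3) using c by (intro mult_smult_assoc_mat[symmetric, of _ ?n ?n _ ?n]) auto
  also have "c \<cdot>\<^sub>m (A * ?D 1) = A * (c \<cdot>\<^sub>m ?D 1)"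
    using c by (intro mult_smult_distrib[symmetric, of _ ?n ?n _ ?n]) auto
  finally have "c \<cdot>\<^sub>m z = A * ?D c * B" unfolding D .
  then show ?thesis
    using int_vol_GL_int[OF mat_diag_dim AB(1,2)] by (simp add: int_vol_diag padic_norm_mult)
qed

text \<open>In a decreasing list the entries exceeding \<open>t\<close> form an initial segment, so
  their number decides which positions they occupy.\<close>

lemma sorted_nth_gt_iff_card:
  fixes ks :: "'a::linorder list"
  assumes "sorted_wrt (\<ge>) ks" "i < length ks"
  shows "ks ! i > t \<longleftrightarrow> i < card {j. j < length ks \<and> ks ! j > t}"
proof
  have mono: "ks ! j \<le> ks ! l" if "l \<le> j" "j < length ks" for j l
    using assms(1) that by (cases "l = j") (auto simp: sorted_wrt_iff_nth_less)
  {
    assume "ks ! i > t"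
    then have "{..i} \<subseteq> {j. j < length ks \<and> ks ! j > t}"
      using mono[of _ i] assms(2) by (auto intro: less_le_trans)
    from card_mono[OF _ this] show "i < card {j. j < length ks \<and> ks ! j > t}" by simp
  next
    assume "i < card {j. j < length ks \<and> ks ! j > t}"
    show "ks ! i > t"
    proof (rule ccontr)
      assume "\<not> ks ! i > t"
      then have "{j. j < length ks \<and> ks ! j > t} \<subseteq> {..<i}"
        using mono[of i] by (auto simp: not_less) (meson leD le_less_linear less_le_trans)
      from card_mono[OF _ this] \<open>i < card _\<close> show False by simp
    qed
  }
qed

text \<open>
  The volumes of the lattices of all multiples \<open>c z\<close> determine, for every \<open>t\<close>, the number of
  exponents exceeding \<open>t\<close>.
\<close>

lemma sing_exps_unique:
  fixes z :: "'p::prime_card padic mat"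
  assumes ks: "is_sing_exps z ks" and ls: "is_sing_exps z ls"
  shows "ks = ls"
proof -
  let ?p = "real CARD('p)"
  let ?s = "\<lambda>k. padic_norm (sing_entry k :: 'p padic)"
  let ?F = "\<lambda>ks t. \<Prod>i<length ks. max 1 (?p powi (- t) * ?s (ks ! i))"
  have p: "?p > 1" by (rule prime_card_gt_1)
  have len: "length ks = length ls" using ks ls by (simp add: is_sing_exps_def)
  have F: "?F ks t = ?F ls t" for t
  proof -
    obtain c :: "'p padic" where c: "padic_norm c = ?p powi (- t)"
      using padic_norm_sing_entry[of "Some (- t)", where 'p='p] by auto
    have "(\<Prod>i<length ks. 1 / max 1 (padic_norm c * ?s (ks ! i))) = (\<Prod>i<length ls. 1 / max 1 (padic_norm c * ?s (ls ! i)))"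
      using int_vol_smult_sing_exps[OF ks, of c] int_vol_smult_sing_exps[OF ls, of c] by simp
    then show ?thesis by (simp add: prod_dividef c)
  qed
  \<comment> \<open>Lowering the scaling from p^(-t) to p^(-t-1) divides exactly the factors with
    exponent above \<open>t\<close> by p and leaves the others at 1. The ratio of consecutive
    products therefore counts these exponents.\<close>
  have step: "?F ks t = ?F ks (t + 1) * ?p ^ card {j. j < length ks \<and> ks ! j > Some t}" for ks t
  proof -
    have 1: "max 1 (?p powi (- t) * ?s k) = max 1 (?p powi (- (t + 1)) * ?s k) * (if k > Some t then ?p else 1)" for k
    proof (cases k)
      case (Some l)
      have *: "?p powi (- t) * ?p powi l = ?p powi (l - t)" "?p powi (- t - 1) * ?p powi l = ?p powi (l - t - 1)"
        using p by (simp_all add: power_int_add[symmetric] algebra_simps)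
      have **: "?p powi m \<le> 1 \<longleftrightarrow> m \<le> 0" for m using powi_card_le_iff[of m 0, where 'p='p] by simp
      have ***: "?p powi (l - t - 1) * ?p = ?p powi (l - t)"
        using p by (simp add: power_int_diff)
      show ?thesis
      proof (cases "l > t")
        case True
        then have "?p powi (l - t) \<ge> 1" "?p powi (l - t - 1) \<ge> 1"
          using powi_card_le_iff[of 0 _, where 'p='p] by (simp_all add: )
        then show ?thesis using True *** by (simp add: Some padic_norm_sing_entry *)
      next
        case False
        then have "?p powi (l - t) \<le> 1" "?p powi (l - t - 1) \<le> 1" by (simp_all add: **)
        then show ?thesis using False by (simp add: Some padic_norm_sing_entry *)
      qed
    qed (simp add: padic_norm_sing_entry)
    have "?F ks t = ?F ks (t + 1) * (\<Prod>i<length ks. if ks ! i > Some t then ?p else 1)"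
      unfolding prod.distrib[symmetric] by (intro prod.cong refl 1)
    also have "(\<Prod>i<length ks. if ks ! i > Some t then ?p else 1) = ?p ^ card {j. j < length ks \<and> ks ! j > Some t}"
      by (subst prod.If_cases) (auto simp: lessThan_def Int_def intro!: arg_cong[where f = card])
    finally show ?thesis .
  qed
  have pos: "?F ks t > 0" for ks t by (intro prod_pos) auto
  have card: "card {j. j < length ks \<and> ks ! j > Some t} = card {j. j < length ls \<and> ls ! j > Some t}" for t
  proof -
    have "?F ls (t + 1) * ?p ^ card {j. j < length ks \<and> ks ! j > Some t}
        = ?F ls (t + 1) * ?p ^ card {j. j < length ls \<and> ls ! j > Some t}"
      by (simp only: F[symmetric] step[of t ks, symmetric]) (simp only: F step[of t ls])
    moreover have "?F ls (t + 1) \<noteq> 0" by (rule less_imp_neq[OF pos, symmetric])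
    ultimately have "?p ^ card {j. j < length ks \<and> ks ! j > Some t} = ?p ^ card {j. j < length ls \<and> ls ! j > Some t}"
      using mult_left_cancel by blast
    then show ?thesis using p power_inject_exp by blast
  qed
  show ?thesis
  proof (rule nth_equalityI[OF len])
    fix i assume i: "i < length ks"
    have gt: "ks ! i > Some t \<longleftrightarrow> ls ! i > Some t" for t
      using sorted_nth_gt_iff_card[of ks i "Some t"] sorted_nth_gt_iff_card[of ls i "Some t"] card[of t] i len ks ls
      by (simp add: is_sing_exps_def)
    \<comment> \<open>Strict comparison with the thresholds \<open>Some t\<close> separates all
      exponents: \<open>Some a\<close> exceeds \<open>Some (a - 1)\<close>, and \<open>None\<close>
      exceeds none of them.\<close>
    have le: "k \<le> l" if "\<And>t. k > Some t \<Longrightarrow> l > Some t" for k l :: "int option"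
    proof (cases k)
      case (Some a)
      then show ?thesis using that[of "a - 1"] by (cases l) auto
    qed simp
    show "ks ! i = ls ! i" using le[of "ks ! i" "ls ! i"] le[of "ls ! i" "ks ! i"] gt by force
  qed
qed

lemma is_sing_exps_sing_exps:
  assumes "z \<in> carrier_mat n n"
  shows "is_sing_exps z (sing_exps z)"
proof -
  have "\<exists>ks. is_sing_exps z ks"
    using smith_normal_form_exists[of z "dim_row z"] assms by (auto simp: is_sing_exps_def)
  then have "is_sing_exps z (THE ks. is_sing_exps z ks)"
    using sing_exps_unique by (metis theI)
  then show ?thesis unfolding sing_exps_def Let_def is_sing_exps_def .
qed

text \<open>The factor max 1 (p^k) of the inverse volume equals p^k for positive k and 1 otherwise,
  which is the factor in \<open>gamma\<close>.\<close>

lemma gamma_eq_inverse_int_vol: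
  assumes "z \<in> carrier_mat n n"
  shows "gamma (z :: 'p::prime_card padic mat) = 1 / int_vol z"
proof -
  let ?ks = "sing_exps z"
  have "1 \<cdot>\<^sub>m z = z" by auto
  then have "int_vol z = (\<Prod>i<length ?ks. 1 / max 1 (padic_norm (sing_entry (?ks ! i) :: 'p padic)))"
    using int_vol_smult_sing_exps[OF is_sing_exps_sing_exps[OF assms], of 1] by simp
  then have "1 / int_vol z = (\<Prod>i<length ?ks. max 1 (padic_norm (sing_entry (?ks ! i) :: 'p padic)))"
    by (simp add: prod_dividef)
  also have "\<dots> = (\<Prod>i<length ?ks. case ?ks ! i of None \<Rightarrow> 1 | Some k \<Rightarrow> if k > 0 then real CARD('p) powi k else 1)"
    using powi_card_le_iff[of _ 0, where 'p='p] powi_card_le_iff[of 0, where 'p='p]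
    by (intro prod.cong) (auto simp: padic_norm_sing_entry max_def split: option.split)
  also have "\<dots> = gamma z"
    unfolding gamma_def prod.list_conv_set_nth by (simp add: atLeast0LessThan)
  finally show ?thesis by simp
qed

lemma int_vol_pos:
  assumes "z \<in> carrier_mat n n"
  shows "int_vol (z :: 'p::prime_card padic mat) > 0"
proof -
  have "1 \<cdot>\<^sub>m z = z" by auto
  then have "int_vol z = (\<Prod>i<length (sing_exps z). 1 / max 1 (padic_norm (sing_entry (sing_exps z ! i) :: 'p padic)))"
    using int_vol_smult_sing_exps[OF is_sing_exps_sing_exps[OF assms], of 1] by simp
  also have "\<dots> > 0" by (intro prod_pos) auto
  finally show ?thesis .
qed

text \<open>Transposition exchanges the two outer factors of the Smith form and fixes the diagonal
  one, which alone determines the volume.\<close>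

lemma int_vol_transpose:
  assumes z: "z \<in> carrier_mat n n"
  shows "int_vol (transpose_mat z) = int_vol (z :: 'p::prime_card padic mat)"
proof -
  obtain ks A B where AB: "A \<in> GL_int n" "B \<in> GL_int n" "z = A * mat_diag n (\<lambda>j. sing_entry (ks ! j)) * B"
    using smith_normal_form_exists[OF z] by blast
  let ?D = "mat_diag n (\<lambda>j. sing_entry (ks ! j)) :: 'p padic mat"
  have "transpose_mat ?D = ?D" by (auto simp: mat_diag_def intro!: eq_matI)
  then have "int_equiv n (transpose_mat z) ?D"
    using int_equiv_transpose[of n z ?D] z AB by (auto simp: int_equiv_def)
  then obtain A' B' where AB': "A' \<in> GL_int n" "B' \<in> GL_int n" "transpose_mat z = A' * ?D * B'"
    by (auto simp: int_equiv_def)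
  show ?thesis unfolding AB'(3) unfolding AB(3)
    by (simp only: int_vol_GL_int[OF mat_diag_dim] AB AB')
qed

section \<open>Integrating out a row\<close>

text \<open>The lattices of a measurable family of matrices are the sections of one measurable set
  \<open>Q\<close> in a product space, and section measures depend measurably on the
  parameter.\<close>

lemma measurable_int_vol:
  fixes F :: "'a \<Rightarrow> nat \<Rightarrow> nat \<Rightarrow> 'p::prime_card padic"
  assumes F: "\<And>i j. i < k \<Longrightarrow> j < l \<Longrightarrow> (\<lambda>f. F f i j) \<in> borel_measurable N"
  shows "(\<lambda>f. int_vol (Matrix.mat k l (\<lambda>(i, j). F f i j))) \<in> borel_measurable N"
proof -
  let ?L = "haar_prod {..<l} :: (nat \<Rightarrow> 'p padic) measure"
  interpret L: sigma_finite_measure ?L by (rule sigma_finite_haar_prod) simp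
  let ?z = "\<lambda>f. Matrix.mat k l (\<lambda>(i, j). F f i j)"
  define Q where "Q = {q \<in> space (N \<Otimes>\<^sub>M ?L). (\<forall>j\<in>{..<l}. snd q j \<in> padic_ints) \<and>
    (\<forall>i\<in>{..<k}. (\<Sum>j<l. F (fst q) i j * snd q j) \<in> padic_ints)}"
  have comp: "(\<lambda>q. snd q j) \<in> borel_measurable (N \<Otimes>\<^sub>M ?L)" if "j < l" for j
    by (rule measurable_haar_prod_component[OF _ measurable_snd]) (use that in simp)
  have Q: "Q \<in> sets (N \<Otimes>\<^sub>M ?L)"
    unfolding Q_def
    by (intro sets.sets_Collect_conj sets.sets_Collect_finite_All finite_lessThan sets_Collect_padic_ints
        measurable_padic_sum measurable_padic_mult comp measurable_compose[OF measurable_fst F]) simp_all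
  have "(\<lambda>f. measure ?L (Pair f -` Q)) \<in> borel_measurable N"
    unfolding measure_def using L.measurable_emeasure_Pair[OF Q] by (rule measurable_compose) simp
  also have "?this \<longleftrightarrow> (\<lambda>f. int_vol (?z f)) \<in> borel_measurable N"
  proof (rule measurable_cong)
    fix f assume f: "f \<in> space N"
    have "Pair f -` Q = {x \<in> int_funs {..<l}. mat_act (?z f) x \<in> int_funs {..<k}}"
    proof (rule Set.set_eqI)
      fix x :: "nat \<Rightarrow> 'p padic"
      have "mat_act (?z f) x \<in> int_funs {..<k} \<longleftrightarrow> (\<forall>i\<in>{..<k}. (\<Sum>j<l. F f i j * x j) \<in> padic_ints)"
        by (simp add: mat_act_def PiE_iff)
      then show "x \<in> Pair f -` Q \<longleftrightarrow> x \<in> {x \<in> int_funs {..<l}. mat_act (?z f) x \<in> int_funs {..<k}}"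
        using f by (simp add: Q_def space_pair_measure PiE_iff) blast
    qed
    then show "measure ?L (Pair f -` Q) = int_vol (?z f)" by (simp add: int_vol_def)
  qed
  finally show ?thesis .
qed

section \<open>The lattice cut out by a single row\<close>

definition dot :: "nat \<Rightarrow> (nat \<Rightarrow> 'a::comm_semiring_0) \<Rightarrow> (nat \<Rightarrow> 'a) \<Rightarrow> 'a" where
  "dot m r x = (\<Sum>j<m. r j * x j)"

definition append_row :: "'a mat \<Rightarrow> (nat \<Rightarrow> 'a) \<Rightarrow> 'a mat" where
  "append_row z r = Matrix.mat (Suc (dim_row z)) (dim_col z) (\<lambda>(i, j). if i < dim_row z then z $$ (i, j) else r j)"

text \<open>The volume of the \<open>x\<close> in O^m with integral \<open>dot m r x\<close>.
  Mathematically it is the inverse of max(1, |r_0|, ..., |r_(m-1)|).\<close>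

definition dual_vol :: "nat \<Rightarrow> (nat \<Rightarrow> 'p::prime_card padic) \<Rightarrow> real" where
  "dual_vol m r = int_vol (Matrix.mat 1 m (\<lambda>(i, j). r j))"

lemma append_row_carrier [simp]: "z \<in> carrier_mat n m \<Longrightarrow> append_row z r \<in> carrier_mat (Suc n) m"
  by (simp add: append_row_def)

lemma mat_act_append_row_iff:
  assumes "z \<in> carrier_mat n m"
  shows "mat_act (append_row z r) x \<in> int_funs {..<Suc n} \<longleftrightarrow>
    mat_act z x \<in> int_funs {..<n} \<and> dot m r x \<in> padic_ints"
proof -
  have "(\<forall>i\<in>{..<Suc n}. P i) \<longleftrightarrow> (\<forall>i\<in>{..<n}. P i) \<and> P n" for P by (auto simp: less_Suc_eq)
  then show ?thesis using assms by (simp add: mat_act_def append_row_def dot_def PiE_iff)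
qed

lemma emeasure_dual_vol:
  "emeasure (haar_prod {..<m}) {x \<in> int_funs {..<m}. dot m r x \<in> padic_ints} = ennreal (dual_vol m r)"
proof -
  have "mat_act (Matrix.mat 1 m (\<lambda>(i, j). r j)) x \<in> int_funs {..<1} \<longleftrightarrow> dot m r x \<in> padic_ints" for x
    by (simp add: mat_act_def dot_def PiE_iff)
  then show ?thesis
    unfolding dual_vol_def
    using emeasure_int_vol[of "Matrix.mat 1 m (\<lambda>(i, j). r j)" 1 m] by (simp only: mat_carrier)
qed

lemma dual_vol_set_measurable:
  "{x \<in> int_funs {..<m}. dot m r x \<in> padic_ints} \<in> sets (haar_prod {..<m})"
proof -
  have "mat_act (Matrix.mat 1 m (\<lambda>(i, j). r j)) x \<in> int_funs {..<1} \<longleftrightarrow> dot m r x \<in> padic_ints" for x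
    by (simp add: mat_act_def dot_def PiE_iff)
  then show ?thesis
    using int_vol_set_measurable[of "Matrix.mat 1 m (\<lambda>(i, j). r j)" 1 m] by (simp only: mat_carrier)
qed

lemma dual_vol_nonneg [simp]: "0 \<le> dual_vol m r" and dual_vol_le_1: "dual_vol m r \<le> 1"
  by (simp_all add: dual_vol_def int_vol_le_1)

lemma measurable_dual_vol: "dual_vol m \<in> borel_measurable (haar_prod {..<m})"
  unfolding dual_vol_def
  by (intro measurable_int_vol measurable_haar_prod_proj) simp

lemma dot_mat_act_transpose:
  assumes "g \<in> carrier_mat m m"
  shows "dot m (mat_act (transpose_mat g) r) y = dot m r (mat_act g y)"
proof -
  have "dot m (mat_act (transpose_mat g) r) y = (\<Sum>j<m. \<Sum>i<m. g $$ (i, j) * r i * y j)"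
    using assms by (simp add: dot_def mat_act_def sum_distrib_right)
  also have "\<dots> = (\<Sum>i<m. \<Sum>j<m. g $$ (i, j) * r i * y j)" by (rule sum.swap)
  also have "\<dots> = dot m r (mat_act g y)"
    using assms by (simp add: dot_def mat_act_def sum_distrib_left mult_ac)
  finally show ?thesis .
qed

text \<open>\<open>B\<close> preserves Haar measure, so only the diagonal factor scales it.\<close>

lemma distr_mat_act_diag_GL_int:
  fixes d :: "nat \<Rightarrow> 'p::prime_card padic"
  assumes B: "B \<in> GL_int n" and d: "\<And>i. i < n \<Longrightarrow> d i \<noteq> 0"
  shows "distr (haar_prod {..<n}) (haar_prod {..<n}) (mat_act (mat_diag n d * B))
    = scale_measure (ennreal (\<Prod>i<n. 1 / padic_norm (d i))) (haar_prod {..<n})"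
proof -
  let ?L = "haar_prod {..<n} :: (nat \<Rightarrow> 'p padic) measure"
  have "mat_act (mat_diag n d * B) = mat_act (mat_diag n d) \<circ> mat_act B"
    using mat_act_mult[OF mat_diag_dim GL_int_carrier[OF B]] by (simp add: fun_eq_iff)
  then have "distr ?L ?L (mat_act (mat_diag n d * B)) = distr (distr ?L ?L (mat_act B)) ?L (mat_act (mat_diag n d))"
    using distr_distr[OF measurable_mat_act[OF mat_diag_dim] measurable_mat_act[OF GL_int_carrier[OF B]]] by simp
  then show ?thesis by (simp only: distr_mat_act_GL_int[OF B] distr_mat_act_diag[OF d])
qed

text \<open>
  In other words, the lattice \<open>{x \<in> O\<^sup>m. z x \<in> O\<^sup>n}\<close> is the image of \<open>O\<^sup>m\<close> under the inverse of \<open>diag(d) B\<close>.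
\<close>

lemma integral_lattice_form:
  fixes z :: "'p::prime_card padic mat"
  assumes z: "z \<in> carrier_mat n m" and "n \<le> m"
  shows "\<exists>B\<in>GL_int m. \<exists>d. (\<forall>i<m. d i \<noteq> 0) \<and>
    (\<forall>x\<in>extensional {..<m}. (x \<in> int_funs {..<m} \<and> mat_act z x \<in> int_funs {..<n})
      = (mat_act (mat_diag m d * B) x \<in> int_funs {..<m}))"
proof -
  \<comment> \<open>Padding with zero rows makes the matrix square without adding a condition on
    \<open>x\<close>, so the square Smith form applies.\<close>
  define w where "w = Matrix.mat m m (\<lambda>(i, j). if i < n then z $$ (i, j) else 0)"
  have w: "w \<in> carrier_mat m m" by (simp add: w_def)
  obtain ks A B where AB: "A \<in> GL_int m" "B \<in> GL_int m" "w = A * mat_diag m (\<lambda>j. sing_entry (ks ! j)) * B"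
    using smith_normal_form_exists[OF w] by blast
  define s where "s j = (sing_entry (ks ! j) :: 'p padic)" for j
  have wAB: "w = A * mat_diag m s * B" unfolding s_def by (rule AB(3))
  \<comment> \<open>With this choice the single condition that \<open>d j * y\<close> is integral is
    equivalent to \<open>y\<close> and \<open>s j * y\<close> both being integral. It also replaces
    zero entries by 1, which makes the diagonal matrix invertible.\<close>
  define d where "d j = (if padic_norm (s j) \<le> 1 then 1 else s j)" for j
  note c = AB(1,2)[THEN GL_int_carrier]
  have d: "d j * y \<in> padic_ints \<longleftrightarrow> y \<in> padic_ints \<and> s j * y \<in> padic_ints" for j y
  proof (cases "padic_norm (s j) \<le> 1")
    case True
    then show ?thesis using padic_ints_mult[of "s j" y] by (auto simp: d_def padic_ints_iff)
  next
    case False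
    then show ?thesis using padic_ints_cancel_scale[of "s j" y] by (auto simp: d_def)
  qed
  have wz: "mat_act w x \<in> int_funs {..<m} \<longleftrightarrow> mat_act z x \<in> int_funs {..<n}" for x
  proof -
    have "mat_act w x \<in> int_funs {..<m} \<longleftrightarrow> (\<forall>i<m. (\<Sum>j<m. (if i < n then z $$ (i, j) else 0) * x j) \<in> padic_ints)"
      by (simp add: w_def mat_act_def PiE_iff Ball_def)
    also have "\<dots> \<longleftrightarrow> (\<forall>i<n. (\<Sum>j<m. z $$ (i, j) * x j) \<in> padic_ints)"
    proof (intro iffI allI impI)
      fix i assume *: "\<forall>i<m. (\<Sum>j<m. (if i < n then z $$ (i, j) else 0) * x j) \<in> padic_ints" and "i < n"
      then show "(\<Sum>j<m. z $$ (i, j) * x j) \<in> padic_ints" using *[rule_format, of i] \<open>n \<le> m\<close> by simp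
    next
      fix i assume *: "\<forall>i<n. (\<Sum>j<m. z $$ (i, j) * x j) \<in> padic_ints" and "i < m"
      then show "(\<Sum>j<m. (if i < n then z $$ (i, j) else 0) * x j) \<in> padic_ints"
        by (cases "i < n") simp_all
    qed
    also have "\<dots> \<longleftrightarrow> mat_act z x \<in> int_funs {..<n}"
      using z by (simp add: mat_act_def PiE_iff Ball_def)
    finally show ?thesis .
  qed
  have form: "x \<in> int_funs {..<m} \<and> mat_act z x \<in> int_funs {..<n} \<longleftrightarrow> mat_act (mat_diag m d * B) x \<in> int_funs {..<m}"
    if x: "x \<in> extensional {..<m}" for x
  proof -
    have act: "mat_act w x = mat_act A (mat_act (mat_diag m s) (mat_act B x))"
      unfolding wAB using mat_act_mult[of "A * mat_diag m s" m m B m x] mat_act_mult[of A m m "mat_diag m s" m "mat_act B x"] c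
      by simp
    have "x \<in> int_funs {..<m} \<and> mat_act z x \<in> int_funs {..<n} \<longleftrightarrow>
        mat_act B x \<in> int_funs {..<m} \<and> mat_act (mat_diag m s) (mat_act B x) \<in> int_funs {..<m}"
      unfolding wz[symmetric] act mat_act_GL_int_iff[OF AB(2) x]
      by (subst mat_act_GL_int_iff[OF AB(1) mat_act_extensional[OF mat_diag_dim]]) simp
    also have "\<dots> \<longleftrightarrow> (\<forall>i\<in>{..<m}. d i * mat_act B x i \<in> padic_ints)"
      using mat_act_extensional[OF c(2), of x] unfolding d by (auto simp: mat_act_diag PiE_iff)
    also have "\<dots> \<longleftrightarrow> mat_act (mat_diag m d * B) x \<in> int_funs {..<m}"
      using mat_act_mult[OF mat_diag_dim c(2), of d x] by (simp add: mat_act_diag PiE_iff)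
    finally show ?thesis .
  qed
  have d0: "d i \<noteq> 0" for i by (auto simp: d_def)
  show ?thesis by (intro bexI[OF _ AB(2)] exI[of _ d] conjI allI impI ballI d0 form)
qed

definition dual_const :: "'p::prime_card itself \<Rightarrow> nat \<Rightarrow> real \<Rightarrow> ennreal" where
  "dual_const _ m \<alpha> = (\<integral>\<^sup>+ r. ennreal (dual_vol m r powr \<alpha>) \<partial>(haar_prod {..<m} :: (nat \<Rightarrow> 'p padic) measure))"

text \<open>The exponent \<alpha> - 1 arises as follows. With \<open>q\<close> the volume of the
  lattice of \<open>z\<close>, passing to coordinates on that lattice multiplies every volume by
  \<open>q\<close> and contributes \<open>q powr \<alpha>\<close>; the substitution in the row
  variable contributes 1 / q.\<close>

lemma int_vol_append_row_integral:
  fixes z :: "'p::prime_card padic mat"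
  assumes z: "z \<in> carrier_mat n m" and "n \<le> m"
  shows "(\<integral>\<^sup>+ r. ennreal (int_vol (append_row z r) powr \<alpha>) \<partial>haar_prod {..<m})
    = ennreal (int_vol z powr (\<alpha> - 1)) * dual_const TYPE('p) m \<alpha>"
proof -
  let ?L = "haar_prod {..<m} :: (nat \<Rightarrow> 'p padic) measure"
  obtain B d where B: "B \<in> GL_int m" and Bd: "(\<forall>i<m. d i \<noteq> 0) \<and>
      (\<forall>x\<in>extensional {..<m}. (x \<in> int_funs {..<m} \<and> mat_act z x \<in> int_funs {..<n})
        = (mat_act (mat_diag m d * B) x \<in> int_funs {..<m}))"
    using integral_lattice_form[OF assms] by (elim bexE exE)
  have d0: "d i \<noteq> 0" if "i < m" for i by (rule Bd[THEN conjunct1, rule_format, OF that])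
  have lattice: "(x \<in> int_funs {..<m} \<and> mat_act z x \<in> int_funs {..<n})
      = (mat_act (mat_diag m d * B) x \<in> int_funs {..<m})" if "x \<in> extensional {..<m}" for x
    by (rule Bd[THEN conjunct2, THEN bspec, OF that])
  obtain B' where B': "B' \<in> GL_int m" "B * B' = 1\<^sub>m m" "B' * B = 1\<^sub>m m"
    using GL_int_obtain_inverse[OF B] .
  \<comment> \<open>The lattice of \<open>z\<close> is the preimage of O^m under \<open>?T\<close>,
    and \<open>?g\<close> is the inverse of \<open>?T\<close>, so the lattice is the image of O^m
    under \<open>?g\<close>.\<close>
  let ?D = "mat_diag m d" and ?E = "mat_diag m (\<lambda>i. inverse (d i))"
  let ?T = "?D * B" and ?g = "B' * ?E"
  note c = GL_int_carrier[OF B] GL_int_carrier[OF B'(1)]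
  have T: "?T \<in> carrier_mat m m" and g: "?g \<in> carrier_mat m m"
    by (intro mult_carrier_mat[OF mat_diag_dim c(1)] mult_carrier_mat[OF c(2) mat_diag_dim])+
  \<comment> \<open>This is 1 / |det ?T|, the factor by which \<open>?T\<close> scales Haar measure
    under pushforward; the transpose of \<open>?g\<close> scales it by the reciprocal.\<close>
  define q where "q = (\<Prod>i<m. 1 / padic_norm (d i))"
  have q: "q > 0" unfolding q_def by (intro prod_pos) (use d0 in simp)
  have distrT: "distr ?L ?L (mat_act ?T) = scale_measure (ennreal q) ?L"
    unfolding q_def by (rule distr_mat_act_diag_GL_int[OF B d0])
  have "transpose_mat ?E = ?E" by (auto simp: mat_diag_def intro!: eq_matI)
  then have gT: "transpose_mat ?g = ?E * transpose_mat B'"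
    using transpose_mult[OF c(2) mat_diag_dim, of "\<lambda>i. inverse (d i)"] by simp
  have "(\<Prod>i<m. 1 / padic_norm (inverse (d i))) = 1 / q"
    unfolding q_def by (simp add: padic_norm_inverse divide_inverse prod_inversef[symmetric] o_def)
  then have distrg: "distr ?L ?L (mat_act (transpose_mat ?g)) = scale_measure (ennreal (1 / q)) ?L"
    unfolding gT using distr_mat_act_diag_GL_int[OF GL_int_transpose[OF B'(1)], of "\<lambda>i. inverse (d i)"] d0 by simp
  have ED: "?E * ?D = 1\<^sub>m m"
    using d0 by (auto simp: mat_diag_mult_left) (auto simp: mat_diag_def intro!: eq_matI)
  have "?g * ?T = B' * (?E * ?T)" by (rule assoc_mult_mat[OF c(2) mat_diag_dim T])
  also have "?E * ?T = (?E * ?D) * B" by (rule assoc_mult_mat[OF mat_diag_dim mat_diag_dim c(1), symmetric])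
  also have "B' * ((?E * ?D) * B) = 1\<^sub>m m" unfolding ED using c B' by simp
  finally have gTx: "mat_act ?g (mat_act ?T x) = x" if "x \<in> extensional {..<m}" for x
    using mat_act_mult[OF g T, of x] that by (simp add: mat_act_one)
  have vol_z: "int_vol z = q"
  proof (rule int_vol_eqI[OF z])
    have "{x \<in> int_funs {..<m}. mat_act z x \<in> int_funs {..<n}} = mat_act ?T -` int_funs {..<m} \<inter> space ?L"
    proof (rule Set.set_eqI)
      fix x :: "nat \<Rightarrow> 'p padic"
      have "x \<in> int_funs {..<m} \<Longrightarrow> x \<in> extensional {..<m}" by (simp add: PiE_def)
      then show "x \<in> {x \<in> int_funs {..<m}. mat_act z x \<in> int_funs {..<n}}
          \<longleftrightarrow> x \<in> mat_act ?T -` int_funs {..<m} \<inter> space ?L"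
        using lattice[of x] by (simp only: mem_Collect_eq Int_iff vimage_eq space_haar_prod) blast
    qed
    then show "emeasure ?L {x \<in> int_funs {..<m}. mat_act z x \<in> int_funs {..<n}} = ennreal q"
      using emeasure_distr[OF measurable_mat_act[OF T] int_funs_sets] by (simp add: distrT)
  qed (use q in simp)
  \<comment> \<open>In the coordinates y = ?T x the original conditions become integrality of
    \<open>y\<close>, and the new condition pairs \<open>y\<close> with the transpose of
    \<open>?g\<close> applied to \<open>r\<close>.\<close>
  have vol_row: "int_vol (append_row z r) = q * dual_vol m (mat_act (transpose_mat ?g) r)" for r
  proof (rule int_vol_eqI[OF append_row_carrier[OF z]])
    let ?r = "mat_act (transpose_mat ?g) r"
    let ?S = "{y \<in> int_funs {..<m}. dot m ?r y \<in> padic_ints}"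
    have "{x \<in> int_funs {..<m}. mat_act (append_row z r) x \<in> int_funs {..<Suc n}} = mat_act ?T -` ?S \<inter> space ?L"
    proof (rule Set.set_eqI)
      fix x :: "nat \<Rightarrow> 'p padic"
      show "x \<in> {x \<in> int_funs {..<m}. mat_act (append_row z r) x \<in> int_funs {..<Suc n}}
          \<longleftrightarrow> x \<in> mat_act ?T -` ?S \<inter> space ?L"
      proof (cases "x \<in> extensional {..<m}")
        case True
        have "dot m ?r (mat_act ?T x) = dot m r x"
          by (simp only: dot_mat_act_transpose[OF g] gTx[OF True])
        then show ?thesis
          by (simp only: mem_Collect_eq Int_iff vimage_eq space_haar_prod mat_act_append_row_iff[OF z]
              conj_assoc[symmetric] lattice[OF True] True simp_thms)
      next
        case False
        then show ?thesis by (simp add: PiE_def)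
      qed
    qed
    then show "emeasure ?L {x \<in> int_funs {..<m}. mat_act (append_row z r) x \<in> int_funs {..<Suc n}}
        = ennreal (q * dual_vol m ?r)"
      using emeasure_distr[OF measurable_mat_act[OF T] dual_vol_set_measurable[of m ?r]] q
      by (simp add: distrT emeasure_dual_vol ennreal_mult)
  qed (use q in simp)
  have meas: "(\<lambda>r. ennreal (dual_vol m r powr \<alpha>)) \<in> borel_measurable ?L"
    using measurable_dual_vol[of m, where 'a='p] by measurable
  have gtc: "transpose_mat ?g \<in> carrier_mat m m" using g by simp
  have meas': "(\<lambda>r. ennreal (dual_vol m (mat_act (transpose_mat ?g) r) powr \<alpha>)) \<in> borel_measurable ?L"
    by (rule measurable_compose[OF measurable_mat_act[OF gtc] meas])
  have "(\<integral>\<^sup>+ r. ennreal (int_vol (append_row z r) powr \<alpha>) \<partial>?L)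
      = (\<integral>\<^sup>+ r. ennreal (q powr \<alpha>) * ennreal (dual_vol m (mat_act (transpose_mat ?g) r) powr \<alpha>) \<partial>?L)"
    using q by (intro nn_integral_cong) (simp add: vol_row powr_mult ennreal_mult)
  also have "\<dots> = ennreal (q powr \<alpha>) * (\<integral>\<^sup>+ r. ennreal (dual_vol m (mat_act (transpose_mat ?g) r) powr \<alpha>) \<partial>?L)"
    by (rule nn_integral_cmult[OF meas'])
  also have "(\<integral>\<^sup>+ r. ennreal (dual_vol m (mat_act (transpose_mat ?g) r) powr \<alpha>) \<partial>?L)
      = (\<integral>\<^sup>+ r. ennreal (dual_vol m r powr \<alpha>) \<partial>distr ?L ?L (mat_act (transpose_mat ?g)))"
    by (rule nn_integral_distr[symmetric, OF measurable_mat_act[OF gtc]]) (use meas in simp)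
  also have "\<dots> = ennreal (1 / q) * dual_const TYPE('p) m \<alpha>"
    unfolding distrg dual_const_def by (rule nn_integral_scale_measure[OF meas])
  also have "ennreal (q powr \<alpha>) * (ennreal (1 / q) * dual_const TYPE('p) m \<alpha>)
      = ennreal (q powr (\<alpha> - 1)) * dual_const TYPE('p) m \<alpha>"
    using q by (simp add: mult.assoc[symmetric] ennreal_mult[symmetric] powr_diff)
  finally show ?thesis by (simp add: vol_z)
qed

section \<open>Finiteness of the row constant\<close>

lemma indicator_mono_point: "(a \<in> A \<Longrightarrow> b \<in> B) \<Longrightarrow> indicator A a \<le> (indicator B b :: ennreal)"
  by (simp add: indicator_def)

text \<open>With all coordinates but the j-th fixed, the condition on x_j is affine with slope
  \<open>r j\<close>. Whatever the constant term, the slice has measure at most the stated bound,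
  and the other coordinates range over a set of mass 1.\<close>

lemma dual_vol_le_inverse_norm:
  fixes r :: "nat \<Rightarrow> 'p::prime_card padic"
  assumes j: "j < m"
  shows "dual_vol m r \<le> 1 / max 1 (padic_norm (r j))"
proof -
  let ?I = "{..<m} - {j}"
  let ?c = "1 / max 1 (padic_norm (r j))"
  let ?S = "{x \<in> int_funs {..<m}. dot m r x \<in> padic_ints}"
  have ins: "insert j ?I = {..<m}" using j by auto
  have S: "?S \<in> sets (haar_prod {..<m})" by (rule dual_vol_set_measurable)
  have "ennreal (dual_vol m r) = (\<integral>\<^sup>+ x. indicator ?S x \<partial>haar_prod (insert j ?I))"
    unfolding ins emeasure_dual_vol[symmetric] by (rule nn_integral_indicator[symmetric, OF S])
  also have "\<dots> = (\<integral>\<^sup>+ x. (\<integral>\<^sup>+ y. indicator ?S (x(j := y)) \<partial>padic_haar) \<partial>haar_prod ?I)"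
    by (rule padic_prod.product_nn_integral_insert) (use S in \<open>simp_all add: ins del: insert_Diff_single\<close>)
  also have "\<dots> \<le> (\<integral>\<^sup>+ x. ennreal ?c * indicator (int_funs ?I) x \<partial>(haar_prod ?I :: (nat \<Rightarrow> 'p padic) measure))"
  proof (rule nn_integral_mono)
    fix x :: "nat \<Rightarrow> 'p padic" assume "x \<in> space (haar_prod ?I)"
    then have x: "x \<in> extensional ?I" by simp
    show "(\<integral>\<^sup>+ y. indicator ?S (x(j := y)) \<partial>padic_haar) \<le> ennreal ?c * indicator (int_funs ?I) x"
    proof (cases "x \<in> int_funs ?I")
      case True
      let ?e = "\<Sum>i\<in>?I. r i * x i"
      have dot: "dot m r (x(j := y)) = r j * y + ?e" for y
        unfolding dot_def by (subst sum.remove[of _ j]) (use j in \<open>auto intro!: sum.cong\<close>)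
      have yO: "y \<in> padic_ints" if "x(j := y) \<in> ?S" for y
      proof -
        have "x(j := y) \<in> int_funs {..<m}" by (rule CollectD[OF that, THEN conjunct1])
        from PiE_mem[OF this, of j] j show ?thesis by (simp only: lessThan_iff fun_upd_same)
      qed
      have "(\<integral>\<^sup>+ y. indicator ?S (x(j := y)) \<partial>padic_haar) \<le> ennreal ?c"
      proof (cases "padic_norm (r j) \<le> 1")
        case True
        have "(\<integral>\<^sup>+ y. indicator ?S (x(j := y)) \<partial>padic_haar) \<le> (\<integral>\<^sup>+ y. indicator padic_ints y \<partial>(padic_haar :: 'p padic measure))"
          by (intro nn_integral_mono indicator_mono_point yO)
        also have "\<dots> = ennreal ?c" using True by simp
        finally show ?thesis .
      next
        case False
        then have "r j \<noteq> 0" by auto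
        have "(\<integral>\<^sup>+ y. indicator ?S (x(j := y)) \<partial>padic_haar)
            \<le> (\<integral>\<^sup>+ y. indicator {y. r j * y + ?e \<in> padic_ints} y \<partial>padic_haar)"
        proof (intro nn_integral_mono indicator_mono_point CollectI)
          fix y assume "x(j := y) \<in> ?S"
          from CollectD[OF this] have "dot m r (x(j := y)) \<in> padic_ints" by (rule conjunct2)
          then show "r j * y + ?e \<in> padic_ints" by (simp only: dot)
        qed
        also have "\<dots> = ennreal ?c"
          using False emeasure_padic_haar_affine_ints[OF \<open>r j \<noteq> 0\<close>, of ?e]
          by (simp add: padic_affine_ints_borel)
        finally show ?thesis .
      qed
      then show ?thesis using True by simp
    next
      case False
      have "x(j := y) \<notin> ?S" for y
      proof
        assume "x(j := y) \<in> ?S"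
        from CollectD[OF this] have *: "x(j := y) \<in> int_funs {..<m}" by (rule conjunct1)
        have "x i \<in> padic_ints" if i: "i \<in> ?I" for i
        proof -
          have "i \<in> {..<m}" "i \<noteq> j" using i by simp_all
          from PiE_mem[OF * this(1)] this(2) show ?thesis by simp
        qed
        with x have "x \<in> int_funs ?I" by (simp add: PiE_iff)
        with False show False by contradiction
      qed
      then show ?thesis by simp
    qed
  qed
  also have "\<dots> = ennreal ?c * emeasure (haar_prod ?I) (int_funs ?I :: (nat \<Rightarrow> 'p padic) set)"
    by (rule nn_integral_cmult_indicator) (rule int_funs_sets, simp)
  also have "\<dots> = ennreal ?c" by simp
  finally show ?thesis by (simp add: ennreal_le_iff)
qed

text \<open>The geometric mean of the \<open>m\<close> bounds, which makes the integral a product of one-dimensional ones.\<close>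

lemma dual_vol_powr_le_prod:
  fixes r :: "nat \<Rightarrow> 'p::prime_card padic"
  assumes m: "m \<ge> 1" and \<alpha>: "\<alpha> > 0"
  shows "dual_vol m r powr \<alpha> \<le> (\<Prod>j<m. (1 / max 1 (padic_norm (r j))) powr (\<alpha> / real m))"
proof (cases "dual_vol m r = 0")
  case True
  then show ?thesis by (simp add: prod_nonneg)
next
  case False
  then have pos: "dual_vol m r > 0" using dual_vol_nonneg[of m r] by linarith
  have "dual_vol m r powr \<alpha> = (dual_vol m r powr (\<alpha> / real m)) powr real m"
    using m by (simp add: powr_powr)
  also have "\<dots> = (\<Prod>j<m. dual_vol m r powr (\<alpha> / real m))"
    using pos by (simp add: powr_realpow)
  also have "\<dots> \<le> (\<Prod>j<m. (1 / max 1 (padic_norm (r j))) powr (\<alpha> / real m))"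
    by (intro prod_mono conjI powr_mono2 dual_vol_le_inverse_norm) (use \<alpha> in auto)
  finally show ?thesis .
qed

text \<open>Where max(1, |x|) = p^k the integrand is p^(-k \<beta>), and the whole ball of radius
  p^k has mass p^k. Bounding shells by balls leaves a geometric series with ratio p^(1 -
  \<beta>).\<close>

lemma padic_powr_integral_finite:
  assumes "\<beta> > 1"
  shows "(\<integral>\<^sup>+ x. ennreal ((1 / max 1 (padic_norm (x :: 'p::prime_card padic))) powr \<beta>) \<partial>padic_haar) < \<infinity>"
proof -
  let ?p = "real CARD('p)"
  let ?t = "\<lambda>k x. ennreal (?p powr (- (real k * \<beta>))) * indicator (pball (0 :: 'p padic) (int k)) x"
  have p: "?p > 1" by (rule prime_card_gt_1)
  have le: "ennreal ((1 / max 1 (padic_norm x)) powr \<beta>) \<le> (\<Sum>k. ?t k x)" for x :: "'p padic"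
  proof -
    obtain k where k: "x \<in> pball 0 (int k)" "max 1 (padic_norm x) = ?p powr real k"
    proof (cases "padic_norm x \<le> 1")
      case True
      then show thesis using p by (intro that[of 0]) (simp_all add: pball_def)
    next
      case False
      then have "x \<noteq> 0" by auto
      then obtain l where l: "padic_norm x = ?p powi l" using padic_norm_values by blast
      with False have "l > 0" using powi_card_le_iff[of l 0, where 'p='p] by auto
      then have "l = int (nat l)" by simp
      then obtain k where "l = int k" by blast
      then show thesis using l False p by (intro that[of k]) (simp_all add: pball_def powr_realpow)
    qed
    have "(1 / max 1 (padic_norm x)) powr \<beta> = ?p powr (- (real k * \<beta>))"
      unfolding k(2) using p by (simp add: powr_divide powr_powr powr_minus_divide)
    \<comment> \<open>One term of the series, the one for the shell containing \<open>x\<close>,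
      already equals the integrand there.\<close>
    then have "ennreal ((1 / max 1 (padic_norm x)) powr \<beta>) = (\<Sum>k\<in>{k}. ?t k x)" using k(1) by simp
    also have "\<dots> \<le> (\<Sum>k. ?t k x)" by (rule sum_le_suminf) (simp_all add: summableI)
    finally show ?thesis .
  qed
  have "(\<integral>\<^sup>+ x. ennreal ((1 / max 1 (padic_norm (x :: 'p padic))) powr \<beta>) \<partial>padic_haar)
      \<le> (\<integral>\<^sup>+ x. (\<Sum>k. ?t k x) \<partial>padic_haar)"
    by (intro nn_integral_mono le)
  also have "\<dots> = (\<Sum>k. (\<integral>\<^sup>+ x. ?t k x \<partial>padic_haar))"
    by (rule nn_integral_suminf) simp
  also have "(\<lambda>k. \<integral>\<^sup>+ x. ?t k x \<partial>padic_haar) = (\<lambda>k. ennreal ((?p powr (1 - \<beta>)) ^ k))"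
  proof
    fix k
    have "(\<integral>\<^sup>+ x. ?t k x \<partial>padic_haar) = ennreal (?p powr (- (real k * \<beta>))) * ennreal (?p powi int k)"
      by (subst nn_integral_cmult_indicator) (simp_all add: emeasure_padic_haar_pball)
    also have "\<dots> = ennreal (?p powr (- (real k * \<beta>)) * ?p powr real k)"
      using p by (simp add: ennreal_mult powr_realpow)
    also have "?p powr (- (real k * \<beta>)) * ?p powr real k = (?p powr (1 - \<beta>)) powr real k"
      by (simp add: powr_add[symmetric] powr_powr algebra_simps)
    also have "\<dots> = (?p powr (1 - \<beta>)) ^ k" using p by (simp add: powr_realpow)
    finally show "(\<integral>\<^sup>+ x. ?t k x \<partial>padic_haar) = ennreal ((?p powr (1 - \<beta>)) ^ k)" .
  qed
  also have "(\<Sum>k. ennreal ((?p powr (1 - \<beta>)) ^ k)) = ennreal (\<Sum>k. (?p powr (1 - \<beta>)) ^ k)"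
  proof (rule suminf_ennreal2)
    have "?p powr (1 - \<beta>) < ?p powr 0" using p assms by (intro powr_less_mono) auto
    then show "summable (\<lambda>k. (?p powr (1 - \<beta>)) ^ k)" using p by (intro summable_geometric) simp
  qed simp
  also have "\<dots> < \<infinity>" by simp
  finally show ?thesis .
qed

text \<open>The geometric mean distributes the exponent over the \<open>m\<close> coordinates, and
  \<alpha> / m > 1 makes each one-dimensional integral converge.\<close>

lemma dual_const_finite:
  assumes m: "m \<ge> 1" and \<alpha>: "\<alpha> > real m"
  shows "dual_const TYPE('p::prime_card) m \<alpha> < \<infinity>"
proof -
  let ?f = "\<lambda>x :: 'p padic. ennreal ((1 / max 1 (padic_norm x)) powr (\<alpha> / real m))"
  have mf: "?f \<in> borel_measurable borel"
  proof -
    have "continuous_on UNIV (padic_norm :: 'p padic \<Rightarrow> real)"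
    proof -
      have "continuous_on UNIV (\<lambda>x :: 'p padic. dist x 0)" by (intro continuous_intros)
      then show ?thesis by (simp add: dist_padic_def)
    qed
    then have "(padic_norm :: 'p padic \<Rightarrow> real) \<in> borel_measurable borel"
      by (rule borel_measurable_continuous_onI)
    then show ?thesis by measurable
  qed
  have "dual_const TYPE('p) m \<alpha> \<le> (\<integral>\<^sup>+ r. (\<Prod>j<m. ?f (r j)) \<partial>haar_prod {..<m})"
    unfolding dual_const_def
  proof (rule nn_integral_mono)
    fix r :: "nat \<Rightarrow> 'p padic"
    have "ennreal (dual_vol m r powr \<alpha>) \<le> ennreal (\<Prod>j<m. (1 / max 1 (padic_norm (r j))) powr (\<alpha> / real m))"
      using m \<alpha> by (intro ennreal_leI dual_vol_powr_le_prod) auto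
    also have "\<dots> = (\<Prod>j<m. ?f (r j))" by (rule prod_ennreal[symmetric]) simp
    finally show "ennreal (dual_vol m r powr \<alpha>) \<le> (\<Prod>j<m. ?f (r j))" .
  qed
  also have "\<dots> = (\<Prod>j<m. integral\<^sup>N padic_haar ?f)"
    by (rule padic_prod.product_nn_integral_prod) (use mf in simp_all)
  also have "\<dots> = (integral\<^sup>N padic_haar ?f) ^ m" by simp
  also have "\<dots> < \<infinity>"
  proof -
    have "integral\<^sup>N padic_haar ?f < \<infinity>"
      using m \<alpha> by (intro padic_powr_integral_finite) (simp add: field_simps)
    then show ?thesis by (simp add: power_less_top_ennreal)
  qed
  finally show ?thesis .
qed

text \<open>The integrand is 1 on the integral rows, which have mass 1. Being nonzero is half of
  what allows the constant to be cancelled in \<open>ennreal\<close>.\<close>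

lemma dual_const_nonzero: "dual_const TYPE('p::prime_card) m \<alpha> \<noteq> 0"
proof -
  let ?L = "haar_prod {..<m} :: (nat \<Rightarrow> 'p padic) measure"
  have "dual_vol m r = 1" if r: "r \<in> int_funs {..<m}" for r :: "nat \<Rightarrow> 'p padic"
  proof -
    have "dot m r x \<in> padic_ints" if "x \<in> int_funs {..<m}" for x
      unfolding dot_def by (intro padic_ints_sum padic_ints_mult PiE_mem[OF r] PiE_mem[OF that]) simp_all
    then have "{x \<in> int_funs {..<m}. dot m r x \<in> padic_ints} = int_funs {..<m}" by blast
    then show ?thesis using emeasure_dual_vol[of m r] by simp
  qed
  then have "(\<integral>\<^sup>+ r. indicator (int_funs {..<m}) r \<partial>?L) \<le> dual_const TYPE('p) m \<alpha>"
    unfolding dual_const_def by (intro nn_integral_mono) (simp add: indicator_def)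
  also have "(\<integral>\<^sup>+ r. indicator (int_funs {..<m}) r \<partial>?L) = 1"
    using int_funs_sets[of "{..<m}", where 'b='p] by simp
  finally show ?thesis by auto
qed

section \<open>The projection\<close>

text \<open>Used to treat the entries of the last row or column, indexed by pairs, as vectors
  indexed by an initial segment.\<close>

lemma haar_prod_reindex:
  assumes A: "finite A" and t: "bij_betw t A R"
  shows "distr (haar_prod R) (haar_prod A) (\<lambda>x. \<lambda>i\<in>A. x (t i))
    = (haar_prod A :: ('i \<Rightarrow> 'p::prime_card padic) measure)"
proof (rule padic_prod.PiM_eqI[OF A])
  have R: "finite R" using A t bij_betw_finite by blast
  have tR: "t i \<in> R" if "i \<in> A" for i using t that by (auto simp: bij_betw_def)
  have m: "(\<lambda>x. \<lambda>i\<in>A. x (t i)) \<in> haar_prod R \<rightarrow>\<^sub>M (haar_prod A :: ('i \<Rightarrow> 'p padic) measure)"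
    by (intro measurable_into_haar_prod measurable_haar_prod_proj tR)
  fix E :: "'i \<Rightarrow> 'p padic set" assume E: "\<And>i. i \<in> A \<Longrightarrow> E i \<in> sets padic_haar"
  let ?u = "the_inv_into A t"
  have inj: "inj_on t A" and img: "t ` A = R" using t by (auto simp: bij_betw_def)
  have ut: "?u (t i) = i" if "i \<in> A" for i using the_inv_into_f_f[OF inj that] .
  have uR: "?u j \<in> A" if "j \<in> R" for j using the_inv_into_into[OF inj, of j A] that img by auto
  have pre: "(\<lambda>x. \<lambda>i\<in>A. x (t i)) -` Pi\<^sub>E A E \<inter> space (haar_prod R) = (\<Pi>\<^sub>E j\<in>R. E (?u j))"
  proof (rule Set.set_eqI)
    fix x :: "_ \<Rightarrow> 'p padic"
    have "(\<forall>i\<in>A. x (t i) \<in> E i) \<longleftrightarrow> (\<forall>j\<in>R. x j \<in> E (?u j))"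
      unfolding img[symmetric] ball_simps(9) using ut by simp
    then show "x \<in> (\<lambda>x. \<lambda>i\<in>A. x (t i)) -` Pi\<^sub>E A E \<inter> space (haar_prod R) \<longleftrightarrow> x \<in> (\<Pi>\<^sub>E j\<in>R. E (?u j))"
      by (simp add: PiE_iff conj_commute)
  qed
  have PE: "Pi\<^sub>E A E \<in> sets (haar_prod A)" using E by (intro sets_PiM_I_finite A) auto
  have "emeasure (distr (haar_prod R) (haar_prod A) (\<lambda>x. \<lambda>i\<in>A. x (t i))) (Pi\<^sub>E A E)
      = emeasure (haar_prod R) (\<Pi>\<^sub>E j\<in>R. E (?u j))"
    unfolding pre[symmetric] by (rule emeasure_distr[OF m PE])
  also have "\<dots> = (\<Prod>j\<in>R. emeasure padic_haar (E (?u j)))"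
    by (rule padic_prod.emeasure_PiM[OF R]) (rule E[OF uR])
  also have "\<dots> = (\<Prod>i\<in>A. emeasure padic_haar (E (?u (t i))))"
    by (rule prod.reindex_bij_betw[OF t, symmetric])
  also have "\<dots> = (\<Prod>i\<in>A. emeasure padic_haar (E i))" by (intro prod.cong refl) (simp only: ut)
  finally show "emeasure (distr (haar_prod R) (haar_prod A) (\<lambda>x. \<lambda>i\<in>A. x (t i))) (Pi\<^sub>E A E)
      = (\<Prod>i\<in>A. emeasure padic_haar (E i))" .
qed simp

lemma haar_prod_reindex_integral:
  assumes A: "finite A" and t: "bij_betw t A R"
    and H: "H \<in> borel_measurable (haar_prod A :: ('i \<Rightarrow> 'p::prime_card padic) measure)"
  shows "(\<integral>\<^sup>+ x. H (\<lambda>i\<in>A. x (t i)) \<partial>haar_prod R) = (\<integral>\<^sup>+ x. H x \<partial>haar_prod A)"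
proof -
  have tR: "t i \<in> R" if "i \<in> A" for i using t that by (auto simp: bij_betw_def)
  have m: "(\<lambda>x. \<lambda>i\<in>A. x (t i)) \<in> haar_prod R \<rightarrow>\<^sub>M (haar_prod A :: ('i \<Rightarrow> 'p padic) measure)"
    by (intro measurable_into_haar_prod measurable_haar_prod_proj tR)
  have "(\<integral>\<^sup>+ x. H (\<lambda>i\<in>A. x (t i)) \<partial>haar_prod R)
      = (\<integral>\<^sup>+ x. H x \<partial>distr (haar_prod R) (haar_prod A) (\<lambda>x. \<lambda>i\<in>A. x (t i)))"
    by (rule nn_integral_distr[OF m, symmetric]) (simp add: H)
  then show ?thesis by (simp only: haar_prod_reindex[OF A t])
qed

section \<open>Padding by zeros and transposition of rectangular matrices\<close>

lemma int_vol_append_zero_row: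
  assumes z: "z \<in> carrier_mat n m"
  shows "int_vol (append_row z (\<lambda>_. 0)) = int_vol z"
proof (rule int_vol_eqI[OF append_row_carrier[OF z]])
  have "dot m (\<lambda>_. 0) x = 0" for x :: "nat \<Rightarrow> 'a padic" by (simp add: dot_def)
  then show "emeasure (haar_prod {..<m}) {x \<in> int_funs {..<m}. mat_act (append_row z (\<lambda>_. 0)) x \<in> int_funs {..<Suc n}}
      = ennreal (int_vol z)"
    by (simp only: mat_act_append_row_iff[OF z] padic_ints_0 simp_thms emeasure_int_vol[OF z])
qed simp

text \<open>The extra coordinate is constrained only to be integral and contributes the factor
  1.\<close>

lemma int_vol_append_zero_col:
  fixes w :: "'p::prime_card padic mat"
  assumes w: "w \<in> carrier_mat k l"
  shows "int_vol (Matrix.mat k (Suc l) (\<lambda>(i, j). if j < l then w $$ (i, j) else 0)) = int_vol w"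
    (is "int_vol ?w = _")
proof (rule int_vol_eqI)
  let ?S = "{x \<in> int_funs {..<l}. mat_act w x \<in> int_funs {..<k}}"
  let ?S' = "{x \<in> int_funs {..<Suc l}. mat_act ?w x \<in> int_funs {..<k}}"
  have S: "?S \<in> sets (haar_prod {..<l})" by (rule int_vol_set_measurable[OF w])
  have S': "?S' \<in> sets (haar_prod {..<Suc l})" by (rule int_vol_set_measurable) simp
  have ins: "{..<Suc l} = insert l {..<l}" by auto
  have mem: "x(l := y) \<in> ?S' \<longleftrightarrow> x \<in> ?S \<and> y \<in> padic_ints" if x: "x \<in> extensional {..<l}" for x y
  proof -
    have act: "mat_act ?w (x(l := y)) = mat_act w x"
      using w by (auto simp: mat_act_def fun_eq_iff lessThan_Suc intro!: sum.cong)
    have "(\<forall>i\<in>{..<Suc l}. (x(l := y)) i \<in> padic_ints) \<longleftrightarrow> (\<forall>i\<in>{..<l}. x i \<in> padic_ints) \<and> y \<in> padic_ints"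
      by (auto simp: ins)
    moreover have "x(l := y) \<in> extensional {..<Suc l}" using x by (auto simp: extensional_def)
    ultimately have "x(l := y) \<in> int_funs {..<Suc l} \<longleftrightarrow> x \<in> int_funs {..<l} \<and> y \<in> padic_ints"
      using x by (simp only: PiE_iff simp_thms)
    then show ?thesis by (simp only: mem_Collect_eq act) blast
  qed
  have "emeasure (haar_prod {..<Suc l}) ?S' = (\<integral>\<^sup>+ x. indicator ?S' x \<partial>haar_prod (insert l {..<l}))"
    unfolding ins[symmetric] by (rule nn_integral_indicator[symmetric, OF S'])
  also have "\<dots> = (\<integral>\<^sup>+ x. (\<integral>\<^sup>+ y. indicator ?S' (x(l := y)) \<partial>padic_haar) \<partial>haar_prod {..<l})"
    by (rule padic_prod.product_nn_integral_insert) (use S' in \<open>simp_all add: ins[symmetric]\<close>)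
  also have "\<dots> = (\<integral>\<^sup>+ x. indicator ?S x \<partial>haar_prod {..<l})"
  proof (rule nn_integral_cong)
    fix x :: "nat \<Rightarrow> 'p padic" assume "x \<in> space (haar_prod {..<l})"
    then have x: "x \<in> extensional {..<l}" by simp
    have "(\<integral>\<^sup>+ y. indicator ?S' (x(l := y)) \<partial>padic_haar)
        = (\<integral>\<^sup>+ y. indicator ?S x * indicator padic_ints y \<partial>(padic_haar :: 'p padic measure))"
      by (intro nn_integral_cong) (simp only: indicator_def mem[OF x] of_bool_conj)
    also have "\<dots> = indicator ?S x * emeasure padic_haar (padic_ints :: 'p padic set)"
      by (rule nn_integral_cmult_indicator) simp
    finally show "(\<integral>\<^sup>+ y. indicator ?S' (x(l := y)) \<partial>padic_haar) = indicator ?S x" by simp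
  qed
  also have "\<dots> = emeasure (haar_prod {..<l}) ?S" by (rule nn_integral_indicator[OF S])
  also have "\<dots> = ennreal (int_vol w)" by (rule emeasure_int_vol[OF w])
  finally show "emeasure (haar_prod {..<Suc l}) ?S' = ennreal (int_vol w)" .
qed simp_all

text \<open>A zero row makes \<open>w\<close> square, so that transposition invariance applies;
  after transposing it is a zero column. Neither changes the volume.\<close>

lemma int_vol_transpose_Suc:
  fixes w :: "'p::prime_card padic mat"
  assumes w: "w \<in> carrier_mat n (Suc n)"
  shows "int_vol (transpose_mat w) = int_vol w"
proof -
  have sq: "append_row w (\<lambda>_. 0) \<in> carrier_mat (Suc n) (Suc n)" by (rule append_row_carrier[OF w])
  have wt: "transpose_mat w \<in> carrier_mat (Suc n) n" using w by simp
  have "transpose_mat (append_row w (\<lambda>_. 0))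
      = Matrix.mat (Suc n) (Suc n) (\<lambda>(i, j). if j < n then transpose_mat w $$ (i, j) else 0)"
    by (rule eq_matI) (simp_all add: append_row_def carrier_matD[OF w])
  then have "int_vol (transpose_mat w) = int_vol (transpose_mat (append_row w (\<lambda>_. 0)))"
    by (simp only: int_vol_append_zero_col[OF wt])
  then show ?thesis by (simp only: int_vol_transpose[OF sq] int_vol_append_zero_row[OF w])
qed

text \<open>Reduces integration over a column of \<open>z\<close> to integration over a row appended
  to its transpose.\<close>

lemma int_vol_append_col:
  fixes z :: "'p::prime_card padic mat"
  assumes z: "z \<in> carrier_mat n n"
  shows "int_vol (Matrix.mat n (Suc n) (\<lambda>(i, j). if j < n then z $$ (i, j) else c i))
    = int_vol (append_row (transpose_mat z) c)"
proof -
  let ?w = "Matrix.mat n (Suc n) (\<lambda>(i, j). if j < n then z $$ (i, j) else c i)"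
  have "transpose_mat ?w = append_row (transpose_mat z) c"
    by (rule eq_matI) (simp_all add: append_row_def carrier_matD[OF z])
  then show ?thesis using int_vol_transpose_Suc[of ?w n] by simp
qed

lemma measurable_int_vol_append_row:
  "(\<lambda>r. int_vol (append_row z r)) \<in> borel_measurable (haar_prod {..<dim_col z} :: (nat \<Rightarrow> 'p::prime_card padic) measure)"
proof -
  have "(\<lambda>r. int_vol (Matrix.mat (Suc (dim_row z)) (dim_col z) (\<lambda>(i, j). (if i < dim_row z then z $$ (i, j) else r j))))
    \<in> borel_measurable (haar_prod {..<dim_col z} :: (nat \<Rightarrow> 'p padic) measure)"
  proof (rule measurable_int_vol)
    fix i j assume j: "j < dim_col z"
    show "(\<lambda>r. if i < dim_row z then z $$ (i, j) else r j)
        \<in> borel_measurable (haar_prod {..<dim_col z} :: (nat \<Rightarrow> 'p padic) measure)"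
    proof (cases "i < dim_row z")
      case True
      then show ?thesis by (simp only: if_True) (rule borel_measurable_const)
    next
      case False
      show ?thesis using False by (simp only: if_False) (rule measurable_haar_prod_proj, simp add: j)
    qed
  qed
  then show ?thesis by (simp only: append_row_def)
qed

lemma measurable_int_vol_mat:
  assumes "{..<k} \<times> {..<l} \<subseteq> J"
  shows "(\<lambda>f. int_vol (Matrix.mat k l f)) \<in> borel_measurable (haar_prod J :: (_ \<Rightarrow> 'p::prime_card padic) measure)"
proof -
  have "(\<lambda>f. int_vol (Matrix.mat k l (\<lambda>(i, j). f (i, j)))) \<in> borel_measurable (haar_prod J :: (_ \<Rightarrow> 'p padic) measure)"
    by (intro measurable_int_vol measurable_haar_prod_proj) (use assms in auto)
  then show ?thesis by simp
qed


lemma measurable_int_vol_powr: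
  assumes "{..<k} \<times> {..<l} \<subseteq> J"
  shows "(\<lambda>f. ennreal (int_vol (Matrix.mat k l f) powr a))
    \<in> borel_measurable (haar_prod J :: (_ \<Rightarrow> 'p::prime_card padic) measure)"
  using measurable_int_vol_mat[OF assms, where 'p='p] by simp

section \<open>Integration over the last row and the last column\<close>

lemma haar_fiber_row_integral:
  fixes x :: "nat \<times> nat \<Rightarrow> 'p::prime_card padic"
  shows "(\<integral>\<^sup>+ r. ennreal (int_vol (Matrix.mat (Suc n) (Suc n)
      (merge ({..<n} \<times> {..<Suc n}) ({n} \<times> {..<Suc n}) (x, r))) powr \<alpha>) \<partial>haar_prod ({n} \<times> {..<Suc n}))
    = ennreal (int_vol (Matrix.mat n (Suc n) x) powr (\<alpha> - 1)) * dual_const TYPE('p) (Suc n) \<alpha>"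
proof -
  let ?z = "Matrix.mat n (Suc n) x"
  let ?H = "\<lambda>r. ennreal (int_vol (append_row ?z r) powr \<alpha>)"
  have H: "?H \<in> borel_measurable (haar_prod {..<Suc n} :: (nat \<Rightarrow> 'p padic) measure)"
    using measurable_int_vol_append_row[of ?z] by simp
  have t: "bij_betw (\<lambda>j. (n, j)) {..<Suc n} ({n} \<times> {..<Suc n})"
    by (auto simp: bij_betw_def inj_on_def)
  have eq: "Matrix.mat (Suc n) (Suc n) (merge ({..<n} \<times> {..<Suc n}) ({n} \<times> {..<Suc n}) (x, r))
      = append_row ?z (\<lambda>j\<in>{..<Suc n}. r (n, j))" for r
    by (rule eq_matI) (auto simp: append_row_def merge_def less_Suc_eq)
  show ?thesis
    unfolding eq haar_prod_reindex_integral[OF finite_lessThan t H]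
    by (rule int_vol_append_row_integral[OF mat_carrier]) simp
qed

lemma haar_fiber_col_integral:
  fixes f :: "nat \<times> nat \<Rightarrow> 'p::prime_card padic"
  shows "(\<integral>\<^sup>+ c. ennreal (int_vol (Matrix.mat n (Suc n)
      (merge (mat_index n) ({..<n} \<times> {n}) (f, c))) powr \<alpha>) \<partial>haar_prod ({..<n} \<times> {n}))
    = ennreal (int_vol (Matrix.mat n n f) powr (\<alpha> - 1)) * dual_const TYPE('p) n \<alpha>"
proof -
  let ?z = "Matrix.mat n n f"
  let ?H = "\<lambda>r. ennreal (int_vol (append_row (transpose_mat ?z) r) powr \<alpha>)"
  have H: "?H \<in> borel_measurable (haar_prod {..<n} :: (nat \<Rightarrow> 'p padic) measure)"
    using measurable_int_vol_append_row[of "transpose_mat ?z"] by simp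
  have t: "bij_betw (\<lambda>i. (i, n)) {..<n} ({..<n} \<times> {n})"
    by (auto simp: bij_betw_def inj_on_def)
  have "Matrix.mat n (Suc n) (merge (mat_index n) ({..<n} \<times> {n}) (f, c))
      = Matrix.mat n (Suc n) (\<lambda>(i, j). if j < n then ?z $$ (i, j) else (\<lambda>i\<in>{..<n}. c (i, n)) i)" for c
    by (rule eq_matI) (auto simp: merge_def less_Suc_eq)
  then have eq: "int_vol (Matrix.mat n (Suc n) (merge (mat_index n) ({..<n} \<times> {n}) (f, c)))
      = int_vol (append_row (transpose_mat ?z) (\<lambda>i\<in>{..<n}. c (i, n)))" for c
    by (simp only: int_vol_append_col[of ?z n] mat_carrier)
  have "(\<integral>\<^sup>+ r. ?H r \<partial>haar_prod {..<n}) = ennreal (int_vol (transpose_mat ?z) powr (\<alpha> - 1)) * dual_const TYPE('p) n \<alpha>"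
    by (rule int_vol_append_row_integral[of _ n]) simp_all
  then show ?thesis
    unfolding eq haar_prod_reindex_integral[OF finite_lessThan t H]
    by (simp only: int_vol_transpose[of ?z n] mat_carrier)
qed

text \<open>The last row, of n + 1 entries, is integrated first at exponent \<alpha>; what remains
  of the last column has n entries and is integrated at exponent \<alpha> - 1. This order accounts
  for the arguments of the two constants.\<close>

lemma haar_fiber_integral:
  fixes \<phi> :: "(nat \<times> nat \<Rightarrow> 'p::prime_card padic) \<Rightarrow> ennreal"
  assumes \<phi>: "\<phi> \<in> borel_measurable (haar_prod (mat_index n))"
  shows "(\<integral>\<^sup>+ f. ennreal (int_vol (Matrix.mat (Suc n) (Suc n) f) powr \<alpha>) * \<phi> (restrict f (mat_index n))
      \<partial>haar_prod (mat_index (Suc n)))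
    = (\<integral>\<^sup>+ f. ennreal (int_vol (Matrix.mat n n f) powr (\<alpha> - 2)) * \<phi> f \<partial>haar_prod (mat_index n))
      * (dual_const TYPE('p) n (\<alpha> - 1) * dual_const TYPE('p) (Suc n) \<alpha>)"
proof -
  let ?I = "mat_index n" and ?K = "{..<n} \<times> {n}" and ?R = "{n} \<times> {..<Suc n}" and ?IK = "{..<n} \<times> {..<Suc n}"
  let ?C1 = "dual_const TYPE('p) (Suc n) \<alpha>" and ?C2 = "dual_const TYPE('p) n (\<alpha> - 1)"
  let ?F = "\<lambda>f. ennreal (int_vol (Matrix.mat (Suc n) (Suc n) f) powr \<alpha>) * \<phi> (restrict f ?I)"
  let ?G = "\<lambda>f. ennreal (int_vol (Matrix.mat n (Suc n) f) powr (\<alpha> - 1)) * \<phi> (restrict f ?I)"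
  have sets: "mat_index (Suc n) = ?IK \<union> ?R" "?IK = ?I \<union> ?K" "?IK \<inter> ?R = {}" "?I \<inter> ?K = {}"
    by auto
  have \<phi>m: "(\<lambda>f. \<phi> (restrict f ?I)) \<in> borel_measurable (haar_prod J)" if "?I \<subseteq> J" for J
    by (rule measurable_compose[OF measurable_restrict_subset[OF that] \<phi>])
  have F: "?F \<in> borel_measurable (haar_prod (?IK \<union> ?R))"
    by (rule borel_measurable_times_ennreal[OF measurable_int_vol_powr \<phi>m]) auto
  have G: "?G \<in> borel_measurable (haar_prod (?I \<union> ?K))"
    by (rule borel_measurable_times_ennreal[OF measurable_int_vol_powr \<phi>m]) auto
  have "(\<integral>\<^sup>+ f. ?F f \<partial>haar_prod (mat_index (Suc n)))
      = (\<integral>\<^sup>+ x. (\<integral>\<^sup>+ r. ?F (merge ?IK ?R (x, r)) \<partial>haar_prod ?R) \<partial>haar_prod ?IK)"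
    unfolding sets(1) by (rule padic_prod.product_nn_integral_fold[OF sets(3) _ _ F]) simp_all
  also have "\<dots> = (\<integral>\<^sup>+ x. ?G x * ?C1 \<partial>haar_prod ?IK)"
  proof (rule nn_integral_cong)
    fix x :: "nat \<times> nat \<Rightarrow> 'p padic"
    let ?Q = "\<lambda>r. ennreal (int_vol (Matrix.mat (Suc n) (Suc n) (merge ?IK ?R (x, r))) powr \<alpha>)"
    assume x: "x \<in> space (haar_prod ?IK)"
    \<comment> \<open>The test function sees only the upper left block, so it is constant in the
      inner integral and can be taken out.\<close>
    have res: "restrict (merge ?IK ?R (x, r)) ?I = restrict x ?I" for r
      by (auto simp: fun_eq_iff merge_def restrict_def)
    have "(\<lambda>r. merge ?IK ?R (x, r)) \<in> haar_prod ?R \<rightarrow>\<^sub>M haar_prod (?IK \<union> ?R)"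
      by (rule measurable_compose[OF measurable_Pair1'[OF x] measurable_merge])
    then have "?Q \<in> borel_measurable (haar_prod ?R)"
      by (rule measurable_compose[OF _ measurable_int_vol_powr]) auto
    then have "(\<integral>\<^sup>+ r. ?Q r * \<phi> (restrict x ?I) \<partial>haar_prod ?R) = (\<integral>\<^sup>+ r. ?Q r \<partial>haar_prod ?R) * \<phi> (restrict x ?I)"
      by (rule nn_integral_multc)
    then show "(\<integral>\<^sup>+ r. ?F (merge ?IK ?R (x, r)) \<partial>haar_prod ?R) = ?G x * ?C1"
      by (simp only: res haar_fiber_row_integral mult_ac)
  qed
  also have "\<dots> = (\<integral>\<^sup>+ x. ?G x \<partial>haar_prod ?IK) * ?C1"
    by (rule nn_integral_multc) (use G sets(2) in simp)
  also have "(\<integral>\<^sup>+ x. ?G x \<partial>haar_prod ?IK)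
      = (\<integral>\<^sup>+ f. (\<integral>\<^sup>+ c. ?G (merge ?I ?K (f, c)) \<partial>haar_prod ?K) \<partial>haar_prod ?I)"
    unfolding sets(2) by (rule padic_prod.product_nn_integral_fold[OF sets(4) _ _ G]) simp_all
  also have "\<dots> = (\<integral>\<^sup>+ f. ennreal (int_vol (Matrix.mat n n f) powr (\<alpha> - 2)) * \<phi> f * ?C2 \<partial>haar_prod ?I)"
  proof (rule nn_integral_cong)
    fix f :: "nat \<times> nat \<Rightarrow> 'p padic"
    let ?Q = "\<lambda>c. ennreal (int_vol (Matrix.mat n (Suc n) (merge ?I ?K (f, c))) powr (\<alpha> - 1))"
    assume f: "f \<in> space (haar_prod ?I)"
    have res: "restrict (merge ?I ?K (f, c)) ?I = f" for c
      using f by (auto simp: fun_eq_iff merge_def restrict_def extensional_def)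
    have "(\<lambda>c. merge ?I ?K (f, c)) \<in> haar_prod ?K \<rightarrow>\<^sub>M haar_prod (?I \<union> ?K)"
      by (rule measurable_compose[OF measurable_Pair1'[OF f] measurable_merge])
    then have "?Q \<in> borel_measurable (haar_prod ?K)"
      by (rule measurable_compose[OF _ measurable_int_vol_powr]) auto
    then have "(\<integral>\<^sup>+ c. ?Q c * \<phi> f \<partial>haar_prod ?K) = (\<integral>\<^sup>+ c. ?Q c \<partial>haar_prod ?K) * \<phi> f"
      by (rule nn_integral_multc)
    moreover have "\<alpha> - 1 - 1 = \<alpha> - 2" by simp
    ultimately show "(\<integral>\<^sup>+ c. ?G (merge ?I ?K (f, c)) \<partial>haar_prod ?K)
        = ennreal (int_vol (Matrix.mat n n f) powr (\<alpha> - 2)) * \<phi> f * ?C2"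
      by (simp only: res haar_fiber_col_integral mult_ac)
  qed
  also have "\<dots> = (\<integral>\<^sup>+ f. ennreal (int_vol (Matrix.mat n n f) powr (\<alpha> - 2)) * \<phi> f \<partial>haar_prod ?I) * ?C2"
    by (rule nn_integral_multc) (rule borel_measurable_times_ennreal[OF measurable_int_vol_powr[OF order_refl] \<phi>])
  finally show ?thesis by (simp only: mult.assoc)
qed


section \<open>Transfer to the measures \<open>mu\<close> and the projection\<close>

lemma measurable_int_vol_borel_mat:
  "int_vol \<in> borel_measurable (borel_mat n :: 'p::prime_card padic mat measure)"
proof -
  have "(\<lambda>z. int_vol (Matrix.mat n n (mat_entries n z))) \<in> borel_measurable (borel_mat n :: 'p padic mat measure)"
    by (rule measurable_compose[OF measurable_mat_entries measurable_int_vol_mat]) simp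
  also have "?this \<longleftrightarrow> ?thesis"
    by (rule measurable_cong) (simp add: mat_of_mat_entries)
  finally show ?thesis .
qed

lemma gamma_powr_minus:
  assumes "z \<in> carrier_mat n n"
  shows "gamma z powr (- a) = int_vol (z :: 'p::prime_card padic mat) powr a"
  using int_vol_pos[OF assms] unfolding gamma_eq_inverse_int_vol[OF assms]
  by (simp add: powr_minus powr_divide)

lemma sets_vol [simp]: "sets (vol n) = sets (borel_mat n)"
  by (simp add: vol_eq)

lemma space_vol [simp]: "space (vol n) = carrier_mat n n"
  by (simp add: vol_eq)

lemma nn_integral_vol:
  assumes "g \<in> borel_measurable (borel_mat n :: 'p::prime_card padic mat measure)"
  shows "(\<integral>\<^sup>+ z. g z \<partial>vol n) = (\<integral>\<^sup>+ f. g (Matrix.mat n n f) \<partial>haar_prod (mat_index n))"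
  unfolding vol_eq by (rule nn_integral_distr[OF measurable_mat]) (simp add: assms)

lemma norm_const_eq:
  "norm_const TYPE('p::prime_card) n a
    = (\<integral>\<^sup>+ f. ennreal (int_vol (Matrix.mat n n f) powr a) \<partial>(haar_prod (mat_index n) :: (_ \<Rightarrow> 'p padic) measure))"
proof -
  have "norm_const TYPE('p) n a = (\<integral>\<^sup>+ z. ennreal (int_vol z powr a) \<partial>(vol n :: 'p padic mat measure))"
    unfolding norm_const_def by (rule nn_integral_cong) (simp add: gamma_powr_minus)
  also have "\<dots> = (\<integral>\<^sup>+ f. ennreal (int_vol (Matrix.mat n n f) powr a) \<partial>(haar_prod (mat_index n) :: (_ \<Rightarrow> 'p padic) measure))"
    by (rule nn_integral_vol) (use measurable_int_vol_borel_mat[of n, where 'p='p] in simp)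
  finally show ?thesis .
qed

lemma emeasure_mu:
  fixes X :: "'p::prime_card padic mat set"
  assumes X: "X \<in> sets (borel_mat n)"
  shows "emeasure (mu s n) X
    = (\<integral>\<^sup>+ f. ennreal (int_vol (Matrix.mat n n f) powr (s + 2 * real n)) * indicator X (Matrix.mat n n f)
        \<partial>haar_prod (mat_index n)) / norm_const TYPE('p) n (s + 2 * real n)"
proof -
  let ?a = "s + 2 * real n" and ?c = "norm_const TYPE('p) n (s + 2 * real n)"
  let ?V = "vol n :: 'p padic mat measure"
  have gp: "gamma z powr (- s - 2 * real n) = int_vol z powr ?a" if "z \<in> carrier_mat n n" for z :: "'p padic mat"
  proof -
    have "- s - 2 * real n = - ?a" by simp
    then show ?thesis using gamma_powr_minus[OF that, of ?a] by (simp only:)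
  qed
  have m1: "(\<lambda>z. ennreal (int_vol z powr ?a)) \<in> borel_measurable (borel_mat n :: 'p padic mat measure)"
    using measurable_int_vol_borel_mat[of n, where 'p='p] by simp
  have m2: "(\<lambda>z. ennreal (int_vol z powr ?a) * indicator X z) \<in> borel_measurable (borel_mat n)"
    by (intro borel_measurable_times_ennreal m1 borel_measurable_indicator X)
  \<comment> \<open>Measurability of the density is obtained through \<open>int_vol\<close>: the
    description behind \<open>gamma\<close> gives no direct access to it, but the two expressions
    agree on the whole space.\<close>
  have "(\<lambda>z. ennreal (int_vol z powr ?a) / ?c) \<in> borel_measurable ?V"
    using m1 by (simp add: divide_ennreal_def cong: measurable_cong_sets)
  also have "?this \<longleftrightarrow> (\<lambda>z. ennreal (gamma z powr (- s - 2 * real n)) / ?c) \<in> borel_measurable ?V"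
    by (rule measurable_cong) (simp add: gp)
  finally have m: "(\<lambda>z. ennreal (gamma z powr (- s - 2 * real n)) / ?c) \<in> borel_measurable ?V" .
  have "emeasure (mu s n) X = (\<integral>\<^sup>+ z. ennreal (gamma z powr (- s - 2 * real n)) / ?c * indicator X z \<partial>?V)"
    unfolding mu_def by (rule emeasure_density[OF m]) (simp add: X)
  also have "\<dots> = (\<integral>\<^sup>+ z. (ennreal (int_vol z powr ?a) * indicator X z) / ?c \<partial>?V)"
    by (rule nn_integral_cong) (simp add: gp ennreal_divide_times ennreal_times_divide)
  also have "\<dots> = (\<integral>\<^sup>+ z. ennreal (int_vol z powr ?a) * indicator X z \<partial>?V) / ?c"
    by (rule nn_integral_divide) (use m2 in \<open>simp cong: measurable_cong_sets\<close>)
  also have "(\<integral>\<^sup>+ z. ennreal (int_vol z powr ?a) * indicator X z \<partial>?V)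
      = (\<integral>\<^sup>+ f. ennreal (int_vol (Matrix.mat n n f) powr ?a) * indicator X (Matrix.mat n n f) \<partial>haar_prod (mat_index n))"
    by (rule nn_integral_vol[OF m2])
  finally show ?thesis .
qed

lemma sets_mu [simp]: "sets (mu s n) = sets (borel_mat n)"
  by (simp add: mu_def)

lemma space_mu [simp]: "space (mu s n) = carrier_mat n n"
  by (simp add: mu_def)

lemma upper_left_block_eq: "upper_left_block n z = Matrix.mat n n (\<lambda>ij. z $$ ij)"
  by (simp add: upper_left_block_def split_block_def Let_def)

lemma measurable_upper_left_block:
  "upper_left_block n \<in> borel_mat (Suc n) \<rightarrow>\<^sub>M (borel_mat n :: 'p::prime_card padic mat measure)"
proof -
  have sub: "mat_index n \<subseteq> mat_index (Suc n)" by auto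
  have "(\<lambda>z. Matrix.mat n n (restrict (mat_entries (Suc n) z) (mat_index n)))
      \<in> borel_mat (Suc n) \<rightarrow>\<^sub>M (borel_mat n :: 'p padic mat measure)"
    by (rule measurable_compose[OF measurable_compose[OF measurable_mat_entries measurable_restrict_subset[OF sub]] measurable_mat])
  moreover have "(\<lambda>z :: 'p padic mat. Matrix.mat n n (restrict (mat_entries (Suc n) z) (mat_index n))) = upper_left_block n"
    by (rule ext) (auto simp: upper_left_block_eq mat_entries_def)
  ultimately show ?thesis by (simp only:)
qed

theorem theorem1p3:
  fixes n :: nat and s :: real
  assumes "n \<ge> 1" and "s > -1"
  shows "distr (mu s (n + 1) :: 'p::prime_card padic mat measure) (borel_mat n) (upper_left_block n)
    = mu s n"
proof (rule measure_eqI)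
  fix X assume "X \<in> sets (distr (mu s (n + 1) :: 'p padic mat measure) (borel_mat n) (upper_left_block n))"
  then have X: "X \<in> sets (borel_mat n)" by simp
  let ?L = "haar_prod (mat_index n) :: (_ \<Rightarrow> 'p padic) measure"
  let ?L' = "haar_prod (mat_index (Suc n)) :: (_ \<Rightarrow> 'p padic) measure"
  define \<alpha> where "\<alpha> = s + 2 * real (Suc n)"
  define C where "C = dual_const TYPE('p) n (\<alpha> - 1) * dual_const TYPE('p) (Suc n) \<alpha>"
  let ?d = "\<lambda>f. ennreal (int_vol (Matrix.mat n n f :: 'p padic mat) powr (s + 2 * real n))"
  let ?d' = "\<lambda>f. ennreal (int_vol (Matrix.mat (Suc n) (Suc n) f :: 'p padic mat) powr \<alpha>)"
  have \<alpha>2: "\<alpha> - 2 = s + 2 * real n" by (simp add: \<alpha>_def)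
  have "C \<noteq> 0" by (simp add: C_def dual_const_nonzero)
  \<comment> \<open>Both exponents exceed their numbers of variables: \<alpha> - 1 = s + 2n + 1 > n
    and \<alpha> = s + 2n + 2 > n + 1. Cancelling \<open>C\<close> from a quotient of extended reals
    needs it finite and nonzero.\<close>
  moreover have "C < \<infinity>"
    using dual_const_finite[of n "\<alpha> - 1", where 'p='p] dual_const_finite[of "Suc n" \<alpha>, where 'p='p] assms
    by (simp add: C_def \<alpha>_def ennreal_mult_less_top)
  ultimately have C: "C \<noteq> 0" "C \<noteq> \<infinity>" by auto
  let ?Y = "upper_left_block n -` X \<inter> carrier_mat (Suc n) (Suc n)"
  have Y: "?Y \<in> sets (borel_mat (Suc n))"
    using measurable_sets[OF measurable_upper_left_block X] by simp
  have ulb: "upper_left_block n \<in> (mu s (n + 1) :: 'p padic mat measure) \<rightarrow>\<^sub>M borel_mat n"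
    using measurable_upper_left_block[of n, where 'p='p] by (simp cong: measurable_cong_sets)
  have \<phi>: "(\<lambda>f. indicator X (Matrix.mat n n f) :: ennreal) \<in> borel_measurable ?L"
    by (rule measurable_compose[OF measurable_mat borel_measurable_indicator[OF X]])
  have block: "upper_left_block n (Matrix.mat (Suc n) (Suc n) f) = Matrix.mat n n (restrict f (mat_index n))"
    for f :: "nat \<times> nat \<Rightarrow> 'p padic"
    by (auto simp: upper_left_block_eq intro!: eq_matI)
  \<comment> \<open>A matrix lies in \<open>?Y\<close> exactly when its block lies in
    \<open>X\<close>, so the test function is the indicator of \<open>X\<close>.\<close>
  have num: "(\<integral>\<^sup>+ f. ?d' f * indicator ?Y (Matrix.mat (Suc n) (Suc n) f) \<partial>?L')
      = (\<integral>\<^sup>+ f. ?d f * indicator X (Matrix.mat n n f) \<partial>?L) * C"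
    using haar_fiber_integral[OF \<phi>, of \<alpha>] by (simp add: indicator_def block \<alpha>2 C_def)
  \<comment> \<open>The same fibre identity with test function 1, which makes the two normalizing
    constants differ by exactly the factor \<open>C\<close>.\<close>
  have den: "norm_const TYPE('p) (Suc n) \<alpha> = norm_const TYPE('p) n (s + 2 * real n) * C"
    using haar_fiber_integral[of "\<lambda>_ :: nat \<times> nat \<Rightarrow> 'p padic. 1" n \<alpha>] by (simp add: norm_const_eq \<alpha>2 C_def)
  have "emeasure (distr (mu s (n + 1) :: 'p padic mat measure) (borel_mat n) (upper_left_block n)) X
      = emeasure (mu s (Suc n)) ?Y"
    by (subst emeasure_distr[OF ulb X]) simp
  also have "\<dots> = ((\<integral>\<^sup>+ f. ?d f * indicator X (Matrix.mat n n f) \<partial>?L) * C) / (norm_const TYPE('p) n (s + 2 * real n) * C)"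
    unfolding emeasure_mu[OF Y] \<alpha>_def[symmetric] by (simp only: num den)
  also have "\<dots> = (\<integral>\<^sup>+ f. ?d f * indicator X (Matrix.mat n n f) \<partial>?L) / norm_const TYPE('p) n (s + 2 * real n)"
    by (rule divide_mult_eq[OF C])
  also have "\<dots> = emeasure (mu s n) X" by (rule emeasure_mu[OF X, symmetric])
  finally show "emeasure (distr (mu s (n + 1) :: 'p padic mat measure) (borel_mat n) (upper_left_block n)) X
    = emeasure (mu s n) X" .
qed simp

end
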